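(* Let $\Omega=\{\omega_k\}_{k=1}^N$, $\omega_k=[a_k,b_k]$, be a finite family of intervals in $\mathbb{R}$ with $\sum_{k=1}^N \mathbf 1_{\omega_k}(x)\le B$ for all $x\in\mathbb{R}$. Then there exists a positive constant $K$, independent of $N$, $f$ and $\vec g$, such that the following holds. For every $f\in C_0^\infty(\mathbb{R})$ and every $\vec g=\{g_k\}_{k=1}^N$ with $g_k\in C_0^\infty(\mathbb{R})$ for each $k$, there exists a $\frac16$-sparse collection $\mathcal S$ of intervals (depending on $f$ and $\vec g$) such that $$ |\langle Tf,\vec g\rangle|\le K\sum_{I\in\mathcal S}|I|\,\langle f\rangle_{2,I}\,\langle|\vec g|\rangle_{I}. $$
   Context: $\mathbf 1_E$ is the characteristic function of $E$, and $\check h(x)=\int_{\mathbb{R}}h(\xi)e^{2\pi i x\xi}\,d\xi$ is the inverse Fourier transform. The bilinear form associated with the Littlewood--Paley square function of $\Omega$, $Tf(x)=\big(\sum_{k=1}^N|f*\check{\mathbf 1}_{\omega_k}(x)|^2\big)^{1/2}$, is $$\langle Tf,\vec g\rangle:=\sum_{k=1}^N\int_{\mathbb{R}} (f*\check{\mathbf 1}_{[a_k,b_k]})(x)\,g_k(x)\,dx .$$ Write $|\vec g(x)|:=\big(\sum_{k=1}^N|g_k(x)|^2\big)^{1/2}$. For an interval $I$ and $r\ge1$, $\langle h\rangle_{r,I}:=\big(\frac1{|I|}\int_I|h|^r\big)^{1/r}$ and $\langle h\rangle_I:=\langle h\rangle_{1,I}$. For $0<\eta<1$, a family $\mathcal S$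 of intervals is $\eta$-sparse if for each $I\in\mathcal S$ there is a set $E_I\subset I$ with $\eta|I|\le|E_I|$, and the sets $E_I$, $I\in\mathcal S$, are pairwise disjoint. *)

theory Defs
  imports "HOL-Analysis.Analysis"
begin

text \<open>The space of test functions, complex-valued: all iterated derivatives exist everywhere,
  and the support is compact.\<close>

definition nth_vderiv :: "nat \<Rightarrow> (real \<Rightarrow> complex) \<Rightarrow> real \<Rightarrow> complex" where
  "nth_vderiv n f = ((\<lambda>h x. vector_derivative h (at x)) ^^ n) f"

definition test_function :: "(real \<Rightarrow> complex) \<Rightarrow> bool" where
  "test_function f \<longleftrightarrow>
     (\<forall>n x. nth_vderiv n f differentiable (at x)) \<and> compact (closure {x. f x \<noteq> 0})"

definition inv_fourier :: "(real \<Rightarrow> complex) \<Rightarrow> real \<Rightarrow> complex" where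
  "inv_fourier h x = (LINT \<xi>|lborel. h \<xi> * exp (2 * of_real pi * \<i> * of_real x * of_real \<xi>))"

definition convolve :: "(real \<Rightarrow> complex) \<Rightarrow> (real \<Rightarrow> complex) \<Rightarrow> real \<Rightarrow> complex" where
  "convolve f h x = (LINT y|lborel. f (x - y) * h y)"

text \<open>The bilinear form of the square function of the intervals \<open>[a k, b k]\<close>, \<open>1 \<le> k \<le> N\<close>.
  It is bilinear, so \<open>g k\<close> is not conjugated.\<close>

definition sq_form ::
  "nat \<Rightarrow> (nat \<Rightarrow> real) \<Rightarrow> (nat \<Rightarrow> real) \<Rightarrow> (real \<Rightarrow> complex) \<Rightarrow> (nat \<Rightarrow> real \<Rightarrow> complex) \<Rightarrow> complex"
where
  "sq_form N a b f g =
     (\<Sum>k=1..N. LINT x|lborel. convolve f (inv_fourier (indicator {a k..b k})) x * g k x)"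

definition vec_abs :: "nat \<Rightarrow> (nat \<Rightarrow> real \<Rightarrow> complex) \<Rightarrow> real \<Rightarrow> real" where
  "vec_abs N g x = sqrt (\<Sum>k=1..N. (cmod (g k x))\<^sup>2)"

definition avg :: "real \<Rightarrow> real set \<Rightarrow> (real \<Rightarrow> 'a::real_normed_vector) \<Rightarrow> real" where
  "avg r I h = ((1 / measure lborel I) * (LINT x:I|lborel. norm (h x) powr r)) powr (1 / r)"

text \<open>Members of a sparse family are bounded intervals of positive length, open, closed or
  half-open; this is what makes the averages over them meaningful.\<close>

definition sparse_family :: "real \<Rightarrow> real set set \<Rightarrow> bool" where
  "sparse_family \<eta> S \<longleftrightarrow>
     (\<forall>I\<in>S. is_interval I \<and> bounded I \<and> 0 < measure lborel I) \<and>
     (\<exists>E. (\<forall>I\<in>S. E I \<in> sets lebesgue \<and> E I \<subseteq> I \<and>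
                 \<eta> * measure lborel I \<le> measure lebesgue (E I)) \<and>
          disjoint_family_on E S)"

text \<open>The right-hand side: a sum of nonnegative terms over a possibly infinite family,
  valued in \<open>[0, \<infinity>]\<close>.\<close>

definition sparse_form ::
  "real set set \<Rightarrow> nat \<Rightarrow> (real \<Rightarrow> complex) \<Rightarrow> (nat \<Rightarrow> real \<Rightarrow> complex) \<Rightarrow> ennreal"
where
  "sparse_form S N f g =
     (\<Sum>\<^sub>\<infinity>I\<in>S. ennreal (measure lborel I * avg 2 I f * avg 1 I (vec_abs N g)))"

end

theory Submission
  imports Defs "HOL-Probability.Characteristic_Functions"
begin

text \<open>A sparse recursion with sharp frequency cutoffs, run on the local forms
  \<open>\<Lambda>\<^sub>I = \<Lambda>(f 1\<^bsub>3I\<^esub>, g 1\<^sub>I)\<close>. Let \<open>J\<close> run over the stopping intervals of \<open>I\<close>, and subtract from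
  \<open>g\<^sub>k 1\<^sub>J\<close> a function of size \<open>\<langle>|g|\<rangle>\<^sub>J\<close> with the same Fourier coefficients at the two endpoints \<open>a\<^sub>k\<close>, \<open>b\<^sub>k\<close>.
  The subtracted functions are controlled by the \<open>L\<^sup>2\<close> bound, which is Bessel's inequality and the bounded overlap.
  For the remainder, the cancellation at \<open>a\<^sub>k\<close> and \<open>b\<^sub>k\<close> turns the kernel
  \<open>K\<^sub>k(x - y) = (e(b\<^sub>k(x - y)) - e(a\<^sub>k(x - y))) / (2 \<pi> i (x - y))\<close>, with \<open>e(t) = exp(2 \<pi> i t)\<close>, into
  \<open>K\<^sub>k(x - y) (c - x) / (c - y)\<close> away from \<open>3J\<close>; a one-dimensional Sobolev inequality in frequency bounds
  the \<open>\<ell>\<^sup>2\<close> sum over \<open>k\<close>, so the off-diagonal part is summable. What is left is the sum of the \<open>\<Lambda>\<^sub>J\<close>.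
  The recursion is run to a finite dyadic depth; the forms on the shortest intervals are negligible because the
  kernels are bounded.\<close>

section \<open>Bounded functions of compact support\<close>

text \<open>A sharp cutoff leaves a kernel that decays only like 1 / |x - y|, with two numerators
  oscillating at unrelated frequencies, so a bad part that merely has mean zero gains nothing. Each
  bad piece must be orthogonal to the exponentials at \<open>a k\<close> and at \<open>b k\<close>
  at once, and the correction that achieves this must be bounded uniformly in both frequencies, even
  when they nearly coincide; \<open>rep_kern\<close> is built for that. The stopping rule looks only
  at averages of |g| and of |f|^2. The tail of |f|^2 in the off-diagonal estimate is not itself a
  stopping quantity: it is bounded by a geometric series over the ancestors, none of which stopped.
  Keeping \<open>f\<close> on the triple of the interval gives the distance that the off-diagonal
  estimate needs, at two costs. Triples of disjoint intervals overlap, so a Vitali selection with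
  factor 15 enters; with threshold 64 the stopped length is at most h/64 + 15h/64, below h/2. And
  the sparse family consists of the triples, so that one half of an interval becomes 1/6 of its
  triple.\<close>

definition bounded_cs :: "(real \<Rightarrow> complex) \<Rightarrow> bool" where
  "bounded_cs h \<longleftrightarrow> h \<in> borel_measurable borel \<and>
     (\<exists>M R. \<forall>x. cmod (h x) \<le> M * indicator {-R..R} x)"

lemma bounded_cs_measurable [measurable_dest]: "bounded_cs h \<Longrightarrow> h \<in> borel_measurable borel"
  by (simp add: bounded_cs_def)

lemma bounded_csI:
  assumes "h \<in> borel_measurable borel" "\<And>x. cmod (h x) \<le> M" "\<And>x. h x \<noteq> 0 \<Longrightarrow> \<bar>x\<bar> \<le> R"
  shows "bounded_cs h"
  unfolding bounded_cs_def
proof (intro conjI exI allI)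
  show "cmod (h x) \<le> M * indicator {-R..R} x" for x
    using assms(2)[of x] assms(3)[of x] by (cases "h x = 0") (auto simp: indicator_def)
qed fact

lemma bounded_csE:
  assumes "bounded_cs h"
  obtains M R where "h \<in> borel_measurable borel" "M > 0" "R > 0" "\<And>x. cmod (h x) \<le> M"
    "\<And>x. \<bar>x\<bar> > R \<Longrightarrow> h x = 0"
proof -
  from assms obtain M R where h: "h \<in> borel_measurable borel"
    and b: "\<And>x. cmod (h x) \<le> M * indicator {-R..R} x"
    unfolding bounded_cs_def by blast
  show thesis
  proof (rule that[of "\<bar>M\<bar> + 1" "\<bar>R\<bar> + 1"])
    show "cmod (h x) \<le> \<bar>M\<bar> + 1" for x
      using b[of x] by (auto simp: indicator_def of_bool_def split: if_splits)
    show "h x = 0" if "\<bar>x\<bar> > \<bar>R\<bar> + 1" for x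
      using b[of x] that by (auto simp: indicator_def of_bool_def split: if_splits)
  qed (use h in auto)
qed

lemma bounded_cs_indicator [intro]: "bounded_cs (indicator {a..b})" "bounded_cs (indicator {a..<b})"
  by (rule bounded_csI[of _ 1 "\<bar>a\<bar> + \<bar>b\<bar>"]; auto simp: indicator_def of_bool_def split: if_splits)+

lemma bounded_cs_diff [intro]:
  assumes "bounded_cs f" "bounded_cs g"
  shows "bounded_cs (\<lambda>x. f x - g x)"
proof -
  obtain M R where 1: "f \<in> borel_measurable borel" "M > 0" "R > 0" "\<And>x. cmod (f x) \<le> M"
    "\<And>x. \<bar>x\<bar> > R \<Longrightarrow> f x = 0" using assms(1) by (rule bounded_csE) blast
  obtain M' R' where 2: "g \<in> borel_measurable borel" "M' > 0" "R' > 0" "\<And>x. cmod (g x) \<le> M'"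
    "\<And>x. \<bar>x\<bar> > R' \<Longrightarrow> g x = 0" using assms(2) by (rule bounded_csE) blast
  show ?thesis
  proof (rule bounded_csI[of _ "M + M'" "R + R'"])
    show "cmod (f x - g x) \<le> M + M'" for x
      using norm_triangle_ineq4[of "f x" "g x"] 1(4)[of x] 2(4)[of x] by linarith
    show "\<bar>x\<bar> \<le> R + R'" if "f x - g x \<noteq> 0" for x
      using 1(5)[of x] 2(5)[of x] 1(3) 2(3) that by (cases "f x = 0") force+
  qed (use 1(1) 2(1) in measurable)
qed

lemma bounded_cs_0 [intro]: "bounded_cs (\<lambda>x. 0)"
  by (rule bounded_csI[of _ 0 0]) auto

lemma bounded_cs_mult:
  assumes "bounded_cs f" "w \<in> borel_measurable borel" "\<And>x. f x \<noteq> 0 \<Longrightarrow> cmod (w x) \<le> M"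
  shows "bounded_cs (\<lambda>x. f x * w x)" "bounded_cs (\<lambda>x. w x * f x)"
proof -
  obtain M1 R where 1: "f \<in> borel_measurable borel" "M1 > 0" "R > 0" "\<And>x. cmod (f x) \<le> M1"
    "\<And>x. \<bar>x\<bar> > R \<Longrightarrow> f x = 0" using assms(1) by (rule bounded_csE) blast
  show *: "bounded_cs (\<lambda>x. f x * w x)"
  proof (rule bounded_csI[of _ "M1 * \<bar>M\<bar>" R])
    show "cmod (f x * w x) \<le> M1 * \<bar>M\<bar>" for x
    proof (cases "f x = 0")
      case False
      show ?thesis
        unfolding norm_mult by (intro mult_mono) (use 1 assms(3)[OF False] in auto)
    qed (use 1 in auto)
    show "\<bar>x\<bar> \<le> R" if "f x * w x \<noteq> 0" for x
      using 1(5)[of x] that by force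
  qed (use 1(1) assms(2) in measurable)
  then show "bounded_cs (\<lambda>x. w x * f x)" by (simp add: mult.commute)
qed

text \<open>The closure property that dictates the class: the recursion cuts \<open>f\<close> and
  \<open>g\<close> to intervals, which destroys continuity but neither boundedness nor compact
  support.\<close>

lemma bounded_cs_restrict:
  assumes "bounded_cs f" "A \<in> sets borel"
  shows "bounded_cs (\<lambda>x. indicator A x * f x)"
  by (rule bounded_cs_mult(2)[OF assms(1), of _ 1]) (use assms in \<open>auto simp: indicator_def\<close>)

lemma bounded_cs_sum [intro]:
  assumes "finite F" "\<And>i. i \<in> F \<Longrightarrow> bounded_cs (f i)"
  shows "bounded_cs (\<lambda>x. \<Sum>i\<in>F. f i x)"
  using assms
proof (induction F rule: finite_induct)
  case (insert j F)
  have "bounded_cs (\<lambda>x. f j x - (0 - (\<Sum>i\<in>F. f i x)))"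
    using insert by (intro bounded_cs_diff) auto
  then show ?case using insert by simp
qed auto

lemma bounded_cs_affine:
  assumes "bounded_cs f"
  shows "bounded_cs (\<lambda>x. f (t - x))"
proof -
  obtain M R where 1: "f \<in> borel_measurable borel" "M > 0" "R > 0" "\<And>x. cmod (f x) \<le> M"
    "\<And>x. \<bar>x\<bar> > R \<Longrightarrow> f x = 0" using assms(1) by (rule bounded_csE) blast
  show ?thesis
  proof (rule bounded_csI[of _ M "R + \<bar>t\<bar>"])
    show "\<bar>x\<bar> \<le> R + \<bar>t\<bar>" if "f (t - x) \<noteq> 0" for x
      using 1(5)[of "t - x"] that by force
  qed (use 1 in \<open>auto\<close>)
qed

lemma bounded_cs_integrable:
  assumes "bounded_cs f"
  shows "integrable lborel f"
proof -
  obtain M R where 1: "f \<in> borel_measurable borel" "M > 0" "R > 0" "\<And>x. cmod (f x) \<le> M"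
    "\<And>x. \<bar>x\<bar> > R \<Longrightarrow> f x = 0" using assms(1) by (rule bounded_csE) blast
  show ?thesis
  proof (rule Bochner_Integration.integrable_bound)
    show "integrable lborel (\<lambda>x. M * indicator {-R..R} x)"
      by (intro integrable_mult_right integrable_real_indicator) (auto simp: emeasure_lborel_Icc_eq)
    show "AE x in lborel. norm (f x) \<le> norm (M * indicator {-R..R} x)"
      using 1 by (intro AE_I2) (force simp: indicator_def)
  qed (use 1 in simp)
qed

lemma bounded_cs_norm_integrable:
  assumes "bounded_cs f"
  shows "integrable lborel (\<lambda>x. cmod (f x))" "integrable lborel (\<lambda>x. (cmod (f x))\<^sup>2)"
proof -
  show "integrable lborel (\<lambda>x. cmod (f x))"
    using bounded_cs_integrable[OF assms] by (rule integrable_norm)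
  obtain M R where 1: "f \<in> borel_measurable borel" "M > 0" "R > 0" "\<And>x. cmod (f x) \<le> M"
    "\<And>x. \<bar>x\<bar> > R \<Longrightarrow> f x = 0" using assms(1) by (rule bounded_csE) blast
  have "integrable lborel (\<lambda>x. cmod (f x * f x))"
    by (intro integrable_norm bounded_cs_integrable bounded_cs_mult(1)[of _ _ M])
       (use assms 1 in auto)
  then show "integrable lborel (\<lambda>x. (cmod (f x))\<^sup>2)"
    by (simp add: norm_mult power2_eq_square)
qed

lemma inv_fourier_cis: "inv_fourier h x = (LINT y|lborel. h y * cis (2 * pi * x * y))"
  unfolding inv_fourier_def cis_conv_exp by (simp add: mult_ac)

section \<open>Norm bounds and Fubini's theorem for bounded kernels\<close>

lemma norm_integral_le:
  fixes f :: "'a \<Rightarrow> 'b::{banach, second_countable_topology}"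
  assumes "integrable M g" "\<And>x. norm (f x) \<le> g x"
  shows "norm (integral\<^sup>L M f) \<le> integral\<^sup>L M g"
  by (rule order_trans[OF integral_norm_bound integral_mono'])
     (use assms order_trans[OF norm_ge_zero] in \<open>auto\<close>)

lemma integrable_pair_kernel:
  fixes p q :: "real \<Rightarrow> 'a::{real_normed_field, banach, second_countable_topology}"
  assumes p: "integrable lborel p" and q: "integrable lborel q"
    and w[measurable]: "(\<lambda>z. w (fst z) (snd z)) \<in> borel_measurable (borel \<Otimes>\<^sub>M borel)"
    and wb: "\<And>x y. norm (w x y) \<le> M"
  shows "integrable (lborel \<Otimes>\<^sub>M lborel) (\<lambda>(x, y). p x * q y * w x y)"
proof -
  note [measurable] = borel_measurable_integrable[OF p] borel_measurable_integrable[OF q]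
  have int: "integrable (lborel \<Otimes>\<^sub>M lborel) (\<lambda>(x, y). p x * q y)"
    using lborel_pair.Fubini_integrable[of "\<lambda>(x,y). p x * q y"]
    by (auto simp: norm_mult p q integrable_mult_right integrable_mult_left integrable_norm)
  have wm: "(\<lambda>(x,y). w x y) \<in> borel_measurable (lborel \<Otimes>\<^sub>M lborel)"
    using w by (simp add: case_prod_beta)
  have "integrable (lborel \<Otimes>\<^sub>M lborel) (\<lambda>z. (case z of (x, y) \<Rightarrow> p x * q y) * (case z of (x,y) \<Rightarrow> w x y))"
  proof (rule Bochner_Integration.integrable_bound[OF integrable_mult_left[OF int, of "of_real M"]])
    show "AE x in lborel \<Otimes>\<^sub>M lborel. norm ((case x of (x, y) \<Rightarrow> p x * q y) * (case x of (x,y) \<Rightarrow> w x y))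
        \<le> norm ((case x of (x, y) \<Rightarrow> p x * q y) * of_real M)"
    proof (intro AE_I2)
      fix z :: "real \<times> real"
      show "norm ((case z of (x, y) \<Rightarrow> p x * q y) * (case z of (x,y) \<Rightarrow> w x y))
        \<le> norm ((case z of (x, y) \<Rightarrow> p x * q y) * of_real M)"
        using order_trans[OF wb[of "fst z" "snd z"] abs_ge_self]
        by (auto simp: norm_mult case_prod_beta intro!: mult_left_mono)
    qed
  qed (use wm in measurable)
  then show ?thesis unfolding case_prod_beta .
qed

text \<open>Two integrable factors times a bounded kernel: the shape of the interchanges below,
  where the kernel is an exponential, a Gaussian, \<open>kern\<close> or
  \<open>rep_kern\<close>.\<close>

lemma Fubini_kernel:
  fixes p q :: "real \<Rightarrow> 'a::{real_normed_field, banach, second_countable_topology}"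
  assumes p: "integrable lborel p" and q: "integrable lborel q"
    and w: "(\<lambda>z. w (fst z) (snd z)) \<in> borel_measurable (borel \<Otimes>\<^sub>M borel)"
    and wb: "\<And>x y. norm (w x y) \<le> M"
  shows "(LINT x|lborel. p x * (LINT y|lborel. q y * w x y)) = (LINT y|lborel. q y * (LINT x|lborel. p x * w x y))"
    and "integrable lborel (\<lambda>x. p x * (LINT y|lborel. q y * w x y))"
proof -
  note int = integrable_pair_kernel[OF assms]
  have "(LINT x|lborel. p x * (LINT y|lborel. q y * w x y)) = (LINT x|lborel. (LINT y|lborel. p x * q y * w x y))"
    by (simp add: mult.assoc)
  also have "\<dots> = (LINT y|lborel. (LINT x|lborel. p x * q y * w x y))"
    using lborel_pair.Fubini_integral[OF int, symmetric] .
  also have "\<dots> = (LINT y|lborel. (LINT x|lborel. q y * (p x * w x y)))"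
    by (simp add: mult_ac)
  also have "\<dots> = (LINT y|lborel. q y * (LINT x|lborel. p x * w x y))"
    by simp
  finally show "(LINT x|lborel. p x * (LINT y|lborel. q y * w x y)) = (LINT y|lborel. q y * (LINT x|lborel. p x * w x y))" .
  show "integrable lborel (\<lambda>x. p x * (LINT y|lborel. q y * w x y))"
    using lborel_pair.integrable_fst[OF int] by (simp add: mult.assoc)
qed

lemma measurable_cis [measurable]:
  "f \<in> borel_measurable M \<Longrightarrow> (\<lambda>x. cis (f x)) \<in> borel_measurable M"
  by (rule measurable_compose[of f M borel cis]) (auto intro!: borel_measurable_continuous_onI continuous_intros)

lemma measurable_inv_fourier [measurable]:
  assumes "bounded_cs h"
  shows "inv_fourier h \<in> borel_measurable borel"
proof -
  note [measurable] = bounded_cs_measurable[OF assms]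
  show ?thesis unfolding inv_fourier_cis[abs_def] by measurable
qed

lemma inv_fourier_bound:
  assumes "bounded_cs h"
  shows "cmod (inv_fourier h x) \<le> (LINT y|lborel. cmod (h y))"
  unfolding inv_fourier_cis by (rule order_trans[OF integral_norm_bound]) (simp add: norm_mult)

section \<open>Bessel's inequality for the Fourier transform\<close>

text \<open>A Gaussian of height 1 that tends to 1 pointwise as \<open>n\<close> grows. Writing it
  through \<open>std_normal_density\<close> makes its transform available from the characteristic
  function of the normal distribution.\<close>

definition gauss :: "real \<Rightarrow> real \<Rightarrow> real" where
  "gauss n x = sqrt (2 * pi) * std_normal_density (x / n)"

lemma gauss_eq: "gauss n x = exp (- (x / n)\<^sup>2 / 2)"
  by (simp add: gauss_def std_normal_density_def)

lemma integrable_std_normal_affine: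
  assumes "c \<noteq> 0"
  shows "integrable lborel (\<lambda>x. std_normal_density (x / c))"
    "(LINT x|lborel. std_normal_density ((t - x) / c)) = \<bar>c\<bar>"
    "integrable lborel (\<lambda>x. std_normal_density ((t - x) / c))"
proof -
  have "integrable lborel (\<lambda>x. std_normal_density (0 + (1 / c) * x))"
    by (rule lborel_integrable_real_affine) (use assms in auto)
  then show "integrable lborel (\<lambda>x. std_normal_density (x / c))" by simp
  have "integrable lborel (\<lambda>x. std_normal_density (t / c + (- 1 / c) * x))"
    by (rule lborel_integrable_real_affine) (use assms in auto)
  then show "integrable lborel (\<lambda>x. std_normal_density ((t - x) / c))"
    by (simp add: diff_divide_distrib)
  have "1 = \<bar>- 1 / c\<bar> *\<^sub>R (LINT x|lborel. std_normal_density (t / c + (- 1 / c) * x))"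
    by (subst lborel_integral_real_affine[symmetric]) (use assms in auto)
  also have "(\<lambda>x. std_normal_density (t / c + (- 1 / c) * x)) = (\<lambda>x. std_normal_density ((t - x) / c))"
    by (simp add: diff_divide_distrib)
  finally have "1 = \<bar>- 1 / c\<bar> * (LINT x|lborel. std_normal_density ((t - x) / c))"
    by (simp only: real_scaleR_def)
  then have "\<bar>c\<bar> = \<bar>c\<bar> * (\<bar>- 1 / c\<bar> * (LINT x|lborel. std_normal_density ((t - x) / c)))"
    by (metis mult.right_neutral)
  also have "\<dots> = (LINT x|lborel. std_normal_density ((t - x) / c))"
    using assms by (simp add: mult.assoc[symmetric])
  finally show "(LINT x|lborel. std_normal_density ((t - x) / c)) = \<bar>c\<bar>" ..
qed

text \<open>Rescaling by \<open>n\<close> reduces this to the characteristic function of the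
  standard normal law. The right-hand side is a probability density in \<open>t\<close>,
  concentrated at scale 1 / (2 pi n).\<close>

lemma inv_fourier_gauss:
  assumes n: "n > 0"
  shows "inv_fourier (\<lambda>x. of_real (gauss n x)) t = of_real (2 * pi * n * std_normal_density (t * (2 * pi * n)))"
proof -
  have "inv_fourier (\<lambda>x. of_real (gauss n x)) t
      = \<bar>n\<bar> *\<^sub>R (LINT x|lborel. of_real (gauss n (0 + n * x)) * cis (2 * pi * t * (0 + n * x)))"
    unfolding inv_fourier_cis by (rule lborel_integral_real_affine) (use n in auto)
  also have "\<dots> = of_real (n * sqrt (2 * pi)) * (LINT x|lborel. std_normal_density x *\<^sub>R cis (2 * pi * t * n * x))"
    using n unfolding integral_mult_right_zero[symmetric] integral_scaleR_right[symmetric]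
    by (intro Bochner_Integration.integral_cong) (auto simp: gauss_def scaleR_conv_of_real mult_ac)
  also have "(LINT x|lborel. std_normal_density x *\<^sub>R cis (2 * pi * t * n * x))
      = char std_normal_distribution (2 * pi * t * n)"
    unfolding char_def cis_conv_exp
    by (subst integral_density) (auto simp: mult_ac)
  also have "\<dots> = of_real (exp (- (2 * pi * t * n)\<^sup>2 / 2))"
    by (simp add: char_std_normal_distribution)
  finally have "inv_fourier (\<lambda>x. of_real (gauss n x)) t
      = of_real (n * sqrt (2 * pi) * exp (- (2 * pi * t * n)\<^sup>2 / 2))"
    by simp
  also have "n * sqrt (2 * pi) * exp (- (2 * pi * t * n)\<^sup>2 / 2)
      = 2 * pi * n * std_normal_density (t * (2 * pi * n))"
  proof -
    have "sqrt (2 * pi) = 2 * pi / sqrt (2 * pi)" by (simp add: real_div_sqrt)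
    then have "n * sqrt (2 * pi) * exp (- (2 * pi * t * n)\<^sup>2 / 2)
       = n * (2 * pi / sqrt (2 * pi)) * exp (- (2 * pi * t * n)\<^sup>2 / 2)" by simp
    moreover have "2 * pi * t * n = t * (2 * pi * n)" by simp
    ultimately show ?thesis by (simp only: std_normal_density_def) simp
  qed
  finally show ?thesis .
qed

lemma integrable_gauss: "n > 0 \<Longrightarrow> integrable lborel (gauss n)"
  unfolding gauss_def by (intro integrable_mult_right integrable_std_normal_affine) auto

lemma gauss_nonneg: "gauss n x \<ge> 0"
  by (auto simp: gauss_eq)

text \<open>The weight makes all integrals absolutely convergent before the transform is known to be
  square integrable. Expanding the square gives a double integral of
  \<open>cnj (h x) * h y * V (y - x)\<close> with \<open>V\<close> a symmetric probability density,
  and the Schur test (2|h(x) h(y)| at most |h(x)|^2 + |h(y)|^2) finishes.\<close>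

lemma Bessel_gauss:
  assumes h: "bounded_cs h" and n: "n > 0"
  shows "(LINT x|lborel. gauss n x * (cmod (inv_fourier h x))\<^sup>2) \<le> (LINT x|lborel. (cmod (h x))\<^sup>2)"
proof -
  define H where "H = inv_fourier h"
  define V where "V t = 2 * pi * n * std_normal_density (t * (2 * pi * n))" for t
  obtain M R where hM: "h \<in> borel_measurable borel" "M > 0" "R > 0" "\<And>x. cmod (h x) \<le> M"
    "\<And>x. \<bar>x\<bar> > R \<Longrightarrow> h x = 0" using h by (rule bounded_csE) blast
  note [measurable] = hM(1)
  \<comment> \<open>A cutoff to a set outside which \<open>h\<close> vanishes; it supplies the
    integrable factor in \<open>x\<close> that \<open>Fubini_kernel\<close> asks for after the Schur
    step.\<close>
  define X :: "real \<Rightarrow> real" where "X = indicator {-R..R}"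
  have [measurable]: "H \<in> borel_measurable borel"
    unfolding H_def by (rule measurable_inv_fourier[OF h])
  have Hb: "cmod (H x) \<le> (LINT y|lborel. cmod (h y))" for x
    unfolding H_def by (rule inv_fourier_bound[OF h])
  have [measurable]: "V \<in> borel_measurable borel" unfolding V_def by measurable
  have V0: "V t \<ge> 0" for t using n by (simp add: V_def)
  have Vb: "norm (V t) \<le> 2 * pi * n" for t
  proof -
    have "std_normal_density s \<le> 1" for s
    proof -
      have "1 \<le> sqrt (2 * pi)" using pi_gt3 by simp
      then have "1 / sqrt (2 * pi) \<le> 1" by simp
      moreover have "exp (- s\<^sup>2 / 2) \<le> 1" by simp
      ultimately show ?thesis unfolding std_normal_density_def
        by (intro mult_le_one) auto
    qed
    then have "2 * pi * n * std_normal_density (t * (2 * pi * n)) \<le> 2 * pi * n * 1"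
      using n by (intro mult_left_mono) auto
    then show ?thesis using V0[of t] by (simp add: V_def)
  qed
  have Vint: "integrable lborel (\<lambda>x. V (t - x))" "(LINT x|lborel. V (t - x)) = 1" for t
  proof -
    have eq: "V (t - x) = 2 * pi * n * std_normal_density ((t - x) / (1 / (2 * pi * n)))" for x
      by (simp add: V_def)
    show "integrable lborel (\<lambda>x. V (t - x))"
      unfolding eq using n by (intro integrable_mult_right integrable_std_normal_affine) auto
    show "(LINT x|lborel. V (t - x)) = 1"
      unfolding eq integral_mult_right_zero
      using n by (subst integrable_std_normal_affine) auto
  qed
  have Vsym: "V (y - x) = V (x - y)" for x y
    by (simp add: V_def std_normal_density_def power2_eq_square algebra_simps)
  have gi: "integrable lborel (\<lambda>x. complex_of_real (gauss n x))"
    using integrable_gauss[OF n] by simp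
  have gHi: "integrable lborel (\<lambda>x. complex_of_real (gauss n x) * H x)"
  proof (rule Bochner_Integration.integrable_bound)
    show "integrable lborel (\<lambda>x. gauss n x * (LINT y|lborel. cmod (h y)))"
      by (intro integrable_mult_left integrable_gauss n)
    show "AE x in lborel. norm (complex_of_real (gauss n x) * H x) \<le> norm (gauss n x * (LINT y|lborel. cmod (h y)))"
      using gauss_nonneg[of n] by (intro AE_I2) (auto simp: norm_mult intro!: mult_left_mono order_trans[OF Hb])
  qed (simp add: gauss_def)
  have hi: "integrable lborel h" by (rule bounded_cs_integrable[OF h])
  have chi: "integrable lborel (\<lambda>x. cnj (h x))" using hi by simp
  \<comment> \<open>The damped Fourier inversion integral of \<open>h\<close> is a Gaussian average
    of \<open>h\<close>.\<close>
  have inner: "(LINT \<xi>|lborel. gauss n \<xi> * H \<xi> * cis (- 2 * pi * \<xi> * x)) = (LINT y|lborel. h y * V (y - x))" for x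
  proof -
    have gH: "gauss n \<xi> * H \<xi> * cis (- 2 * pi * \<xi> * x)
       = gauss n \<xi> * (LINT y|lborel. h y * cis (2 * pi * \<xi> * (y - x)))" for \<xi>
    proof -
      have "H \<xi> * cis (- 2 * pi * \<xi> * x) = (LINT y|lborel. h y * cis (2 * pi * \<xi> * y) * cis (- 2 * pi * \<xi> * x))"
        unfolding H_def inv_fourier_cis by simp
      also have "\<dots> = (LINT y|lborel. h y * cis (2 * pi * \<xi> * (y - x)))"
        by (intro Bochner_Integration.integral_cong) (auto simp: cis_mult mult.assoc algebra_simps)
      finally show ?thesis by (simp add: mult.assoc)
    qed
    have "(LINT \<xi>|lborel. gauss n \<xi> * H \<xi> * cis (- 2 * pi * \<xi> * x))
       = (LINT \<xi>|lborel. complex_of_real (gauss n \<xi>) * (LINT y|lborel. h y * cis (2 * pi * \<xi> * (y - x))))"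
      by (simp only: gH)
    also have "\<dots> = (LINT y|lborel. h y * (LINT \<xi>|lborel. complex_of_real (gauss n \<xi>) * cis (2 * pi * \<xi> * (y - x))))"
      by (rule Fubini_kernel(1)[OF gi hi, where M = 1]) auto
    also have "\<dots> = (LINT y|lborel. h y * V (y - x))"
    proof (intro Bochner_Integration.integral_cong refl arg_cong2[where f = "(*)"])
      fix y
      have "(LINT \<xi>|lborel. complex_of_real (gauss n \<xi>) * cis (2 * pi * \<xi> * (y - x)))
        = inv_fourier (\<lambda>x. of_real (gauss n x)) (y - x)"
        unfolding inv_fourier_cis by (intro Bochner_Integration.integral_cong refl) (simp add: mult_ac)
      then show "(LINT \<xi>|lborel. complex_of_real (gauss n \<xi>) * cis (2 * pi * \<xi> * (y - x))) = V (y - x)"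
        unfolding inv_fourier_gauss[OF n] V_def .
    qed
    finally show ?thesis .
  qed
  have cnjH: "cnj (H \<xi>) = (LINT x|lborel. cnj (h x) * cis (- 2 * pi * \<xi> * x))" for \<xi>
  proof -
    have "cnj (H \<xi>) = (LINT x|lborel. cnj (h x * cis (2 * pi * \<xi> * x)))"
      unfolding H_def inv_fourier_cis
      by (rule integral_bounded_linear[OF bounded_linear_cnj, symmetric])
        (intro bounded_cs_integrable bounded_cs_mult(1)[OF h, where M = 1]; simp)
    then show ?thesis by (simp add: cis_cnj)
  qed
  have "complex_of_real (LINT x|lborel. gauss n x * (cmod (H x))\<^sup>2)
     = (LINT x|lborel. gauss n x * H x * cnj (H x))"
    unfolding integral_complex_of_real[symmetric]
    by (intro Bochner_Integration.integral_cong) (auto simp: complex_norm_square[unfolded of_real_power] mult_ac)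
  also have "\<dots> = (LINT \<xi>|lborel. gauss n \<xi> * H \<xi> * (LINT x|lborel. cnj (h x) * cis (- 2 * pi * \<xi> * x)))"
    by (simp only: cnjH)
  also have "\<dots> = (LINT x|lborel. cnj (h x) * (LINT \<xi>|lborel. gauss n \<xi> * H \<xi> * cis (- 2 * pi * \<xi> * x)))"
    by (rule Fubini_kernel(1)[OF gHi chi, where M = 1]) auto
  also have "\<dots> = (LINT x|lborel. cnj (h x) * (LINT y|lborel. h y * V (y - x)))"
    unfolding inner ..
  finally have eq: "complex_of_real (LINT x|lborel. gauss n x * (cmod (H x))\<^sup>2)
     = (LINT x|lborel. cnj (h x) * (LINT y|lborel. h y * V (y - x)))" .
  have Xi: "integrable lborel X"
    unfolding X_def by (intro integrable_real_indicator) (auto simp: emeasure_lborel_Icc_eq)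
  note h2 = bounded_cs_norm_integrable[OF h]
  have X2: "integrable lborel (\<lambda>x. X x * (LINT y|lborel. (cmod (h y))\<^sup>2 * V (y - x)))"
    by (rule Fubini_kernel(2)[OF Xi h2(2), where M = "2 * pi * n"]) (use Vb in auto)
  have Vmult: "integrable lborel (\<lambda>y. p y * V (y - x))" if "integrable lborel p" for p :: "real \<Rightarrow> real" and x
  proof (rule Bochner_Integration.integrable_bound[OF integrable_mult_left[OF that, of "2 * pi * n"]])
    show "AE y in lborel. norm (p y * V (y - x)) \<le> norm (p y * (2 * pi * n))"
      unfolding norm_mult by (intro AE_I2 mult_left_mono order_trans[OF Vb]) auto
    show "(\<lambda>y. p y * V (y - x)) \<in> borel_measurable lborel"
      using borel_measurable_integrable[OF that] by measurable
  qed
  have "(LINT x|lborel. gauss n x * (cmod (H x))\<^sup>2) \<le> cmod (complex_of_real (LINT x|lborel. gauss n x * (cmod (H x))\<^sup>2))"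
    by simp
  also have "\<dots> \<le> (LINT x|lborel. ((cmod (h x))\<^sup>2 + X x * (LINT y|lborel. (cmod (h y))\<^sup>2 * V (y - x))) / 2)"
    unfolding eq
  proof (rule norm_integral_le)
    show "integrable lborel (\<lambda>x. ((cmod (h x))\<^sup>2 + X x * (LINT y|lborel. (cmod (h y))\<^sup>2 * V (y - x))) / 2)"
      using X2 h2(2) by simp
    fix x
    show "cmod (cnj (h x) * (LINT y|lborel. h y * V (y - x))) \<le> ((cmod (h x))\<^sup>2 + X x * (LINT y|lborel. (cmod (h y))\<^sup>2 * V (y - x))) / 2"
    proof (cases "\<bar>x\<bar> \<le> R")
      case True
      have "cmod (cnj (h x) * (LINT y|lborel. h y * V (y - x))) \<le> cmod (h x) * (LINT y|lborel. cmod (h y * V (y - x)))"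
        unfolding norm_mult complex_mod_cnj by (intro mult_left_mono norm_integral_le)
          (use Vmult[OF h2(1), of x] V0 in \<open>auto simp: norm_mult\<close>)
      also have "\<dots> = (LINT y|lborel. cmod (h x) * (cmod (h y) * V (y - x)))"
        using V0 by (simp add: norm_mult)
      also have "\<dots> \<le> (LINT y|lborel. ((cmod (h x))\<^sup>2 * V (x - y) + (cmod (h y))\<^sup>2 * V (y - x)) / 2)"
      proof (rule integral_mono)
        show "integrable lborel (\<lambda>y. cmod (h x) * (cmod (h y) * V (y - x)))"
          by (intro integrable_mult_right Vmult h2)
        show "integrable lborel (\<lambda>y. ((cmod (h x))\<^sup>2 * V (x - y) + (cmod (h y))\<^sup>2 * V (y - x)) / 2)"
          by (intro integrable_divide Bochner_Integration.integrable_add Vmult h2 integrable_mult_right Vint)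
        show "cmod (h x) * (cmod (h y) * V (y - x)) \<le> ((cmod (h x))\<^sup>2 * V (x - y) + (cmod (h y))\<^sup>2 * V (y - x)) / 2" for y
          using mult_right_mono[OF sum_squares_bound[of "cmod (h x)" "cmod (h y)"] V0[of "y - x"]]
          unfolding Vsym[of x y] by (simp add: algebra_simps)
      qed
      also have "\<dots> = ((cmod (h x))\<^sup>2 + (LINT y|lborel. (cmod (h y))\<^sup>2 * V (y - x))) / 2"
        by (simp add: Vint Vmult h2)
      finally show ?thesis using True by (simp add: X_def indicator_def abs_le_iff)
    next
      case False
      then show ?thesis using hM(5)[of x] by (auto simp: X_def indicator_def)
    qed
  qed
  also have "\<dots> = ((LINT x|lborel. (cmod (h x))\<^sup>2) + (LINT x|lborel. X x * (LINT y|lborel. (cmod (h y))\<^sup>2 * V (y - x)))) / 2"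
    using X2 h2(2) by simp
  also have "(LINT x|lborel. X x * (LINT y|lborel. (cmod (h y))\<^sup>2 * V (y - x)))
      = (LINT y|lborel. (cmod (h y))\<^sup>2 * (LINT x|lborel. X x * V (y - x)))"
    by (rule Fubini_kernel(1)[OF Xi h2(2), where M = "2 * pi * n"]) (use Vb in auto)
  also have "\<dots> \<le> (LINT y|lborel. (cmod (h y))\<^sup>2)"
  proof (rule integral_mono)
    show "integrable lborel (\<lambda>y. (cmod (h y))\<^sup>2 * (LINT x|lborel. X x * V (y - x)))"
      by (rule Fubini_kernel(2)[OF h2(2) Xi, where M = "2 * pi * n" and w = "\<lambda>y x. V (y - x)"]) (use Vb in auto)
    fix y
    have "(LINT x|lborel. X x * V (y - x)) \<le> (LINT x|lborel. V (y - x))"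
    proof (rule integral_mono)
      show "integrable lborel (\<lambda>x. X x * V (y - x))"
        by (subst Vsym) (rule Vmult[OF Xi])
      show "X x * V (y - x) \<le> V (y - x)" for x using V0[of "y - x"] by (auto simp: X_def indicator_def)
    qed (rule Vint)
    then show "(cmod (h y))\<^sup>2 * (LINT x|lborel. X x * V (y - x)) \<le> (cmod (h y))\<^sup>2"
      unfolding Vint using mult_left_mono by fastforce
  qed (rule h2)
  finally show ?thesis unfolding H_def by simp
qed

text \<open>Fatou's lemma removes the Gaussian weight as its width tends to infinity. Only the
  inequality of Plancherel's theorem results, which suffices for upper bounds. The widths are
  \<open>Suc n\<close> to stay positive.\<close>

lemma Bessel:
  assumes h: "bounded_cs h"
  shows "integrable lborel (\<lambda>x. (cmod (inv_fourier h x))\<^sup>2)"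
    and "(LINT x|lborel. (cmod (inv_fourier h x))\<^sup>2) \<le> (LINT x|lborel. (cmod (h x))\<^sup>2)"
proof -
  define H where "H = inv_fourier h"
  have [measurable]: "H \<in> borel_measurable borel"
    unfolding H_def by (rule measurable_inv_fourier[OF h])
  define I where "I = (LINT x|lborel. (cmod (h x))\<^sup>2)"
  have I0: "I \<ge> 0" unfolding I_def by simp
  have lim: "(\<lambda>n. gauss (real (Suc n)) x * (cmod (H x))\<^sup>2) \<longlonglongrightarrow> (cmod (H x))\<^sup>2" for x
  proof -
    have "(\<lambda>n. exp (- (x / real (Suc n))\<^sup>2 / 2) * (cmod (H x))\<^sup>2) \<longlonglongrightarrow> exp (- (0::real)\<^sup>2 / 2) * (cmod (H x))\<^sup>2"
      by (intro tendsto_intros LIMSEQ_Suc[OF lim_const_over_n]) auto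
    then show ?thesis by (simp add: gauss_eq)
  qed
  have "(\<integral>\<^sup>+x. ennreal ((cmod (H x))\<^sup>2) \<partial>lborel) \<le> (\<integral>\<^sup>+x. liminf (\<lambda>n. ennreal (gauss (real (Suc n)) x * (cmod (H x))\<^sup>2)) \<partial>lborel)"
    by (intro nn_integral_mono) (simp add: lim_imp_Liminf[OF _ tendsto_ennrealI[OF lim]] del: of_nat_Suc)
  also have "\<dots> \<le> liminf (\<lambda>n. \<integral>\<^sup>+x. ennreal (gauss (real (Suc n)) x * (cmod (H x))\<^sup>2) \<partial>lborel)"
    by (rule nn_integral_liminf) (simp add: gauss_eq)
  also have "\<dots> \<le> ennreal I"
  proof (rule order_trans[OF Liminf_le_Limsup Limsup_bounded])
    show "\<forall>\<^sub>F n in sequentially. (\<integral>\<^sup>+x. ennreal (gauss (real (Suc n)) x * (cmod (H x))\<^sup>2) \<partial>lborel) \<le> ennreal I"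
    proof (intro always_eventually allI)
      fix n
      have "integrable lborel (\<lambda>x. gauss (real (Suc n)) x * (cmod (H x))\<^sup>2)"
      proof (rule Bochner_Integration.integrable_bound)
        show "integrable lborel (\<lambda>x. gauss (real (Suc n)) x * (LINT y|lborel. cmod (h y))\<^sup>2)"
          by (intro integrable_mult_left integrable_gauss) auto
        show "AE x in lborel. norm (gauss (real (Suc n)) x * (cmod (H x))\<^sup>2) \<le> norm (gauss (real (Suc n)) x * (LINT y|lborel. cmod (h y))\<^sup>2)"
          using gauss_nonneg inv_fourier_bound[OF h]
          by (intro AE_I2) (auto simp: norm_mult H_def intro!: mult_left_mono power_mono)
      qed (simp add: gauss_eq)
      then have "(\<integral>\<^sup>+x. ennreal (gauss (real (Suc n)) x * (cmod (H x))\<^sup>2) \<partial>lborel)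
          = ennreal (LINT x|lborel. gauss (real (Suc n)) x * (cmod (H x))\<^sup>2)"
        by (rule nn_integral_eq_integral) (simp add: gauss_nonneg)
      also have "\<dots> \<le> ennreal I"
        unfolding I_def H_def by (intro ennreal_leI Bessel_gauss h) simp
      finally show "(\<integral>\<^sup>+x. ennreal (gauss (real (Suc n)) x * (cmod (H x))\<^sup>2) \<partial>lborel) \<le> ennreal I" .
    qed
  qed simp
  finally have *: "(\<integral>\<^sup>+x. ennreal ((cmod (H x))\<^sup>2) \<partial>lborel) \<le> ennreal I" .
  show int: "integrable lborel (\<lambda>x. (cmod (inv_fourier h x))\<^sup>2)"
    unfolding H_def[symmetric]
    by (rule integrableI_bounded) (use * in \<open>auto simp: le_less_trans\<close>)
  show "(LINT x|lborel. (cmod (inv_fourier h x))\<^sup>2) \<le> (LINT x|lborel. (cmod (h x))\<^sup>2)"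
    using * nn_integral_eq_integral[OF int] I0 unfolding H_def I_def by simp
qed

section \<open>The bilinear form and its \<open>L\<^sup>2\<close> bound\<close>

text \<open>Optimisation over t, with best value sqrt (v / u). It turns a weighted AM-GM bound,
  which can be integrated and summed termwise, into a Cauchy-Schwarz bound.\<close>

lemma le_sqrt_of_AM_GM:
  fixes x u v :: real
  assumes "\<And>t. t > 0 \<Longrightarrow> x \<le> (t * u + v / t) / 2" "u \<ge> 0" "v \<ge> 0"
  shows "x \<le> sqrt (u * v)"
proof (rule ccontr)
  assume "\<not> x \<le> sqrt (u * v)"
  then have x: "x > sqrt (u * v)" by simp
  then have x0: "x > 0" using assms(2,3) by (meson le_less_trans real_sqrt_ge_zero mult_nonneg_nonneg)
  consider "u = 0" | "v = 0" "u > 0" | "u > 0" "v > 0" using assms by linarith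
  then show False
  proof cases
    case 1
    \<comment> \<open>For u = 0 the optimal t is infinite. The finite choice t = v / x + 1, positive
      even for v = 0, already makes v / t at most x, against x being at most half of v / t.\<close>
    define w where "w = v / (v / x + 1)"
    have "x \<le> w / 2" using assms(1)[of "v / x + 1"] 1 x0 assms(3) by (simp add: add_nonneg_pos w_def)
    moreover have "w \<le> x" unfolding w_def using x0 assms(3) by (simp add: field_simps add_nonneg_pos)
    ultimately show False using x0 by linarith
  next
    case 2
    then show False using assms(1)[of "x / u"] x0 by simp
  next
    case 3
    have "x \<le> (sqrt (v / u) * u + v / sqrt (v / u)) / 2" using assms(1)[of "sqrt (v / u)"] 3 by simp
    moreover have "sqrt (v / u) * u = sqrt (u * v)"
      using 3 by (simp add: real_sqrt_divide real_sqrt_mult field_simps)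
    moreover have "v / sqrt (v / u) = sqrt (u * v)"
      using 3 by (simp add: real_sqrt_divide real_sqrt_mult field_simps)
    ultimately show False using x by simp
  qed
qed

section \<open>The kernel of one sharp band and its action on the frequency side\<close>

definition kern :: "real \<Rightarrow> real \<Rightarrow> real \<Rightarrow> complex" where
  "kern a b = inv_fourier (indicator {a..b})"

lemma measurable_kern [measurable]: "kern a b \<in> borel_measurable borel"
  unfolding kern_def by (rule measurable_inv_fourier) auto

lemma kern_bound: "a \<le> b \<Longrightarrow> cmod (kern a b u) \<le> b - a"
proof -
  assume "a \<le> b"
  moreover have "(\<lambda>y. cmod (indicator {a..b} y)) = indicator {a..b}"
    by (auto simp: indicator_def)
  ultimately show ?thesis
    using inv_fourier_bound[OF bounded_cs_indicator(1), of a b u] unfolding kern_def by simp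
qed

text \<open>The fundamental theorem of calculus in the frequency variable. The product form stays
  valid at u = 0, where the quotient formula for the kernel breaks down.\<close>

lemma kern_mult:
  assumes "a \<le> b"
  shows "2 * pi * \<i> * u * kern a b u = cis (2 * pi * b * u) - cis (2 * pi * a * u)"
proof -
  have "(LINT x|lborel. indicator {a..b} x *\<^sub>R (2 * pi * \<i> * u * cis (2 * pi * u * x)))
     = cis (2 * pi * u * b) - cis (2 * pi * u * a)"
  proof (rule integral_FTC_atLeastAtMost[OF assms])
    show "((\<lambda>x. cis (2 * pi * u * x)) has_vector_derivative 2 * pi * \<i> * u * cis (2 * pi * u * x)) (at x within {a..b})" for x
      using exp_scaleR_has_vector_derivative_right[of "2 * pi * \<i> * u" x "{a..b}"]
      by (simp add: cis_conv_exp scaleR_conv_of_real mult_ac)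
    show "continuous_on {a..b} (\<lambda>x. 2 * pi * \<i> * u * cis (2 * pi * u * x))"
      by (intro continuous_intros)
  qed
  moreover have "2 * pi * \<i> * u * kern a b u
      = (LINT x|lborel. indicator {a..b} x *\<^sub>R (2 * pi * \<i> * u * cis (2 * pi * u * x)))"
    unfolding kern_def inv_fourier_cis integral_mult_right_zero[symmetric]
    by (intro Bochner_Integration.integral_cong) (auto simp: indicator_def)
  ultimately show ?thesis by (simp add: mult_ac)
qed

text \<open>\<open>inv_fourier f (- \<xi>)\<close> is the forward Fourier transform of
  \<open>f\<close>, so this exhibits the convolution as a Fourier multiplier with a sharp
  cutoff.\<close>

lemma conv_kern_freq:
  assumes f: "bounded_cs f"
  shows "(LINT y|lborel. f y * kern a b (x - y))
      = (LINT \<xi>|lborel. (indicator {a..b} \<xi> * inv_fourier f (- \<xi>)) * cis (2 * pi * x * \<xi>))"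
proof -
  have "(LINT y|lborel. f y * kern a b (x - y))
      = (LINT \<xi>|lborel. indicator {a..b} \<xi> * (LINT y|lborel. f y * cis (2 * pi * (x - y) * \<xi>)))"
    unfolding kern_def inv_fourier_cis
    by (rule Fubini_kernel(1)[where M = 1]) (auto intro: bounded_cs_integrable f)
  also have "\<dots> = (LINT \<xi>|lborel. (indicator {a..b} \<xi> * inv_fourier f (- \<xi>)) * cis (2 * pi * x * \<xi>))"
  proof (intro Bochner_Integration.integral_cong refl)
    fix \<xi>
    have "(LINT y|lborel. f y * cis (2 * pi * (x - y) * \<xi>))
       = (LINT y|lborel. f y * cis (2 * pi * (- \<xi>) * y) * cis (2 * pi * x * \<xi>))"
      by (intro Bochner_Integration.integral_cong) (auto simp: cis_mult mult.assoc algebra_simps)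
    then show "indicator {a..b} \<xi> * (LINT y|lborel. f y * cis (2 * pi * (x - y) * \<xi>))
       = (indicator {a..b} \<xi> * inv_fourier f (- \<xi>)) * cis (2 * pi * x * \<xi>)"
      unfolding inv_fourier_cis by simp
  qed
  finally show ?thesis .
qed

definition band_form :: "real \<Rightarrow> real \<Rightarrow> (real \<Rightarrow> complex) \<Rightarrow> (real \<Rightarrow> complex) \<Rightarrow> complex" where
  "band_form a b f g = (LINT x|lborel. g x * (LINT y|lborel. f y * kern a b (x - y)))"

lemma bounded_cs_inv_fourier_restrict:
  assumes "bounded_cs f"
  shows "bounded_cs (\<lambda>\<xi>. indicator {a..b} \<xi> * inv_fourier f (- \<xi>))"
proof (rule bounded_cs_mult(1)[OF bounded_cs_indicator(1)])
  show "(\<lambda>\<xi>. inv_fourier f (- \<xi>)) \<in> borel_measurable borel"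
    using measurable_inv_fourier[OF assms] by measurable
  show "cmod (inv_fourier f (- \<xi>)) \<le> (LINT y|lborel. cmod (f y))" for \<xi>
    by (rule inv_fourier_bound[OF assms])
qed

lemma band_form_freq:
  assumes f: "bounded_cs f" and g: "bounded_cs g"
  shows "band_form a b f g
      = (LINT \<xi>|lborel. (indicator {a..b} \<xi> * inv_fourier f (- \<xi>)) * inv_fourier g \<xi>)"
proof -
  note P = bounded_cs_integrable[OF bounded_cs_inv_fourier_restrict[OF f, of a b]]
  have "band_form a b f g = (LINT x|lborel. g x * (LINT \<xi>|lborel. (indicator {a..b} \<xi> * inv_fourier f (- \<xi>)) * cis (2 * pi * \<xi> * x)))"
    unfolding band_form_def conv_kern_freq[OF f] by (simp only: mult_ac)
  also have "\<dots> = (LINT \<xi>|lborel. (indicator {a..b} \<xi> * inv_fourier f (- \<xi>)) * inv_fourier g \<xi>)"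
    unfolding inv_fourier_cis[of g]
    by (rule Fubini_kernel(1)[OF bounded_cs_integrable[OF g] P, where M = 1]) auto
  finally show ?thesis .
qed

lemma integrable_conv_kern:
  assumes f: "bounded_cs f" and ab: "a \<le> b"
  shows "integrable lborel (\<lambda>y. f y * kern a b (x - y))"
  by (intro bounded_cs_integrable bounded_cs_mult(1)[OF f, where M = "b - a"]) (auto intro: kern_bound ab)

lemma integrable_band_form:
  assumes f: "bounded_cs f" and g: "bounded_cs g" and ab: "a \<le> b"
  shows "integrable lborel (\<lambda>x. g x * (LINT y|lborel. f y * kern a b (x - y)))"
  by (rule Fubini_kernel(2)[where M = "b - a"]) (auto intro: bounded_cs_integrable f g kern_bound ab)

lemma band_form_diff:
  assumes "bounded_cs f" "bounded_cs f'" "bounded_cs g" "bounded_cs g'" "a \<le> b"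
  shows "band_form a b (\<lambda>x. f x - f' x) g = band_form a b f g - band_form a b f' g"
    "band_form a b f (\<lambda>x. g x - g' x) = band_form a b f g - band_form a b f g'"
  unfolding band_form_def
  by (simp_all add: left_diff_distrib right_diff_distrib Bochner_Integration.integral_diff
      integrable_band_form integrable_conv_kern assms)

lemma band_form_sum_right:
  assumes "finite F" "\<And>j. j \<in> F \<Longrightarrow> bounded_cs (g j)" "bounded_cs f" "a \<le> b"
  shows "band_form a b f (\<lambda>x. \<Sum>j\<in>F. g j x) = (\<Sum>j\<in>F. band_form a b f (g j))"
  unfolding band_form_def sum_distrib_right
  by (rule Bochner_Integration.integral_sum) (use assms in \<open>auto intro: integrable_band_form\<close>)

lemma bounded_cs_affine_integral:
  assumes "bounded_cs f"
  shows "(LINT x|lborel. (cmod (f (t - x)))\<^sup>2) = (LINT x|lborel. (cmod (f x))\<^sup>2)"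
  using lborel_integral_real_affine[of "-1" "\<lambda>x. (cmod (f x))\<^sup>2" t] by simp

lemma vec_abs_L2_set: "vec_abs N g x = L2_set (\<lambda>k. cmod (g k x)) {1..N}"
  by (simp add: vec_abs_def L2_set_def)

lemma vec_abs_nonneg [simp]: "vec_abs N g x \<ge> 0"
  by (simp add: vec_abs_L2_set)

lemma measurable_vec_abs [measurable]:
  assumes "\<And>k. k \<in> {1..N} \<Longrightarrow> g k \<in> borel_measurable borel"
  shows "vec_abs N g \<in> borel_measurable borel"
proof -
  have "(\<lambda>x. sqrt (\<Sum>k\<in>{1..N}. (cmod (g k x))\<^sup>2)) \<in> borel_measurable borel"
    by (intro borel_measurable_sum measurable_compose[OF _ borel_measurable_sqrt]
        borel_measurable_power borel_measurable_norm measurable_compose[OF assms]) (use assms in auto)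
  then show ?thesis unfolding vec_abs_def .
qed

lemma vec_abs_integrable:
  assumes g: "\<And>k. k \<in> {1..N} \<Longrightarrow> bounded_cs (g k)"
  shows "integrable lborel (vec_abs N g)" "integrable lborel (\<lambda>x. (vec_abs N g x)\<^sup>2)"
    "(LINT x|lborel. (vec_abs N g x)\<^sup>2) = (\<Sum>k=1..N. LINT x|lborel. (cmod (g k x))\<^sup>2)"
proof -
  have m: "vec_abs N g \<in> borel_measurable borel"
    by (rule measurable_vec_abs) (use g in \<open>auto intro: bounded_cs_measurable\<close>)
  show "integrable lborel (vec_abs N g)"
  proof (rule Bochner_Integration.integrable_bound)
    show "integrable lborel (\<lambda>x. \<Sum>k=1..N. cmod (g k x))"
      by (intro Bochner_Integration.integrable_sum bounded_cs_norm_integrable g) auto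
    show "AE x in lborel. norm (vec_abs N g x) \<le> norm (\<Sum>k=1..N. cmod (g k x))"
      unfolding vec_abs_L2_set by (intro AE_I2) (simp add: L2_set_le_sum sum_nonneg)
  qed (use m in simp)
  have eq: "(vec_abs N g x)\<^sup>2 = (\<Sum>k=1..N. (cmod (g k x))\<^sup>2)" for x
    by (simp add: vec_abs_def sum_nonneg)
  show "integrable lborel (\<lambda>x. (vec_abs N g x)\<^sup>2)"
    unfolding eq by (intro Bochner_Integration.integrable_sum bounded_cs_norm_integrable g) auto
  show "(LINT x|lborel. (vec_abs N g x)\<^sup>2) = (\<Sum>k=1..N. LINT x|lborel. (cmod (g k x))\<^sup>2)"
    unfolding eq by (intro Bochner_Integration.integral_sum bounded_cs_norm_integrable g) auto
qed

locale interval_family =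
  fixes N :: nat and a b :: "nat \<Rightarrow> real" and B :: real
  assumes a_le_b: "k \<in> {1..N} \<Longrightarrow> a k \<le> b k"
    and overlap: "(\<Sum>k=1..N. indicator {a k..b k} x) \<le> B"
begin

lemma B_nonneg: "B \<ge> 0"
  by (rule order_trans[OF _ overlap[of 0]]) (auto intro: sum_nonneg)

definition Form :: "(real \<Rightarrow> complex) \<Rightarrow> (nat \<Rightarrow> real \<Rightarrow> complex) \<Rightarrow> complex" where
  "Form f g = (\<Sum>k=1..N. band_form (a k) (b k) f (g k))"

text \<open>On the frequency side the bands overlap at most \<open>B\<close> times, so after
  Cauchy-Schwarz the transform of \<open>f\<close> is counted at most \<open>B\<close> times and
  each \<open>g k\<close> once; Bessel's inequality returns to physical space.\<close>

lemma Form_bound: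
  assumes f: "bounded_cs f" and g: "\<And>k. k \<in> {1..N} \<Longrightarrow> bounded_cs (g k)"
  shows "cmod (Form f g) \<le> sqrt (B * (LINT x|lborel. (cmod (f x))\<^sup>2) * (LINT x|lborel. (vec_abs N g x)\<^sup>2))"
proof (rule le_sqrt_of_AM_GM)
  define F where "F \<xi> = (cmod (inv_fourier f (- \<xi>)))\<^sup>2" for \<xi>
  define G where "G k \<xi> = (cmod (inv_fourier (g k) \<xi>))\<^sup>2" for k \<xi>
  have F: "integrable lborel F" "integral\<^sup>L lborel F \<le> (LINT x|lborel. (cmod (f x))\<^sup>2)"
  proof -
    have "integrable lborel (\<lambda>\<xi>. (cmod (inv_fourier f (0 + (-1) * \<xi>)))\<^sup>2)"
      by (rule lborel_integrable_real_affine[OF Bessel(1)[OF f]]) simp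
    then show "integrable lborel F" by (simp add: F_def[abs_def])
    have "integral\<^sup>L lborel F = (LINT \<xi>|lborel. (cmod (inv_fourier f \<xi>))\<^sup>2)"
      using lborel_integral_real_affine[of "-1" "\<lambda>\<xi>. (cmod (inv_fourier f \<xi>))\<^sup>2" 0]
      by (simp add: F_def[abs_def])
    then show "integral\<^sup>L lborel F \<le> (LINT x|lborel. (cmod (f x))\<^sup>2)"
      using Bessel(2)[OF f] by simp
  qed
  have G: "integrable lborel (G k)" "integral\<^sup>L lborel (G k) \<le> (LINT x|lborel. (cmod (g k x))\<^sup>2)"
    if "k \<in> {1..N}" for k
    using Bessel[OF g[OF that]] by (simp_all add: G_def[abs_def])
  show "0 \<le> B * (LINT x|lborel. (cmod (f x))\<^sup>2)" using B_nonneg by simp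
  show "0 \<le> (LINT x|lborel. (vec_abs N g x)\<^sup>2)" by simp
  fix t :: real assume t: "t > 0"
  have int: "integrable lborel (\<lambda>\<xi>. (indicator {a k..b k} \<xi> * inv_fourier f (- \<xi>)) * inv_fourier (g k) \<xi>)"
    if k: "k \<in> {1..N}" for k
    by (rule bounded_cs_integrable, rule bounded_cs_mult(1)[OF bounded_cs_inv_fourier_restrict[OF f]])
       (rule measurable_inv_fourier[OF g[OF k]], rule inv_fourier_bound[OF g[OF k]])
  \<comment> \<open>With the sum over \<open>k\<close> inside the integral, the overlap bound acts
    pointwise in \<xi> and \<open>N\<close> never enters.\<close>
  have "Form f g = (LINT \<xi>|lborel. (\<Sum>k=1..N. (indicator {a k..b k} \<xi> * inv_fourier f (- \<xi>)) * inv_fourier (g k) \<xi>))"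
    unfolding Form_def using f g int by (subst Bochner_Integration.integral_sum) (auto simp: band_form_freq)
  also have "cmod \<dots> \<le> (LINT \<xi>|lborel. (t * B * F \<xi> + (\<Sum>k=1..N. G k \<xi>) / t) / 2)"
  proof (rule norm_integral_le)
    show "integrable lborel (\<lambda>\<xi>. (t * B * F \<xi> + (\<Sum>k=1..N. G k \<xi>) / t) / 2)"
      by (intro integrable_divide Bochner_Integration.integrable_add integrable_mult_right
          Bochner_Integration.integrable_sum F G)
    fix \<xi>
    let ?p = "cmod (inv_fourier f (- \<xi>))" and ?q = "\<lambda>k. cmod (inv_fourier (g k) \<xi>)"
    have AG: "?p * ?q k \<le> (t * F \<xi> + G k \<xi> / t) / 2" for k
    proof -
      have "0 \<le> (t * ?p - ?q k)\<^sup>2 / t" using t by simp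
      also have "\<dots> = t * F \<xi> + G k \<xi> / t - 2 * (?p * ?q k)"
        using t by (simp add: F_def G_def power2_eq_square field_simps)
      finally show ?thesis by simp
    qed
    have "cmod (\<Sum>k=1..N. (indicator {a k..b k} \<xi> * inv_fourier f (- \<xi>)) * inv_fourier (g k) \<xi>)
      \<le> (\<Sum>k=1..N. (indicator {a k..b k} \<xi> * (t * F \<xi>) + G k \<xi> / t) / 2)"
    proof (rule sum_norm_le)
      fix k
      have "0 \<le> G k \<xi> / t" using t by (simp add: G_def)
      then show "cmod ((indicator {a k..b k} \<xi> * inv_fourier f (- \<xi>)) * inv_fourier (g k) \<xi>)
         \<le> (indicator {a k..b k} \<xi> * (t * F \<xi>) + G k \<xi> / t) / 2"
        using AG[of k] by (auto simp: indicator_def norm_mult)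
    qed
    also have "\<dots> = ((\<Sum>k=1..N. indicator {a k..b k} \<xi>) * (t * F \<xi>) + (\<Sum>k=1..N. G k \<xi>) / t) / 2"
      by (simp add: sum_distrib_right sum.distrib sum_divide_distrib[symmetric])
    also have "\<dots> \<le> (B * (t * F \<xi>) + (\<Sum>k=1..N. G k \<xi>) / t) / 2"
      by (intro divide_right_mono add_right_mono mult_right_mono overlap) (use t in \<open>auto simp: F_def\<close>)
    finally show "cmod (\<Sum>k=1..N. (indicator {a k..b k} \<xi> * inv_fourier f (- \<xi>)) * inv_fourier (g k) \<xi>)
       \<le> (t * B * F \<xi> + (\<Sum>k=1..N. G k \<xi>) / t) / 2"
      by (simp add: mult_ac)
  qed
  also have "\<dots> = (t * (B * integral\<^sup>L lborel F) + (\<Sum>k=1..N. integral\<^sup>L lborel (G k)) / t) / 2"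
  proof -
    have "integrable lborel (\<lambda>\<xi>. \<Sum>k=1..N. G k \<xi>)"
      "(LINT \<xi>|lborel. (\<Sum>k=1..N. G k \<xi>)) = (\<Sum>k=1..N. integral\<^sup>L lborel (G k))"
      by (intro Bochner_Integration.integrable_sum Bochner_Integration.integral_sum G; assumption)+
    then show ?thesis using F by (simp add: mult.assoc del: sum.cl_ivl_Suc)
  qed
  also have "\<dots> \<le> (t * (B * (LINT x|lborel. (cmod (f x))\<^sup>2)) + (LINT x|lborel. (vec_abs N g x)\<^sup>2) / t) / 2"
  proof -
    have "(LINT x|lborel. (vec_abs N g x)\<^sup>2) = (\<Sum>k=1..N. LINT x|lborel. (cmod (g k x))\<^sup>2)"
      by (rule vec_abs_integrable(3)) (rule g)
    then have "(\<Sum>k=1..N. integral\<^sup>L lborel (G k)) \<le> (LINT x|lborel. (vec_abs N g x)\<^sup>2)"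
      using sum_mono[of "{1..N}", OF G(2)] by simp
    then show ?thesis
      using F t B_nonneg by (intro divide_right_mono add_mono mult_left_mono) auto
  qed
  finally show "cmod (Form f g) \<le> (t * (B * (LINT x|lborel. (cmod (f x))\<^sup>2)) + (LINT x|lborel. (vec_abs N g x)\<^sup>2) / t) / 2" .
qed

end

section \<open>A Sobolev inequality in frequency and the off-diagonal estimate\<close>

lemma inv_fourier_increment:
  assumes \<psi>: "bounded_cs \<psi>" and rs: "r \<le> s"
  shows "inv_fourier \<psi> s - inv_fourier \<psi> r
    = (LINT \<xi>|lborel. indicator {r..s} \<xi> * inv_fourier (\<lambda>u. 2 * pi * \<i> * u * \<psi> u) \<xi>)"
proof -
  have int: "integrable lborel (\<lambda>u. \<psi> u * cis (c * u))" for c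
    by (intro bounded_cs_integrable bounded_cs_mult(1)[OF \<psi>, where M = 1]) auto
  obtain M R where 1: "\<psi> \<in> borel_measurable borel" "M > 0" "R > 0" "\<And>x. cmod (\<psi> x) \<le> M"
    "\<And>x. \<bar>x\<bar> > R \<Longrightarrow> \<psi> x = 0" using \<psi> by (rule bounded_csE) blast
  have b: "bounded_cs (\<lambda>u. (2 * pi * \<i> * u) * \<psi> u)"
  proof (rule bounded_cs_mult(2)[OF \<psi>])
    show "cmod (2 * pi * \<i> * complex_of_real u) \<le> 2 * pi * R" if "\<psi> u \<noteq> 0" for u
      using 1(5)[of u] that by (auto simp: norm_mult not_less[symmetric])
  qed measurable
  \<comment> \<open>Fubini replaces differentiation under the integral: the \<xi>-integral of the
    exponential is \<open>kern r s u\<close>, and \<open>kern_mult\<close> turns it into a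
    difference of two exponentials.\<close>
  have "(LINT \<xi>|lborel. indicator {r..s} \<xi> * inv_fourier (\<lambda>u. (2 * pi * \<i> * u) * \<psi> u) \<xi>)
     = (LINT u|lborel. ((2 * pi * \<i> * u) * \<psi> u) * (LINT \<xi>|lborel. indicator {r..s} \<xi> * cis (2 * pi * \<xi> * u)))"
    unfolding inv_fourier_cis
    by (rule Fubini_kernel(1)[OF _ bounded_cs_integrable[OF b], where M = 1]) (auto intro!: bounded_cs_integrable)
  also have "\<dots> = (LINT u|lborel. ((2 * pi * \<i> * u) * \<psi> u) * kern r s u)"
    unfolding kern_def inv_fourier_cis by (simp only: mult_ac)
  also have "\<dots> = (LINT u|lborel. \<psi> u * cis ((2 * pi * s) * u) - \<psi> u * cis ((2 * pi * r) * u))"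
  proof (intro Bochner_Integration.integral_cong refl)
    fix u
    have "((2 * pi * \<i> * u) * \<psi> u) * kern r s u = \<psi> u * ((2 * pi * \<i> * u) * kern r s u)"
      by (simp only: mult_ac)
    then show "((2 * pi * \<i> * u) * \<psi> u) * kern r s u = \<psi> u * cis ((2 * pi * s) * u) - \<psi> u * cis ((2 * pi * r) * u)"
      unfolding kern_mult[OF rs] by (simp only: right_diff_distrib)
  qed
  also have "\<dots> = inv_fourier \<psi> s - inv_fourier \<psi> r"
    unfolding inv_fourier_cis by (rule Bochner_Integration.integral_diff[OF int int])
  finally show ?thesis ..
qed

lemma interval_Cauchy_Schwarz:
  fixes H :: "real \<Rightarrow> complex"
  assumes "r \<le> s" and H: "integrable lborel (\<lambda>x. (cmod (H x))\<^sup>2)"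
  shows "cmod (LINT x|lborel. indicator {r..s} x * H x) \<le> sqrt ((s - r) * (LINT x|lborel. indicator {r..s} x * (cmod (H x))\<^sup>2))"
proof (rule le_sqrt_of_AM_GM)
  have int: "integrable lborel (\<lambda>x. indicator {r..s} x * (cmod (H x))\<^sup>2)"
    using integrable_mult_indicator[OF _ H, of "{r..s}"] by simp
  have int1: "integrable lborel (indicat_real {r..s})"
    by (intro integrable_real_indicator) (auto simp: emeasure_lborel_Icc_eq)
  fix t :: real assume t: "t > 0"
  have "cmod (LINT x|lborel. indicator {r..s} x * H x)
    \<le> (LINT x|lborel. (t * indicator {r..s} x + (indicator {r..s} x * (cmod (H x))\<^sup>2) / t) / 2)"
  proof (rule norm_integral_le)
    show "integrable lborel (\<lambda>x. (t * indicator {r..s} x + (indicator {r..s} x * (cmod (H x))\<^sup>2) / t) / 2)"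
      by (intro integrable_divide Bochner_Integration.integrable_add integrable_mult_right int int1)
    fix x
    have "0 \<le> (t - cmod (H x))\<^sup>2 / t" using t by simp
    also have "\<dots> = t + (cmod (H x))\<^sup>2 / t - 2 * cmod (H x)"
      using t by (simp add: power2_eq_square field_simps)
    finally show "cmod (indicator {r..s} x * H x) \<le> (t * indicator {r..s} x + (indicator {r..s} x * (cmod (H x))\<^sup>2) / t) / 2"
      by (auto simp: indicator_def)
  qed
  also have "\<dots> = (t * (s - r) + (LINT x|lborel. indicator {r..s} x * (cmod (H x))\<^sup>2) / t) / 2"
    using int int1 assms(1) by simp
  finally show "cmod (LINT x|lborel. indicator {r..s} x * H x)
     \<le> (t * (s - r) + (LINT x|lborel. indicator {r..s} x * (cmod (H x))\<^sup>2) / t) / 2" .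
qed (use assms(1) in auto)

text \<open>A one-dimensional Sobolev inequality for \<open>G\<close> with derivative \<open>H\<close>: on intervals shorter than
  \<open>1 / \<delta>\<close> the increment is controlled by \<open>H\<close> alone, on longer ones both endpoint values are averaged.\<close>

lemma increment_bound:
  fixes G H :: "real \<Rightarrow> complex"
  assumes inc: "\<And>r s. r \<le> s \<Longrightarrow> G s - G r = (LINT \<xi>|lborel. indicator {r..s} \<xi> * H \<xi>)"
    and G: "integrable lborel (\<lambda>x. (cmod (G x))\<^sup>2)" and H: "integrable lborel (\<lambda>x. (cmod (H x))\<^sup>2)"
    and \<delta>: "\<delta> > 0" and ab: "a \<le> b"
  shows "(cmod (G b - G a))\<^sup>2 \<le> 8 * (\<delta> * (LINT x|lborel. indicator {a..b} x * (cmod (G x))\<^sup>2)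
     + (LINT x|lborel. indicator {a..b} x * (cmod (H x))\<^sup>2) / \<delta>)"
proof -
  define P where "P = (LINT x|lborel. indicator {a..b} x * (cmod (G x))\<^sup>2)"
  define Q where "Q = (LINT x|lborel. indicator {a..b} x * (cmod (H x))\<^sup>2)"
  have intG: "integrable lborel (\<lambda>x. indicator {r..s} x * (cmod (G x))\<^sup>2)" for r s
    using integrable_mult_indicator[OF _ G, of "{r..s}"] by simp
  have intH: "integrable lborel (\<lambda>x. indicator {r..s} x * (cmod (H x))\<^sup>2)" for r s
    using integrable_mult_indicator[OF _ H, of "{r..s}"] by simp
  have P0: "P \<ge> 0" and Q0: "Q \<ge> 0" unfolding P_def Q_def by simp_all
  have *: "(cmod (G s - G r))\<^sup>2 \<le> (s - r) * Q" if "a \<le> r" "r \<le> s" "s \<le> b" for r s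
  proof -
    have "(LINT x|lborel. indicator {r..s} x * (cmod (H x))\<^sup>2) \<le> Q"
      unfolding Q_def using that by (intro integral_mono intH) (auto simp: indicator_def)
    then have "cmod (G s - G r) \<le> sqrt ((s - r) * Q)"
      unfolding inc[OF that(2)] using that
      by (intro order_trans[OF interval_Cauchy_Schwarz[OF that(2) H]] real_sqrt_le_mono mult_left_mono) auto
    then have "(cmod (G s - G r))\<^sup>2 \<le> (sqrt ((s - r) * Q))\<^sup>2" by (intro power_mono) auto
    then show ?thesis using that Q0 by simp
  qed
  have "(cmod (G b - G a))\<^sup>2 \<le> 8 * (\<delta> * P + Q / \<delta>)"
  proof (cases "b - a \<le> 1 / \<delta>")
    case True
    have "(cmod (G b - G a))\<^sup>2 \<le> (b - a) * Q" using * ab by simp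
    also have "\<dots> \<le> 1 / \<delta> * Q" using True Q0 by (intro mult_right_mono)
    also have "\<dots> \<le> 8 * (\<delta> * P + Q / \<delta>)"
    proof -
      have "0 \<le> \<delta> * P" "0 \<le> Q / \<delta>" using \<delta> P0 Q0 by auto
      then show ?thesis by simp
    qed
    finally show ?thesis .
  next
    case False
    \<comment> \<open>The window from \<open>c\<close> to \<open>d\<close> has length exactly
      \<open>1 / \<delta>\<close> and an endpoint at \<open>p\<close>; averaging over it costs a
      factor \<delta>, while the variation of \<open>G\<close> inside is at most Q / \<delta> in
      square.\<close>
    have endpoint: "(cmod (G p))\<^sup>2 \<le> 2 * (\<delta> * P + Q / \<delta>)"
      if cd: "a \<le> c" "d \<le> b" "d - c = 1 / \<delta>" "p = c \<or> p = d" for c d p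
    proof -
      have cd': "c \<le> d" using cd(3) \<delta> by (metis diff_ge_0_iff_ge divide_nonneg_nonneg less_imp_le zero_le_one)
      have pt: "(cmod (G p))\<^sup>2 \<le> 2 * (cmod (G t))\<^sup>2 + 2 * Q / \<delta>" if t: "t \<in> {c..d}" for t
      proof -
        have "(cmod (G p - G t))\<^sup>2 \<le> \<bar>p - t\<bar> * Q"
          using *[of t p] *[of p t] t cd by (auto simp: norm_minus_commute)
        also have "\<dots> \<le> 1 / \<delta> * Q"
          using t cd Q0 by (intro mult_right_mono) auto
        finally have 1: "(cmod (G p - G t))\<^sup>2 \<le> Q / \<delta>" by simp
        have "cmod (G p) \<le> cmod (G t) + cmod (G p - G t)" by norm
        then have "(cmod (G p))\<^sup>2 \<le> (cmod (G t) + cmod (G p - G t))\<^sup>2" by (intro power_mono) auto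
        also have "\<dots> \<le> 2 * (cmod (G t))\<^sup>2 + 2 * (cmod (G p - G t))\<^sup>2"
          using sum_squares_bound[of "cmod (G t)" "cmod (G p - G t)"] by (simp add: power2_sum)
        finally show ?thesis using 1 by simp
      qed
      have int1: "integrable lborel (indicat_real {c..d})"
        by (intro integrable_real_indicator) (auto simp: emeasure_lborel_Icc_eq)
      have "(cmod (G p))\<^sup>2 * (1 / \<delta>) = (LINT t|lborel. indicator {c..d} t * (cmod (G p))\<^sup>2)"
        using cd' cd(3) by simp
      also have "\<dots> \<le> (LINT t|lborel. 2 * (indicator {a..b} t * (cmod (G t))\<^sup>2) + indicator {c..d} t * (2 * Q / \<delta>))"
      proof (rule integral_mono)
        show "integrable lborel (\<lambda>t. indicator {c..d} t * (cmod (G p))\<^sup>2)"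
          by (intro integrable_mult_left int1)
        show "integrable lborel (\<lambda>t. 2 * (indicator {a..b} t * (cmod (G t))\<^sup>2) + indicator {c..d} t * (2 * Q / \<delta>))"
          by (intro Bochner_Integration.integrable_add integrable_mult_right integrable_mult_left int1 intG)
        show "indicator {c..d} t * (cmod (G p))\<^sup>2 \<le> 2 * (indicator {a..b} t * (cmod (G t))\<^sup>2) + indicator {c..d} t * (2 * Q / \<delta>)" for t
          using pt[of t] cd by (auto simp: indicator_def)
      qed
      also have "\<dots> = 2 * P + 1 / \<delta> * (2 * Q / \<delta>)"
        using int1 intG cd' cd(3) by (simp add: P_def)
      finally have "(cmod (G p))\<^sup>2 * (1 / \<delta>) * \<delta> \<le> (2 * P + 1 / \<delta> * (2 * Q / \<delta>)) * \<delta>"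
        using \<delta> by (intro mult_right_mono) auto
      then show ?thesis using \<delta> by (simp add: algebra_simps)
    qed
    have "(cmod (G a))\<^sup>2 \<le> 2 * (\<delta> * P + Q / \<delta>)" "(cmod (G b))\<^sup>2 \<le> 2 * (\<delta> * P + Q / \<delta>)"
      using endpoint[of a "a + 1 / \<delta>" a] endpoint[of "b - 1 / \<delta>" b b] False by auto
    moreover have "(cmod (G b - G a))\<^sup>2 \<le> 2 * (cmod (G b))\<^sup>2 + 2 * (cmod (G a))\<^sup>2"
    proof -
      have "cmod (G b - G a) \<le> cmod (G b) + cmod (G a)" by norm
      then have "(cmod (G b - G a))\<^sup>2 \<le> (cmod (G b) + cmod (G a))\<^sup>2" by (intro power_mono) auto
      also have "\<dots> \<le> 2 * (cmod (G b))\<^sup>2 + 2 * (cmod (G a))\<^sup>2"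
        using sum_squares_bound[of "cmod (G b)" "cmod (G a)"] by (simp add: power2_sum)
      finally show ?thesis .
    qed
    ultimately show ?thesis by linarith
  qed
  then show ?thesis unfolding P_def Q_def .
qed

context interval_family
begin

text \<open>As \<open>F\<close> vanishes near 0, it can be divided by 2 pi i u; the quotient \<psi>
  is at most |F| / h in modulus. By \<open>kern_mult\<close> the integral over \<open>u\<close> is
  the increment of \<open>G\<close>, the transform of \<psi>, across the band, and the derivative of
  \<open>G\<close> is the transform of \<open>F\<close>. In \<open>increment_bound\<close> the
  choice \<delta> = h balances both terms: after the overlap bound and Bessel's inequality each
  contributes 8 B / h times the square integral of \<open>F\<close>.\<close>

lemma sum_kern_sq_le:
  assumes F: "bounded_cs F" and supp: "\<And>u. F u \<noteq> 0 \<Longrightarrow> \<bar>u\<bar> \<ge> h" and h: "h > 0"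
  shows "(\<Sum>k=1..N. (cmod (LINT u|lborel. F u * kern (a k) (b k) u))\<^sup>2)
     \<le> 16 * B * (LINT u|lborel. (cmod (F u))\<^sup>2) / h"
proof -
  define \<psi> where "\<psi> u = F u * inverse (2 * pi * \<i> * u)" for u
  have \<psi>: "bounded_cs \<psi>" unfolding \<psi>_def
  proof (rule bounded_cs_mult(1)[OF F])
    show "cmod (inverse (2 * pi * \<i> * complex_of_real u)) \<le> 1 / h" if "F u \<noteq> 0" for u
    proof -
      have "h * 1 \<le> \<bar>u\<bar> * (2 * pi)" using supp[OF that] h pi_gt3 by (intro mult_mono) auto
      then have "h \<le> cmod (2 * pi * \<i> * complex_of_real u)" by (simp add: norm_mult mult_ac)
      then show ?thesis unfolding norm_inverse inverse_eq_divide[symmetric] using h by (rule le_imp_inverse_le)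
    qed
  qed measurable
  have F_eq: "2 * pi * \<i> * u * \<psi> u = F u" for u
  proof (cases "F u = 0")
    case False
    then have "2 * pi * \<i> * complex_of_real u \<noteq> 0" using supp[of u] h by auto
    then show ?thesis unfolding \<psi>_def by (metis mult.left_commute mult.right_neutral right_inverse)
  qed (simp add: \<psi>_def)
  define G where "G = inv_fourier \<psi>"
  define H where "H = inv_fourier F"
  have inc: "G s - G r = (LINT \<xi>|lborel. indicator {r..s} \<xi> * H \<xi>)" if "r \<le> s" for r s
    using inv_fourier_increment[OF \<psi> that] unfolding F_eq G_def H_def .
  have GI: "integrable lborel (\<lambda>x. (cmod (G x))\<^sup>2)" and HI: "integrable lborel (\<lambda>x. (cmod (H x))\<^sup>2)"
    unfolding G_def H_def by (intro Bessel \<psi> F)+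
  define M where "M = (LINT u|lborel. (cmod (F u))\<^sup>2)"
  have M0: "M \<ge> 0" unfolding M_def by simp
  have HM: "(LINT x|lborel. (cmod (H x))\<^sup>2) \<le> M" unfolding H_def M_def by (rule Bessel[OF F])
  have GM: "(LINT x|lborel. (cmod (G x))\<^sup>2) \<le> M / h\<^sup>2"
  proof -
    have "(LINT x|lborel. (cmod (G x))\<^sup>2) \<le> (LINT x|lborel. (cmod (\<psi> x))\<^sup>2)"
      unfolding G_def by (rule Bessel[OF \<psi>])
    also have "\<dots> \<le> (LINT x|lborel. (cmod (F x))\<^sup>2 / h\<^sup>2)"
    proof (intro integral_mono bounded_cs_norm_integrable \<psi> integrable_divide F)
      fix u
      show "(cmod (\<psi> u))\<^sup>2 \<le> (cmod (F u))\<^sup>2 / h\<^sup>2"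
      proof (cases "F u = 0")
        case False
        have "h * 1 \<le> \<bar>u\<bar> * (2 * pi)" using supp[OF False] h pi_gt3 by (intro mult_mono) auto
        then have "cmod (\<psi> u) * h \<le> cmod (\<psi> u) * (\<bar>u\<bar> * (2 * pi))"
          by (intro mult_left_mono) auto
        also have "\<dots> = cmod (F u)"
          unfolding F_eq[of u, symmetric] by (simp add: norm_mult)
        finally have "(cmod (\<psi> u) * h)\<^sup>2 \<le> (cmod (F u))\<^sup>2" using h by (intro power_mono) auto
        then show ?thesis using h by (simp add: field_simps power_mult_distrib)
      qed (simp add: \<psi>_def)
    qed
    also have "\<dots> = M / h\<^sup>2" by (simp add: M_def)
    finally show ?thesis .
  qed
  have overlap_int: "(\<Sum>k=1..N. LINT x|lborel. indicator {a k..b k} x * p x) \<le> B * integral\<^sup>L lborel p"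
    if p: "integrable lborel p" "\<And>x. p x \<ge> 0" for p
  proof -
    have int: "integrable lborel (\<lambda>x. indicator {r..s} x * p x)" for r s
      using integrable_mult_indicator[OF _ p(1), of "{r..s}"] by simp
    have "(\<Sum>k=1..N. LINT x|lborel. indicator {a k..b k} x * p x)
       = (LINT x|lborel. (\<Sum>k=1..N. indicator {a k..b k} x * p x))"
      by (rule Bochner_Integration.integral_sum[symmetric]) (rule int)
    also have "\<dots> \<le> (LINT x|lborel. B * p x)"
      using p overlap
      by (intro integral_mono Bochner_Integration.integrable_sum int integrable_mult_right)
        (auto simp: sum_distrib_right[symmetric] intro!: mult_right_mono)
    finally show ?thesis by simp
  qed
  have "(\<Sum>k=1..N. (cmod (LINT u|lborel. F u * kern (a k) (b k) u))\<^sup>2)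
    \<le> (\<Sum>k=1..N. 8 * (h * (LINT x|lborel. indicator {a k..b k} x * (cmod (G x))\<^sup>2)
           + (LINT x|lborel. indicator {a k..b k} x * (cmod (H x))\<^sup>2) / h))"
  proof (rule sum_mono)
    fix k assume k: "k \<in> {1..N}"
    have int: "integrable lborel (\<lambda>u. \<psi> u * cis (c * u))" for c
      by (intro bounded_cs_integrable bounded_cs_mult(1)[OF \<psi>, where M = 1]) auto
    have "(LINT u|lborel. F u * kern (a k) (b k) u)
        = (LINT u|lborel. \<psi> u * cis ((2 * pi * b k) * u) - \<psi> u * cis ((2 * pi * a k) * u))"
    proof (intro Bochner_Integration.integral_cong refl)
      fix u
      have "F u * kern (a k) (b k) u = \<psi> u * ((2 * pi * \<i> * u) * kern (a k) (b k) u)"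
        unfolding F_eq[of u, symmetric] by (simp only: mult_ac)
      then show "F u * kern (a k) (b k) u = \<psi> u * cis ((2 * pi * b k) * u) - \<psi> u * cis ((2 * pi * a k) * u)"
        unfolding kern_mult[OF a_le_b[OF k]] by (simp only: right_diff_distrib)
    qed
    also have "\<dots> = G (b k) - G (a k)"
      unfolding G_def inv_fourier_cis by (rule Bochner_Integration.integral_diff[OF int int])
    finally have eq: "(LINT u|lborel. F u * kern (a k) (b k) u) = G (b k) - G (a k)" .
    show "(cmod (LINT u|lborel. F u * kern (a k) (b k) u))\<^sup>2
      \<le> 8 * (h * (LINT x|lborel. indicator {a k..b k} x * (cmod (G x))\<^sup>2)
           + (LINT x|lborel. indicator {a k..b k} x * (cmod (H x))\<^sup>2) / h)"
      unfolding eq by (rule increment_bound[OF inc GI HI h a_le_b[OF k]])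
  qed
  also have "\<dots> = 8 * (h * (\<Sum>k=1..N. LINT x|lborel. indicator {a k..b k} x * (cmod (G x))\<^sup>2)
           + (\<Sum>k=1..N. LINT x|lborel. indicator {a k..b k} x * (cmod (H x))\<^sup>2) / h)"
    by (simp add: sum_distrib_left sum.distrib sum_divide_distrib distrib_left)
  also have "\<dots> \<le> 8 * (h * (B * (M / h\<^sup>2)) + (B * M) / h)"
    using h B_nonneg
    by (intro mult_left_mono add_mono divide_right_mono order_trans[OF overlap_int] GM HM GI HI) auto
  also have "\<dots> = 16 * B * M / h" using h by (simp add: field_simps power2_eq_square)
  finally show ?thesis unfolding M_def .
qed

text \<open>The cancellation at both endpoints of each band replaces the kernel \<open>K(x - y)\<close> by
  \<open>K(x - y) (l - x) / (l - y)\<close>, which supplies the missing decay.\<close>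

lemma Form_off_diagonal:
  assumes f: "bounded_cs f" and f0: "\<And>y. y \<in> {l - h..<l + 2 * h} \<Longrightarrow> f y = 0" and h: "h > 0"
    and \<beta>: "\<And>k. k \<in> {1..N} \<Longrightarrow> bounded_cs (\<beta> k)"
    and \<beta>0: "\<And>k x. k \<in> {1..N} \<Longrightarrow> x \<notin> {l..<l + h} \<Longrightarrow> \<beta> k x = 0"
    and ca: "\<And>k. k \<in> {1..N} \<Longrightarrow> inv_fourier (\<beta> k) (a k) = 0"
    and cb: "\<And>k. k \<in> {1..N} \<Longrightarrow> inv_fourier (\<beta> k) (b k) = 0"
  shows "cmod (Form f \<beta>) \<le> 4 * sqrt (B * h * (LINT y|lborel. (cmod (f y))\<^sup>2 / (y - l)\<^sup>2))
           * (LINT x|lborel. vec_abs N \<beta> x)"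
proof -
  define \<phi> where "\<phi> y = f y * inverse (complex_of_real (l - y))" for y
  have \<phi>: "bounded_cs \<phi>" unfolding \<phi>_def
  proof (rule bounded_cs_mult(1)[OF f])
    show "cmod (inverse (complex_of_real (l - y))) \<le> inverse h" if "f y \<noteq> 0" for y
    proof -
      have "h \<le> \<bar>l - y\<bar>" using f0[of y] that h by force
      then show ?thesis unfolding norm_inverse norm_of_real using h by (intro le_imp_inverse_le)
    qed
  qed measurable
  have f_eq: "f y = \<phi> y * (l - y)" for y
    using f0[of y] h by (cases "y = l") (auto simp: \<phi>_def)
  define S where "S = sqrt (16 * B * (LINT y|lborel. (cmod (\<phi> y))\<^sup>2) / h)"
  have form_eq: "band_form (a k) (b k) f (\<beta> k)
      = (LINT x|lborel. complex_of_real (l - x) * \<beta> k x * (LINT y|lborel. \<phi> y * kern (a k) (b k) (x - y)))"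
    if k: "k \<in> {1..N}" for k
  proof -
    note ab = a_le_b[OF k] and bk = \<beta>[OF k]
    let ?K = "kern (a k) (b k)"
    have bl: "bounded_cs (\<lambda>x. complex_of_real (l - x) * \<beta> k x)"
    proof (rule bounded_cs_mult(2)[OF bk])
      show "cmod (complex_of_real (l - x)) \<le> h" if "\<beta> k x \<noteq> 0" for x
        proof -
          have "x \<in> {l..<l + h}" using \<beta>0[OF k, of x] that by blast
          then show ?thesis by (auto simp del: of_real_diff)
        qed
    qed measurable
    have int: "integrable lborel (\<lambda>x. \<beta> k x * cis (c * x))" for c
      by (intro bounded_cs_integrable bounded_cs_mult(1)[OF bk, where M = 1]) auto
    have int\<phi>: "integrable lborel (\<lambda>x. \<phi> x * cis (c * x))" for c
      by (intro bounded_cs_integrable bounded_cs_mult(1)[OF \<phi>, where M = 1]) auto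
    define c where "c = inverse (2 * pi * \<i>)"
    \<comment> \<open>Because (l - y) - (l - x) = x - y cancels the denominator of the kernel, the
      difference is a combination of the exponentials at \<open>b k\<close> and \<open>a k\<close>
      in the variable \<open>x\<close>. Integration against \<open>\<beta> k\<close> then
      annihilates it.\<close>
    have inner: "(LINT y|lborel. f y * ?K (x - y)) - complex_of_real (l - x) * (LINT y|lborel. \<phi> y * ?K (x - y))
       = c * (cis (2 * pi * b k * x) * inv_fourier \<phi> (- b k) - cis (2 * pi * a k * x) * inv_fourier \<phi> (- a k))" for x
    proof -
      have "(LINT y|lborel. f y * ?K (x - y)) - complex_of_real (l - x) * (LINT y|lborel. \<phi> y * ?K (x - y))
        = (LINT y|lborel. f y * ?K (x - y) - complex_of_real (l - x) * (\<phi> y * ?K (x - y)))"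
        using integrable_conv_kern[OF f ab] integrable_conv_kern[OF \<phi> ab]
        by (subst Bochner_Integration.integral_diff) auto
      also have "\<dots> = (LINT y|lborel. c * (cis (2 * pi * b k * x) * (\<phi> y * cis ((2 * pi * (- b k)) * y))
             - cis (2 * pi * a k * x) * (\<phi> y * cis ((2 * pi * (- a k)) * y))))"
      proof (intro Bochner_Integration.integral_cong refl)
        fix y
        have e: "cis (2 * pi * t * (x - y)) = cis (2 * pi * t * x) * cis ((2 * pi * (- t)) * y)" for t
          by (simp add: cis_mult algebra_simps)
        have "f y * ?K (x - y) - complex_of_real (l - x) * (\<phi> y * ?K (x - y))
           = \<phi> y * ((l - y) - (l - x)) * ?K (x - y)"
          unfolding f_eq[of y] by (simp add: algebra_simps)
        also have "\<dots> = c * \<phi> y * (2 * pi * \<i> * complex_of_real (x - y) * ?K (x - y))"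
          by (simp add: c_def field_simps)
        also have "\<dots> = c * \<phi> y * (cis (2 * pi * b k * (x - y)) - cis (2 * pi * a k * (x - y)))"
          unfolding kern_mult[OF ab] ..
        also have "\<dots> = c * (cis (2 * pi * b k * x) * (\<phi> y * cis ((2 * pi * (- b k)) * y))
             - cis (2 * pi * a k * x) * (\<phi> y * cis ((2 * pi * (- a k)) * y)))"
          unfolding e by (simp only: right_diff_distrib mult_ac)
        finally show "f y * ?K (x - y) - complex_of_real (l - x) * (\<phi> y * ?K (x - y))
           = c * (cis (2 * pi * b k * x) * (\<phi> y * cis ((2 * pi * (- b k)) * y))
             - cis (2 * pi * a k * x) * (\<phi> y * cis ((2 * pi * (- a k)) * y)))" .
      qed
      also have "\<dots> = c * (cis (2 * pi * b k * x) * inv_fourier \<phi> (- b k) - cis (2 * pi * a k * x) * inv_fourier \<phi> (- a k))"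
        unfolding inv_fourier_cis using int\<phi>[of "2 * pi * (- b k)"] int\<phi>[of "2 * pi * (- a k)"]
        by (simp del: mult_minus_right)
      finally show ?thesis .
    qed
    have "band_form (a k) (b k) f (\<beta> k) - band_form (a k) (b k) \<phi> (\<lambda>x. complex_of_real (l - x) * \<beta> k x)
      = (LINT x|lborel. \<beta> k x * (LINT y|lborel. f y * ?K (x - y))
            - complex_of_real (l - x) * \<beta> k x * (LINT y|lborel. \<phi> y * ?K (x - y)))"
      unfolding band_form_def
      by (rule Bochner_Integration.integral_diff[symmetric])
        (rule integrable_band_form[OF f bk ab] integrable_band_form[OF \<phi> bl ab])+
    also have "\<dots> = (LINT x|lborel. c * (inv_fourier \<phi> (- b k) * (\<beta> k x * cis ((2 * pi * b k) * x))
        - inv_fourier \<phi> (- a k) * (\<beta> k x * cis ((2 * pi * a k) * x))))"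
    proof (intro Bochner_Integration.integral_cong refl)
      fix x
      have "\<beta> k x * (LINT y|lborel. f y * ?K (x - y)) - complex_of_real (l - x) * \<beta> k x * (LINT y|lborel. \<phi> y * ?K (x - y))
        = \<beta> k x * ((LINT y|lborel. f y * ?K (x - y)) - complex_of_real (l - x) * (LINT y|lborel. \<phi> y * ?K (x - y)))"
        by (simp only: right_diff_distrib mult_ac)
      then show "\<beta> k x * (LINT y|lborel. f y * ?K (x - y)) - complex_of_real (l - x) * \<beta> k x * (LINT y|lborel. \<phi> y * ?K (x - y))
        = c * (inv_fourier \<phi> (- b k) * (\<beta> k x * cis ((2 * pi * b k) * x))
        - inv_fourier \<phi> (- a k) * (\<beta> k x * cis ((2 * pi * a k) * x)))"
        unfolding inner by (simp only: right_diff_distrib mult_ac)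
    qed
    also have "\<dots> = c * (inv_fourier \<phi> (- b k) * inv_fourier (\<beta> k) (b k) - inv_fourier \<phi> (- a k) * inv_fourier (\<beta> k) (a k))"
      unfolding inv_fourier_cis[of "\<beta> k"] using int[of "2 * pi * b k"] int[of "2 * pi * a k"] by simp
    also have "\<dots> = 0" using ca[OF k] cb[OF k] by simp
    finally show ?thesis unfolding band_form_def by simp
  qed
  \<comment> \<open>For \<open>x\<close> in the interval, \<phi> (x - u) can be nonzero only outside
    the triple, hence only for |u| at least \<open>h\<close>, which is the support condition of
    \<open>sum_kern_sq_le\<close>.\<close>
  have inner_bound: "L2_set (\<lambda>k. cmod (LINT y|lborel. \<phi> y * kern (a k) (b k) (x - y))) {1..N} \<le> S"
    if x: "x \<in> {l..<l + h}" for x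
  proof -
    have sub: "(LINT y|lborel. \<phi> y * kern (a k) (b k) (x - y)) = (LINT u|lborel. \<phi> (x - u) * kern (a k) (b k) u)" for k
      using lborel_integral_real_affine[of "-1" "\<lambda>y. \<phi> y * kern (a k) (b k) (x - y)" x] by simp
    have "(\<Sum>k=1..N. (cmod (LINT u|lborel. \<phi> (x - u) * kern (a k) (b k) u))\<^sup>2)
       \<le> 16 * B * (LINT u|lborel. (cmod (\<phi> (x - u)))\<^sup>2) / h"
    proof (rule sum_kern_sq_le[OF bounded_cs_affine[OF \<phi>] _ h])
      show "\<bar>u\<bar> \<ge> h" if "\<phi> (x - u) \<noteq> 0" for u
        using f0[of "x - u"] that x by (force simp: \<phi>_def)
    qed
    also have "(LINT u|lborel. (cmod (\<phi> (x - u)))\<^sup>2) = (LINT u|lborel. (cmod (\<phi> u))\<^sup>2)"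
      by (rule bounded_cs_affine_integral[OF \<phi>])
    finally show ?thesis unfolding sub S_def L2_set_def by (rule real_sqrt_le_mono)
  qed
  have S0: "S \<ge> 0" unfolding S_def using B_nonneg h by simp
  have bl: "bounded_cs (\<lambda>x. complex_of_real (l - x) * \<beta> k x)" if k: "k \<in> {1..N}" for k
  proof (rule bounded_cs_mult(2)[OF \<beta>[OF k]])
    show "cmod (complex_of_real (l - x)) \<le> h" if "\<beta> k x \<noteq> 0" for x
      proof -
        have "x \<in> {l..<l + h}" using \<beta>0[OF k, of x] that by blast
        then show ?thesis by (auto simp del: of_real_diff)
      qed
  qed measurable
  have "Form f \<beta> = (LINT x|lborel. (\<Sum>k=1..N. complex_of_real (l - x) * \<beta> k x * (LINT y|lborel. \<phi> y * kern (a k) (b k) (x - y))))"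
    unfolding Form_def using form_eq
    by (subst Bochner_Integration.integral_sum)
      (auto intro!: integrable_band_form \<phi> bl a_le_b simp del: of_real_diff)
  also have "cmod \<dots> \<le> (LINT x|lborel. h * S * vec_abs N \<beta> x)"
  proof (rule norm_integral_le)
    show "integrable lborel (\<lambda>x. h * S * vec_abs N \<beta> x)"
      by (intro integrable_mult_right vec_abs_integrable \<beta>)
    fix x
    show "cmod (\<Sum>k=1..N. complex_of_real (l - x) * \<beta> k x * (LINT y|lborel. \<phi> y * kern (a k) (b k) (x - y)))
      \<le> h * S * vec_abs N \<beta> x"
    proof (cases "x \<in> {l..<l + h}")
      case True
      let ?p = "\<lambda>k. LINT y|lborel. \<phi> y * kern (a k) (b k) (x - y)"
      have "cmod (\<Sum>k=1..N. complex_of_real (l - x) * \<beta> k x * ?p k)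
         \<le> (\<Sum>k=1..N. h * (\<bar>cmod (\<beta> k x)\<bar> * \<bar>cmod (?p k)\<bar>))"
      proof (rule sum_norm_le)
        fix k
        have "cmod (complex_of_real (l - x)) \<le> h" using True by (auto simp del: of_real_diff)
        then show "cmod (complex_of_real (l - x) * \<beta> k x * ?p k) \<le> h * (\<bar>cmod (\<beta> k x)\<bar> * \<bar>cmod (?p k)\<bar>)"
          unfolding norm_mult mult.assoc abs_norm_cancel by (intro mult_right_mono) auto
      qed
      also have "\<dots> = h * (\<Sum>k=1..N. \<bar>cmod (\<beta> k x)\<bar> * \<bar>cmod (?p k)\<bar>)" by (simp only: sum_distrib_left)
      also have "\<dots> \<le> h * (vec_abs N \<beta> x * L2_set (\<lambda>k. cmod (?p k)) {1..N})"
        unfolding vec_abs_L2_set using h by (intro mult_left_mono L2_set_mult_ineq) auto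
      also have "\<dots> \<le> h * (vec_abs N \<beta> x * S)"
        using h by (intro mult_left_mono inner_bound True) auto
      finally show ?thesis by (simp add: mult_ac)
    next
      case False
      then have "(\<Sum>k=1..N. complex_of_real (l - x) * \<beta> k x * (LINT y|lborel. \<phi> y * kern (a k) (b k) (x - y))) = 0"
        by (intro sum.neutral) (auto simp: \<beta>0)
      then show ?thesis using h S0 by simp
    qed
  qed
  also have "\<dots> = h * S * (LINT x|lborel. vec_abs N \<beta> x)" by simp
  also have "h * S = 4 * sqrt (B * h * (LINT y|lborel. (cmod (f y))\<^sup>2 / (y - l)\<^sup>2))"
  proof -
    have "(LINT y|lborel. (cmod (\<phi> y))\<^sup>2) = (LINT y|lborel. (cmod (f y))\<^sup>2 / (y - l)\<^sup>2)"
      by (intro Bochner_Integration.integral_cong refl)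
        (simp add: \<phi>_def norm_mult norm_inverse power_mult_distrib divide_inverse power2_commute
          power_inverse del: of_real_diff)
    moreover have "h * sqrt y = sqrt (h\<^sup>2 * y)" for y
      using h by (simp add: real_sqrt_mult)
    ultimately have "h * S = sqrt (h\<^sup>2 * (16 * B * (LINT y|lborel. (cmod (f y))\<^sup>2 / (y - l)\<^sup>2) / h))"
      unfolding S_def by simp
    also have "h\<^sup>2 * (16 * B * (LINT y|lborel. (cmod (f y))\<^sup>2 / (y - l)\<^sup>2) / h)
       = 4\<^sup>2 * (B * h * (LINT y|lborel. (cmod (f y))\<^sup>2 / (y - l)\<^sup>2))"
      using h by (simp add: power2_eq_square)
    finally show ?thesis unfolding real_sqrt_mult[of "4\<^sup>2"] by simp
  qed
  finally show ?thesis .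
qed

end

section \<open>A bounded kernel reproducing two exponentials\<close>

text \<open>Minkowski's integral inequality, by duality: the vector of integrals is paired with its
  own conjugate, Cauchy-Schwarz is applied under the integral, and one factor of its norm is
  cancelled.\<close>

lemma L2_set_integral_le:
  assumes v: "\<And>k. k \<in> A \<Longrightarrow> integrable M (v k)" and A: "finite A"
    and V: "integrable M V" "\<And>x. L2_set (\<lambda>k. cmod (v k x)) A \<le> V x"
  shows "L2_set (\<lambda>k. cmod (integral\<^sup>L M (v k))) A \<le> integral\<^sup>L M V"
proof -
  define c where "c k = integral\<^sup>L M (v k)" for k
  define L where "L = L2_set (\<lambda>k. cmod (c k)) A"
  have L0: "L \<ge> 0" unfolding L_def by simp
  have "complex_of_real (L\<^sup>2) = (\<Sum>k\<in>A. cnj (c k) * c k)"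
    unfolding L_def L2_set_def using A by (simp add: sum_nonneg complex_norm_square[unfolded of_real_power] mult.commute)
  also have "\<dots> = integral\<^sup>L M (\<lambda>x. \<Sum>k\<in>A. cnj (c k) * v k x)"
    unfolding c_def using v by (subst Bochner_Integration.integral_sum) auto
  finally have "L\<^sup>2 = cmod (integral\<^sup>L M (\<lambda>x. \<Sum>k\<in>A. cnj (c k) * v k x))"
    by (metis norm_of_real abs_of_nonneg zero_le_power2)
  also have "\<dots> \<le> integral\<^sup>L M (\<lambda>x. L * V x)"
  proof (rule norm_integral_le)
    show "integrable M (\<lambda>x. L * V x)" using V by simp
    fix x
    have "cmod (\<Sum>k\<in>A. cnj (c k) * v k x) \<le> (\<Sum>k\<in>A. \<bar>cmod (c k)\<bar> * \<bar>cmod (v k x)\<bar>)"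
      by (rule sum_norm_le) (simp add: norm_mult)
    also have "\<dots> \<le> L * L2_set (\<lambda>k. cmod (v k x)) A"
      unfolding L_def by (rule L2_set_mult_ineq)
    also have "\<dots> \<le> L * V x" using V(2) L0 by (intro mult_left_mono)
    finally show "cmod (\<Sum>k\<in>A. cnj (c k) * v k x) \<le> L * V x" .
  qed
  also have "\<dots> = L * integral\<^sup>L M V" by simp
  finally have "L * L \<le> L * integral\<^sup>L M V" by (simp add: power2_eq_square)
  moreover have "0 \<le> integral\<^sup>L M V"
    by (intro Bochner_Integration.integral_nonneg order_trans[OF L2_set_nonneg V(2)])
  ultimately have "L \<le> integral\<^sup>L M V" using L0 by (cases "L = 0") auto
  then show ?thesis unfolding L_def c_def .
qed

text \<open>For \<open>u(z) = cis (2 \<pi> \<xi> z)\<close> with \<open>\<xi> = a\<close> or \<open>\<xi> = b\<close>, the two-term recurrence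
  \<open>u(y) = (cis (-2 \<pi> a t) + cis (-2 \<pi> b t)) u(y + t) - cis (-2 \<pi> (a + b) t) u(y + 2t)\<close> holds for every \<open>t\<close>.
  Averaging it over \<open>w = y + 2t\<close> in \<open>[l, l + h)\<close> reproduces both exponentials by a kernel of size \<open>5 / h\<close>,
  uniformly in \<open>a\<close> and \<open>b\<close>.\<close>

definition rep_kern :: "real \<Rightarrow> real \<Rightarrow> real \<Rightarrow> real \<Rightarrow> real \<Rightarrow> real \<Rightarrow> complex" where
  "rep_kern a b l h y z =
     of_real (2 / h) * (cis (- 2 * pi * a * (z - y)) + cis (- 2 * pi * b * (z - y))) * indicator {l..<l + h} (2 * z - y)
     - of_real (1 / h) * cis (- pi * (a + b) * (z - y)) * indicator {l..<l + h} z"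

definition rep :: "real \<Rightarrow> real \<Rightarrow> real \<Rightarrow> real \<Rightarrow> (real \<Rightarrow> complex) \<Rightarrow> real \<Rightarrow> complex" where
  "rep a b l h g z = (LINT y|lborel. g y * rep_kern a b l h y z)"

lemma rep_kern_bound: "h > 0 \<Longrightarrow> cmod (rep_kern a b l h y z) \<le> 5 / h"
proof -
  assume h: "h > 0"
  have "cmod (rep_kern a b l h y z) \<le> 2 / h * (1 + 1) * 1 + 1 / h * 1 * 1"
    unfolding rep_kern_def using h
    by (intro order_trans[OF norm_triangle_ineq4] add_mono)
      (auto simp: norm_mult norm_divide indicator_def intro!: mult_mono divide_right_mono order_trans[OF norm_triangle_ineq])
  then show ?thesis by (simp add: add_divide_distrib[symmetric])
qed

lemma measurable_rep_kern [measurable]: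
  "(\<lambda>z. rep_kern a b l h (fst z) (snd z)) \<in> borel_measurable (borel \<Otimes>\<^sub>M borel)"
  "(\<lambda>y. rep_kern a b l h y z) \<in> borel_measurable borel"
  "(\<lambda>z. rep_kern a b l h y z) \<in> borel_measurable borel"
  unfolding rep_kern_def by measurable

text \<open>If \<open>y\<close> and 2z - y both lie in the interval, so does their midpoint
  \<open>z\<close>. This keeps the correction supported where \<open>g\<close> is.\<close>

lemma rep_kern_outside: "y \<in> {l..<l + h} \<Longrightarrow> z \<notin> {l..<l + h} \<Longrightarrow> rep_kern a b l h y z = 0"
  by (auto simp: rep_kern_def indicator_def)

lemma rep_outside:
  assumes "\<And>y. y \<notin> {l..<l + h} \<Longrightarrow> g y = 0" "z \<notin> {l..<l + h}"
  shows "rep a b l h g z = 0"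
proof -
  have *: "g y * rep_kern a b l h y z = 0" for y
    using assms(1)[of y] rep_kern_outside[of y l h z a b] assms(2) by (cases "y \<in> {l..<l + h}") auto
  show ?thesis unfolding rep_def * by simp
qed

lemma rep_kern_reproduces:
  assumes h: "h > 0" and \<xi>: "\<xi> = a \<or> \<xi> = b"
  shows "(LINT z|lborel. rep_kern a b l h y z * cis (2 * pi * \<xi> * z)) = cis (2 * pi * \<xi> * y)"
proof -
  define J :: "real \<Rightarrow> complex" where "J = indicator {l..<l + h}"
  have J: "bounded_cs J" unfolding J_def by auto
  have [measurable]: "J \<in> borel_measurable borel" unfolding J_def by measurable
  have intJ: "integrable lborel (\<lambda>w. J w * cis (c * w + d))" for c d
    by (intro bounded_cs_integrable bounded_cs_mult(1)[OF J, where M = 1]) auto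
  \<comment> \<open>The other of the two frequencies. The kernel is symmetric in \<open>a\<close>
    and \<open>b\<close>, so both cases of the claim become one.\<close>
  define \<eta> where "\<eta> = a + b - \<xi>"
  have ab: "cis (- 2 * pi * a * t) + cis (- 2 * pi * b * t) = cis (- 2 * pi * \<xi> * t) + cis (- 2 * pi * \<eta> * t)" for t
    using \<xi> by (auto simp: \<eta>_def)
  define p where "p z = (cis (- 2 * pi * a * (z - y)) + cis (- 2 * pi * b * (z - y))) * J (2 * z - y) * cis (2 * pi * \<xi> * z)" for z
  define q where "q z = cis (- pi * (a + b) * (z - y)) * J z * cis (2 * pi * \<xi> * z)" for z
  have q_eq: "q w = J w * cis (pi * (\<xi> - \<eta>) * w + pi * (\<xi> + \<eta>) * y)" for w
  proof -
    have "cis (- pi * (a + b) * (w - y)) * cis (2 * pi * \<xi> * w) = cis (pi * (\<xi> - \<eta>) * w + pi * (\<xi> + \<eta>) * y)"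
      unfolding cis_mult by (rule arg_cong[where f = cis]) (simp add: \<eta>_def algebra_simps)
    then show ?thesis unfolding q_def by (simp only: mult_ac)
  qed
  \<comment> \<open>The substitution w = 2z - y. The term with frequency \<xi> becomes constant in
    \<open>w\<close> and yields the desired exponential; the term with frequency \<eta> coincides
    with \<open>q\<close> and is removed by the subtraction in \<open>rep_kern\<close>. The Jacobian
    1/2 explains the coefficient 2 / h.\<close>
  have p_eq: "p (y / 2 + 1 / 2 * w) = J w * cis (0 * w + 2 * pi * \<xi> * y) + q w" for w
  proof -
    have "cis (- 2 * pi * \<xi> * (y / 2 + 1 / 2 * w - y)) * cis (2 * pi * \<xi> * (y / 2 + 1 / 2 * w)) = cis (0 * w + 2 * pi * \<xi> * y)"
      unfolding cis_mult by (rule arg_cong[where f = cis]) (simp add: algebra_simps)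
    moreover have "cis (- 2 * pi * \<eta> * (y / 2 + 1 / 2 * w - y)) * cis (2 * pi * \<xi> * (y / 2 + 1 / 2 * w))
        = cis (pi * (\<xi> - \<eta>) * w + pi * (\<xi> + \<eta>) * y)"
      unfolding cis_mult by (rule arg_cong[where f = cis]) (simp add: algebra_simps)
    moreover have "2 * (y / 2 + 1 / 2 * w) - y = w" by simp
    ultimately show ?thesis unfolding p_def q_eq ab
      by (simp only: distrib_right distrib_left mult.assoc mult.left_commute[of "J w"] mult.commute[of _ "J w"])
  qed
  have qi: "integrable lborel q" unfolding q_eq by (rule intJ)
  have ppi: "integrable lborel (\<lambda>w. p (y / 2 + 1 / 2 * w))"
    unfolding p_eq by (intro Bochner_Integration.integrable_add intJ qi)
  have pi: "integrable lborel p"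
    using ppi by (subst (asm) lborel_integrable_real_affine_iff) auto
  have "integral\<^sup>L lborel p = (1 / 2) *\<^sub>R (LINT w|lborel. p (y / 2 + 1 / 2 * w))"
    using lborel_integral_real_affine[of "1/2" p "y / 2"] by simp
  also have "(LINT w|lborel. p (y / 2 + 1 / 2 * w)) = (LINT w|lborel. J w * cis (0 * w + 2 * pi * \<xi> * y)) + integral\<^sup>L lborel q"
    unfolding p_eq by (intro Bochner_Integration.integral_add intJ qi)
  also have "(LINT w|lborel. J w * cis (0 * w + 2 * pi * \<xi> * y)) = h * cis (2 * pi * \<xi> * y)"
  proof -
    have "J = (\<lambda>x. complex_of_real (indicator {l..<l + h} x))" by (auto simp: J_def indicator_def)
    then have "integral\<^sup>L lborel J = of_real h"
      using h by (simp add: integral_complex_of_real)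
    then show ?thesis by simp
  qed
  finally have P: "2 * integral\<^sup>L lborel p = h * cis (2 * pi * \<xi> * y) + integral\<^sup>L lborel q"
    by (simp add: scaleR_conv_of_real field_simps)
  have "(LINT z|lborel. rep_kern a b l h y z * cis (2 * pi * \<xi> * z))
     = (LINT z|lborel. of_real (2 / h) * p z - of_real (1 / h) * q z)"
    unfolding rep_kern_def p_def q_def J_def
    by (intro Bochner_Integration.integral_cong refl) (simp only: left_diff_distrib mult.assoc)
  also have "\<dots> = of_real (2 / h) * integral\<^sup>L lborel p - of_real (1 / h) * integral\<^sup>L lborel q"
    using pi qi by simp
  also have "\<dots> = of_real (1 / h) * (2 * integral\<^sup>L lborel p - integral\<^sup>L lborel q)"
    by (simp add: algebra_simps)
  also have "\<dots> = cis (2 * pi * \<xi> * y)" unfolding P using h by simp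
  finally show ?thesis .
qed

lemma bounded_cs_rep:
  assumes g: "bounded_cs g" and g0: "\<And>y. y \<notin> {l..<l + h} \<Longrightarrow> g y = 0" and h: "h > 0"
  shows "bounded_cs (rep a b l h g)"
proof (rule bounded_csI)
  note [measurable] = bounded_cs_measurable[OF g]
  have [measurable]: "(\<lambda>(z, y). rep_kern a b l h y z) \<in> borel_measurable (borel \<Otimes>\<^sub>M borel)"
    unfolding rep_kern_def by measurable
  show "rep a b l h g \<in> borel_measurable borel"
    unfolding rep_def[abs_def] by measurable
  show "cmod (rep a b l h g z) \<le> (LINT y|lborel. cmod (g y) * (5 / h))" for z
    unfolding rep_def
    by (rule norm_integral_le)
      (use h in \<open>auto simp: norm_mult intro!: integrable_mult_left integrable_divide bounded_cs_norm_integrable g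
         mult_left_mono rep_kern_bound simp del: times_divide_eq_right\<close>)
  show "\<bar>z\<bar> \<le> \<bar>l\<bar> + h" if "rep a b l h g z \<noteq> 0" for z
    using rep_outside[of l h g z a b] g0 that by force
qed

lemma inv_fourier_rep:
  assumes g: "bounded_cs g" and g0: "\<And>y. y \<notin> {l..<l + h} \<Longrightarrow> g y = 0" and h: "h > 0"
    and \<xi>: "\<xi> = a \<or> \<xi> = b"
  shows "inv_fourier (rep a b l h g) \<xi> = inv_fourier g \<xi>"
proof -
  \<comment> \<open>The correction vanishes off the interval, so inserting this cutoff changes
    nothing, and it makes the exponential integrable for Fubini.\<close>
  define J :: "real \<Rightarrow> complex" where "J = indicator {l..<l + h}"
  have J: "bounded_cs J" unfolding J_def by auto
  have Jc: "bounded_cs (\<lambda>z. J z * cis (2 * pi * \<xi> * z))"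
    by (intro bounded_cs_mult(1)[OF J, where M = 1]) auto
  have "inv_fourier (rep a b l h g) \<xi>
    = (LINT z|lborel. (J z * cis (2 * pi * \<xi> * z)) * (LINT y|lborel. g y * rep_kern a b l h y z))"
    unfolding inv_fourier_cis rep_def[symmetric]
    using rep_outside[of l h g _ a b] g0
    by (intro Bochner_Integration.integral_cong refl) (auto simp: J_def indicator_def)
  also have "\<dots> = (LINT y|lborel. g y * (LINT z|lborel. (J z * cis (2 * pi * \<xi> * z)) * rep_kern a b l h y z))"
  proof (rule Fubini_kernel(1)[OF bounded_cs_integrable[OF Jc] bounded_cs_integrable[OF g], where M = "5 / h"])
    show "(\<lambda>z. rep_kern a b l h (snd z) (fst z)) \<in> borel_measurable (borel \<Otimes>\<^sub>M borel)"
      unfolding rep_kern_def by measurable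
  qed (rule rep_kern_bound[OF h])
  also have "\<dots> = (LINT y|lborel. g y * cis (2 * pi * \<xi> * y))"
  proof (intro Bochner_Integration.integral_cong refl)
    fix y
    show "g y * (LINT z|lborel. (J z * cis (2 * pi * \<xi> * z)) * rep_kern a b l h y z) = g y * cis (2 * pi * \<xi> * y)"
    proof (cases "y \<in> {l..<l + h}")
      case True
      have "(LINT z|lborel. (J z * cis (2 * pi * \<xi> * z)) * rep_kern a b l h y z)
         = (LINT z|lborel. rep_kern a b l h y z * cis (2 * pi * \<xi> * z))"
        using rep_kern_outside[OF True]
        by (intro Bochner_Integration.integral_cong refl) (auto simp: J_def indicator_def)
      then show ?thesis unfolding rep_kern_reproduces[OF h \<xi>] by simp
    qed (simp add: g0)
  qed
  finally show ?thesis unfolding inv_fourier_cis .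
qed

text \<open>The kernel bound 5 / h is the same for all \<open>k\<close>, so Minkowski's inequality
  passes the l2 norm under the integral with no loss in \<open>N\<close>.\<close>

lemma vec_abs_rep_le:
  assumes g: "\<And>k. k \<in> {1..N} \<Longrightarrow> bounded_cs (g k)" and h: "h > 0"
  shows "vec_abs N (\<lambda>k. rep (a k) (b k) l h (g k)) z \<le> 5 / h * (LINT y|lborel. vec_abs N g y)"
proof -
  have "L2_set (\<lambda>k. cmod (LINT y|lborel. g k y * rep_kern (a k) (b k) l h y z)) {1..N}
     \<le> (LINT y|lborel. 5 / h * vec_abs N g y)"
  proof (rule L2_set_integral_le)
    show "integrable lborel (\<lambda>y. g k y * rep_kern (a k) (b k) l h y z)" if "k \<in> {1..N}" for k
      by (intro bounded_cs_integrable bounded_cs_mult(1)[OF g[OF that] _ rep_kern_bound[OF h]]) measurable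
    show "integrable lborel (\<lambda>y. 5 / h * vec_abs N g y)"
      by (intro integrable_mult_right vec_abs_integrable g)
    fix y
    have "L2_set (\<lambda>k. cmod (g k y * rep_kern (a k) (b k) l h y z)) {1..N}
       \<le> L2_set (\<lambda>k. 5 / h * cmod (g k y)) {1..N}"
      unfolding norm_mult using h
      by (subst mult.commute) (intro L2_set_mono mult_right_mono rep_kern_bound; simp)
    also have "\<dots> = 5 / h * vec_abs N g y"
      unfolding vec_abs_L2_set using h by (subst L2_set_right_distrib) auto
    finally show "L2_set (\<lambda>k. cmod (g k y * rep_kern (a k) (b k) l h y z)) {1..N} \<le> 5 / h * vec_abs N g y" .
  qed simp
  then show ?thesis unfolding vec_abs_L2_set rep_def by simp
qed

section \<open>Stopping intervals\<close>

text \<open>Intervals are coded by left endpoint and length, and are half-open so that bisection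
  gives exact partitions; \<open>ival3\<close> is the concentric triple.\<close>

abbreviation ival :: "real \<Rightarrow> real \<Rightarrow> real set" where
  "ival l h \<equiv> {l..<l + h}"

abbreviation ival3 :: "real \<Rightarrow> real \<Rightarrow> real set" where
  "ival3 l h \<equiv> {l - h..<l + 2 * h}"

abbreviation ivals :: "real \<times> real \<Rightarrow> real set" where
  "ivals p \<equiv> ival (fst p) (snd p)"

abbreviation ivals3 :: "real \<times> real \<Rightarrow> real set" where
  "ivals3 p \<equiv> ival3 (fst p) (snd p)"

text \<open>\<open>P\<close> is the set of leaves of a bisection tree cut at depth \<open>d\<close>.
  \<open>Inv\<close> passes only to the halves of intervals that did not stop, so it also holds at
  the leaves, stopped or not. A leaf that did not stop has length exactly h / 2^d.\<close>

lemma dyadic_stopping: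
  fixes Inv stop :: "real \<Rightarrow> real \<Rightarrow> bool"
  assumes step: "\<And>l h. Inv l h \<Longrightarrow> h > 0 \<Longrightarrow> \<not> stop l h \<Longrightarrow> Inv l (h / 2) \<and> Inv (l + h / 2) (h / 2)"
    and "h > 0" "Inv l h"
  shows "\<exists>P. finite P \<and> disjoint_family_on ivals P \<and> (\<Union>p\<in>P. ivals p) = ival l h \<and>
    (\<forall>(l', h')\<in>P. Inv l' h' \<and> h' > 0 \<and> l \<le> l' \<and> l' + h' \<le> l + h \<and>
       (\<exists>n\<le>d. h' = h / 2 ^ n \<and> (n = d \<or> stop l' h')))"
  using assms(2,3)
proof (induction d arbitrary: l h)
  case 0
  then show ?case by (intro exI[of _ "{(l, h)}"]) (auto simp: disjoint_family_on_def)
next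
  case (Suc d)
  show ?case
  proof (cases "stop l h")
    case True
    with Suc.prems show ?thesis
      by (intro exI[of _ "{(l, h)}"]) (auto simp: disjoint_family_on_def intro!: exI[of _ 0])
  next
    case False
    note s = step[OF Suc.prems(2,1) False]
    have h2: "h / 2 > 0" using Suc.prems by simp
    obtain P1 where P1: "finite P1" "disjoint_family_on ivals P1" "(\<Union>p\<in>P1. ivals p) = ival l (h / 2)"
      "\<forall>(l', h')\<in>P1. Inv l' h' \<and> h' > 0 \<and> l \<le> l' \<and> l' + h' \<le> l + h / 2 \<and>
       (\<exists>n\<le>d. h' = (h / 2) / 2 ^ n \<and> (n = d \<or> stop l' h'))"
    proof -
      from Suc.IH[OF h2 conjunct1[OF s]] show thesis by (elim exE conjE) (rule that)
    qed
    obtain P2 where P2: "finite P2" "disjoint_family_on ivals P2" "(\<Union>p\<in>P2. ivals p) = ival (l + h / 2) (h / 2)"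
      "\<forall>(l', h')\<in>P2. Inv l' h' \<and> h' > 0 \<and> l + h / 2 \<le> l' \<and> l' + h' \<le> l + h / 2 + h / 2 \<and>
       (\<exists>n\<le>d. h' = (h / 2) / 2 ^ n \<and> (n = d \<or> stop l' h'))"
    proof -
      from Suc.IH[OF h2 conjunct2[OF s]] show thesis by (elim exE conjE) (rule that)
    qed
    show ?thesis
    proof (intro exI conjI)
      show "finite (P1 \<union> P2)" using P1 P2 by simp
      have sub: "ivals p \<subseteq> ival l (h / 2)" if "p \<in> P1" for p using P1(3) that by blast
      have sub': "ivals p \<subseteq> ival (l + h / 2) (h / 2)" if "p \<in> P2" for p using P2(3) that by blast
      have "ivals p \<inter> ivals q = {}" if "p \<in> P1" "q \<in> P2" for p q
        using sub[OF that(1)] sub'[OF that(2)] by fastforce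
      then show "disjoint_family_on ivals (P1 \<union> P2)"
        using P1(2) P2(2) unfolding disjoint_family_on_def by (metis Un_iff inf_commute)
      have "(\<Union>p\<in>P1 \<union> P2. ivals p) = ival l (h / 2) \<union> ival (l + h / 2) (h / 2)"
        unfolding UN_Un P1(3) P2(3) ..
      also have "\<dots> = ival l h" using h2 by auto
      finally show "(\<Union>p\<in>P1 \<union> P2. ivals p) = ival l h" .
      have tr: "\<exists>n\<le>Suc d. h' = h / 2 ^ n \<and> (n = Suc d \<or> stop l' h')"
        if t: "\<exists>n\<le>d. h' = (h / 2) / 2 ^ n \<and> (n = d \<or> stop l' h')" for l' h'
      proof -
        obtain n where n: "n \<le> d \<and> h' = (h / 2) / 2 ^ n \<and> (n = d \<or> stop l' h')"
          using t by blast
        then show ?thesis by (intro exI[of _ "Suc n"]) auto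
      qed
      show "\<forall>(l', h')\<in>P1 \<union> P2. Inv l' h' \<and> h' > 0 \<and> l \<le> l' \<and> l' + h' \<le> l + h \<and>
         (\<exists>n\<le>Suc d. h' = h / 2 ^ n \<and> (n = Suc d \<or> stop l' h'))"
      proof safe
        fix l' h' assume p: "(l', h') \<in> P1"
        note q = bspec[OF P1(4) p, unfolded prod.case]
        note q' = q[THEN conjunct2] note q'' = q'[THEN conjunct2] note q3 = q''[THEN conjunct2]
        show "Inv l' h'" "h' > 0" by (rule q[THEN conjunct1] q'[THEN conjunct1])+
        show "l \<le> l'" "l' + h' \<le> l + h"
          using q''[THEN conjunct1] q3[THEN conjunct1] h2 by linarith+
        show "\<exists>n\<le>Suc d. h' = h / 2 ^ n \<and> (n = Suc d \<or> stop l' h')"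
          by (rule tr[OF q3[THEN conjunct2]])
      next
        fix l' h' assume p: "(l', h') \<in> P2"
        note q = bspec[OF P2(4) p, unfolded prod.case]
        note q' = q[THEN conjunct2] note q'' = q'[THEN conjunct2] note q3 = q''[THEN conjunct2]
        show "Inv l' h'" "h' > 0" by (rule q[THEN conjunct1] q'[THEN conjunct1])+
        show "l \<le> l'" "l' + h' \<le> l + h"
          using q''[THEN conjunct1] q3[THEN conjunct1] h2 by linarith+
        show "\<exists>n\<le>Suc d. h' = h / 2 ^ n \<and> (n = Suc d \<or> stop l' h')"
          by (rule tr[OF q3[THEN conjunct2]])
      qed
    qed
  qed
qed

section \<open>Packing and covering estimates for finite families of intervals\<close>

lemma sum_integral_disjoint_le:
  fixes p :: "real \<Rightarrow> real"
  assumes P: "finite P" "disjoint_family_on S P" and S: "\<And>i. i \<in> P \<Longrightarrow> S i \<in> sets borel" "\<And>i. i \<in> P \<Longrightarrow> S i \<subseteq> A"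
    and A: "A \<in> sets borel" and p: "integrable lborel p" "\<And>x. p x \<ge> 0"
  shows "(\<Sum>i\<in>P. LINT x|lborel. indicator (S i) x * p x) \<le> (LINT x|lborel. indicator A x * p x)"
proof -
  have int: "integrable lborel (\<lambda>x. indicator T x * p x)" if "T \<in> sets borel" for T
    using integrable_mult_indicator[OF _ p(1), of T] that by simp
  have "(\<Sum>i\<in>P. LINT x|lborel. indicator (S i) x * p x) = (LINT x|lborel. (\<Sum>i\<in>P. indicator (S i) x * p x))"
    by (rule Bochner_Integration.integral_sum[symmetric]) (intro int S)
  also have "\<dots> \<le> (LINT x|lborel. indicator A x * p x)"
  proof (intro integral_mono Bochner_Integration.integrable_sum int S A)
    fix x
    have "(\<Sum>i\<in>P. indicator (S i) x * p x) = indicator (\<Union>(S ` P)) x * p x"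
      using P by (simp add: indicator_UN_disjoint sum_distrib_right)
    also have "\<dots> \<le> indicator A x * p x"
      using S(2) p(2)[of x] by (intro mult_right_mono) (auto simp: indicator_def)
    finally show "(\<Sum>i\<in>P. indicator (S i) x * p x) \<le> indicator A x * p x" .
  qed
  finally show ?thesis .
qed

lemma sum_length_le:
  assumes P: "finite P" "disjoint_family_on ivals P" "\<And>p. p \<in> P \<Longrightarrow> snd p > 0"
  shows "(\<Sum>p\<in>P. snd p) = measure lborel (\<Union>p\<in>P. ivals p)"
proof -
  have "measure lborel (\<Union>p\<in>P. ivals p) = (\<Sum>p\<in>P. measure lborel (ivals p))"
  proof (rule measure_finite_Union)
    show "emeasure lborel (ivals p) \<noteq> \<infinity>" if "p \<in> P" for p
      using P(3)[OF that] by simp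
  qed (use P in auto)
  also have "\<dots> = (\<Sum>p\<in>P. snd p)"
    by (intro sum.cong refl) (use P(3) in \<open>auto simp: less_imp_le\<close>)
  finally show ?thesis ..
qed

text \<open>Integrals over the triples of disjoint intervals do not add up, so a subfamily with
  disjoint triples is selected. The closed ball of radius 3/2 times the length about the midpoint
  contains the triple, and its fivefold enlargement has 15 times the length of the interval.\<close>

lemma sum_length_Vitali:
  fixes P :: "(real \<times> real) set"
  assumes P: "finite P" "disjoint_family_on ivals P" "\<And>p. p \<in> P \<Longrightarrow> snd p > 0"
  obtains C where "C \<subseteq> P" "disjoint_family_on ivals3 C" "(\<Sum>p\<in>P. snd p) \<le> 15 * (\<Sum>p\<in>C. snd p)"
proof -
  define c where "c p = fst p + snd p / 2" for p :: "real \<times> real"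
  define r where "r p = 3 * snd p / 2" for p :: "real \<times> real"
  have "\<exists>C. countable C \<and> C \<subseteq> P \<and> pairwise (\<lambda>i j. disjnt (cball (c i) (r i)) (cball (c j) (r j))) C \<and>
     (\<Union>p\<in>P. ivals p) \<subseteq> (\<Union>i\<in>C. cball (c i) (5 * r i))"
  proof (rule Vitali_covering_lemma_cballs[where K = P and r = r and a = c and S = "\<Union>p\<in>P. ivals p" and B = "\<Sum>p\<in>P. r p"])
    show "(\<Union>p\<in>P. ivals p) \<subseteq> (\<Union>i\<in>P. cball (c i) (r i))"
    proof (intro UN_mono subset_refl subsetI)
      fix p x assume p: "p \<in> P" and x: "x \<in> ivals p"
      then show "x \<in> cball (c p) (r p)"
        using P(3)[OF p] unfolding mem_cball dist_real_def abs_le_iff c_def r_def by auto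
    qed
    show "0 < r p \<and> r p \<le> (\<Sum>p\<in>P. r p)" if "p \<in> P" for p
    proof
      show "0 < r p" using P(3)[OF that] by (simp add: r_def)
      show "r p \<le> (\<Sum>p\<in>P. r p)"
        by (rule member_le_sum) (use P(1,3) that in \<open>simp_all add: r_def less_imp_le\<close>)
    qed
  qed blast
  then obtain C where C: "C \<subseteq> P" "pairwise (\<lambda>i j. disjnt (cball (c i) (r i)) (cball (c j) (r j))) C"
     "(\<Union>p\<in>P. ivals p) \<subseteq> (\<Union>i\<in>C. cball (c i) (5 * r i))" by blast
  have finC: "finite C" using C P finite_subset by blast
  have sub: "ivals3 p \<subseteq> cball (c p) (r p)" if "p \<in> C" for p
  proof
    fix x assume "x \<in> ivals3 p"
    then show "x \<in> cball (c p) (r p)"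
      using P(3)[of p] C(1) that unfolding mem_cball dist_real_def abs_le_iff c_def r_def by auto
  qed
  show thesis
  proof (rule that[OF C(1)])
    show "disjoint_family_on ivals3 C"
      unfolding disjoint_family_on_def
    proof (intro ballI impI)
      fix p q assume pq: "p \<in> C" "q \<in> C" "p \<noteq> q"
      then have "disjnt (cball (c p) (r p)) (cball (c q) (r q))" using C(2) by (auto simp: pairwise_def)
      then show "ivals3 p \<inter> ivals3 q = {}"
        using sub[OF pq(1)] sub[OF pq(2)] unfolding disjnt_def by blast
    qed
    have "(\<Sum>p\<in>P. snd p) = measure lborel (\<Union>p\<in>P. ivals p)" by (rule sum_length_le[OF P])
    also have "\<dots> \<le> measure lborel (\<Union>i\<in>C. cball (c i) (5 * r i))"
    proof (rule measure_mono_fmeasurable[OF C(3)])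
      show "(\<Union>p\<in>P. ivals p) \<in> sets lborel" using P(1) by (intro sets.finite_UN) auto
      show "(\<Union>i\<in>C. cball (c i) (5 * r i)) \<in> fmeasurable lborel"
        using finC by (intro fmeasurable.finite_UN fmeasurable_compact compact_cball)
    qed
    also have "\<dots> \<le> (\<Sum>i\<in>C. measure lborel (cball (c i) (5 * r i)))"
      by (intro measure_UNION_le finC) auto
    also have "\<dots> = (\<Sum>i\<in>C. 15 * snd i)"
    proof (intro sum.cong refl)
      fix p assume "p \<in> C"
      then have "snd p > 0" using P(3) C(1) by blast
      then show "measure lborel (cball (c p) (5 * r p)) = 15 * snd p"
        by (simp add: cball_eq_atLeastAtMost r_def)
    qed
    finally show "(\<Sum>p\<in>P. snd p) \<le> 15 * (\<Sum>p\<in>C. snd p)" by (simp add: sum_distrib_left)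
  qed
qed

context interval_family
begin

lemma Form_cong:
  assumes "\<And>k x. k \<in> {1..N} \<Longrightarrow> g k x = g' k x"
  shows "Form f g = Form f g'"
proof -
  have "g k = g' k" if "k \<in> {1..N}" for k using assms[OF that] by blast
  then show ?thesis unfolding Form_def by (intro sum.cong refl arg_cong2[where f = "band_form _ _"]) auto
qed

lemma Form_diff:
  assumes "bounded_cs f" "bounded_cs f'"
    and "\<And>k. k \<in> {1..N} \<Longrightarrow> bounded_cs (g k)" "\<And>k. k \<in> {1..N} \<Longrightarrow> bounded_cs (g' k)"
  shows "Form (\<lambda>x. f x - f' x) g = Form f g - Form f' g"
    and "Form f (\<lambda>k x. g k x - g' k x) = Form f g - Form f g'"
proof -
  show "Form (\<lambda>x. f x - f' x) g = Form f g - Form f' g"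
    unfolding Form_def sum_subtractf[symmetric]
    by (intro sum.cong refl band_form_diff(1)[OF assms(1,2) assms(3,3)] a_le_b)
  show "Form f (\<lambda>k x. g k x - g' k x) = Form f g - Form f g'"
    unfolding Form_def sum_subtractf[symmetric]
    by (intro sum.cong refl band_form_diff(2)[OF assms(1,1) assms(3,4)] a_le_b)
qed

lemma Form_sum:
  assumes "finite P" "bounded_cs f" "\<And>p k. p \<in> P \<Longrightarrow> k \<in> {1..N} \<Longrightarrow> bounded_cs (g p k)"
  shows "Form f (\<lambda>k x. \<Sum>p\<in>P. g p k x) = (\<Sum>p\<in>P. Form f (g p))"
proof -
  have "Form f (\<lambda>k x. \<Sum>p\<in>P. g p k x) = (\<Sum>k=1..N. \<Sum>p\<in>P. band_form (a k) (b k) f (g p k))"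
    unfolding Form_def
    by (intro sum.cong refl band_form_sum_right assms a_le_b)
  also have "\<dots> = (\<Sum>p\<in>P. Form f (g p))" unfolding Form_def by (rule sum.swap)
  finally show ?thesis .
qed

end

section \<open>One step of the sparse recursion\<close>

lemma vec_abs_restrict:
  "vec_abs N (\<lambda>k x. indicator A x * g k x) x = indicator A x * vec_abs N g x"
  by (auto simp: vec_abs_def indicator_def)

lemma vec_abs_diff_le: "vec_abs N (\<lambda>k x. g k x - g' k x) x \<le> vec_abs N g x + vec_abs N g' x"
proof -
  have "vec_abs N (\<lambda>k x. g k x - g' k x) x \<le> L2_set (\<lambda>k. cmod (g k x) + cmod (g' k x)) {1..N}"
    unfolding vec_abs_L2_set by (intro L2_set_mono norm_triangle_ineq4) auto
  also have "\<dots> \<le> vec_abs N g x + vec_abs N g' x"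
    unfolding vec_abs_L2_set by (rule L2_set_triangle_ineq)
  finally show ?thesis .
qed

locale form_data = interval_family +
  fixes f :: "real \<Rightarrow> complex" and g :: "nat \<Rightarrow> real \<Rightarrow> complex"
  assumes bounded_f: "bounded_cs f" and bounded_g: "k \<in> {1..N} \<Longrightarrow> bounded_cs (g k)"
begin

definition sq3 :: "real \<Rightarrow> real \<Rightarrow> real" where
  "sq3 l h = (LINT x|lborel. indicator (ival3 l h) x * (cmod (f x))\<^sup>2)"

definition mass :: "real \<Rightarrow> real \<Rightarrow> real" where
  "mass l h = (LINT x|lborel. indicator (ival l h) x * vec_abs N g x)"

text \<open>The centre \<open>c\<close> is a separate argument because a bound at the left endpoint
  alone would not pass to subintervals with other endpoints.\<close>

definition tail :: "real \<Rightarrow> real \<Rightarrow> real \<Rightarrow> real \<Rightarrow> real \<Rightarrow> real" where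
  "tail l h l' h' c = (LINT x|lborel. indicator (ival3 l h - ival3 l' h') x * ((cmod (f x))\<^sup>2 / (x - c)\<^sup>2))"

definition Loc :: "real \<Rightarrow> real \<Rightarrow> complex" where
  "Loc l h = Form (\<lambda>x. indicator (ival3 l h) x * f x) (\<lambda>k x. indicator (ival l h) x * g k x)"

lemma integrable_vec_g: "integrable lborel (vec_abs N g)"
  by (rule vec_abs_integrable(1)) (rule bounded_g)

lemma integrable_restrict_f: "A \<in> sets borel \<Longrightarrow> integrable lborel (\<lambda>x. indicator A x * (cmod (f x))\<^sup>2)"
  using integrable_mult_indicator[OF _ bounded_cs_norm_integrable(2)[OF bounded_f], of A] by simp

lemma integrable_restrict_g: "A \<in> sets borel \<Longrightarrow> integrable lborel (\<lambda>x. indicator A x * vec_abs N g x)"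
  using integrable_mult_indicator[OF _ integrable_vec_g, of A] by simp

lemma sq3_nonneg: "sq3 l h \<ge> 0" unfolding sq3_def by (intro Bochner_Integration.integral_nonneg) auto

lemma mass_nonneg: "mass l h \<ge> 0" unfolding mass_def by (intro Bochner_Integration.integral_nonneg) auto

lemma tail_nonneg: "tail l h l' h' c \<ge> 0"
  unfolding tail_def by (intro Bochner_Integration.integral_nonneg) auto

lemma sq3_mono: "ival3 l' h' \<subseteq> ival3 l h \<Longrightarrow> sq3 l' h' \<le> sq3 l h"
  unfolding sq3_def by (intro integral_mono integrable_restrict_f) (auto simp: indicator_def)

lemma mass_mono: "ival l' h' \<subseteq> ival l h \<Longrightarrow> mass l' h' \<le> mass l h"
  unfolding mass_def by (intro integral_mono integrable_restrict_g) (auto simp: indicator_def)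

lemma integral_local_square_le:
  assumes \<gamma>: "\<And>k. k \<in> {1..N} \<Longrightarrow> bounded_cs (\<gamma> k)" and h: "h > 0"
    and M: "\<And>x. x \<in> ival l h \<Longrightarrow> vec_abs N \<gamma> x \<le> M" "\<And>x. x \<notin> ival l h \<Longrightarrow> vec_abs N \<gamma> x = 0"
  shows "(LINT x|lborel. (vec_abs N \<gamma> x)\<^sup>2) \<le> M\<^sup>2 * h" "(LINT x|lborel. vec_abs N \<gamma> x) \<le> M * h"
proof -
  have I: "integrable lborel (\<lambda>x. c * indicator (ival l h) x)" "(LINT x|lborel. c * indicator (ival l h) x) = c * h" for c :: real
    using h by auto
  have "(LINT x|lborel. (vec_abs N \<gamma> x)\<^sup>2) \<le> (LINT x|lborel. M\<^sup>2 * indicator (ival l h) x)"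
  proof (intro integral_mono vec_abs_integrable \<gamma> I)
    show "(vec_abs N \<gamma> x)\<^sup>2 \<le> M\<^sup>2 * indicator (ival l h) x" for x
      using M by (cases "x \<in> ival l h") (auto intro!: power_mono)
  qed
  then show "(LINT x|lborel. (vec_abs N \<gamma> x)\<^sup>2) \<le> M\<^sup>2 * h" unfolding I .
  have "(LINT x|lborel. vec_abs N \<gamma> x) \<le> (LINT x|lborel. M * indicator (ival l h) x)"
  proof (intro integral_mono vec_abs_integrable \<gamma> I)
    show "vec_abs N \<gamma> x \<le> M * indicator (ival l h) x" for x
      using M by (cases "x \<in> ival l h") auto
  qed
  then show "(LINT x|lborel. vec_abs N \<gamma> x) \<le> M * h" unfolding I .
qed

text \<open>On each piece \<open>g\<close> is the correction \<open>\<gamma> p\<close> plus the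
  cancelling remainder \<open>\<beta> p\<close>. Against \<open>f\<close> on the triple of
  \<open>p\<close>, the remainder gives the child form \<open>Loc\<close> minus an error with
  \<open>\<gamma> p\<close>. So three kinds of error remain: all corrections together against
  \<open>f\<close> on the large triple (\<open>T1\<close>), the remainders against far values of
  \<open>f\<close> (\<open>T2\<close>), and each correction against nearby values of
  \<open>f\<close> (\<open>T3\<close>). The last two are proportional to the mass of
  \<open>g\<close> on \<open>p\<close>, and these masses add up to at most v h.\<close>

lemma Loc_step:
  assumes h: "h > 0" and P: "finite P" "disjoint_family_on ivals P" "(\<Union>p\<in>P. ivals p) = ival l h"
    and Q: "\<And>p. p \<in> P \<Longrightarrow> snd p > 0 \<and> l \<le> fst p \<and> fst p + snd p \<le> l + h"
    and m: "sq3 l h \<le> m * h" "m \<ge> 0" and v: "mass l h \<le> v * h" "v \<ge> 0"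
    and mass: "\<And>p. p \<in> P \<Longrightarrow> mass (fst p) (snd p) \<le> 128 * v * snd p"
    and sq: "\<And>p. p \<in> P \<Longrightarrow> sq3 (fst p) (snd p) \<le> 128 * m * snd p"
    and tail: "\<And>p. p \<in> P \<Longrightarrow> tail l h (fst p) (snd p) (fst p) \<le> 256 * m / snd p"
  shows "cmod (Loc l h) \<le> (\<Sum>p\<in>P. cmod (Loc (fst p) (snd p))) + 1100 * (sqrt (B * m) * (v * h))"
proof -
  define fI where "fI x = indicator (ival3 l h) x * f x" for x
  define fQ where "fQ p x = indicator (ivals3 p) x * f x" for p x
  define fD where "fD p x = indicator (ival3 l h - ivals3 p) x * f x" for p x
  define gQ where "gQ p k x = indicator (ivals p) x * g k x" for p k x
  define \<gamma> where "\<gamma> p k = rep (a k) (b k) (fst p) (snd p) (gQ p k)" for p k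
  define \<beta> where "\<beta> p k x = gQ p k x - \<gamma> p k x" for p k x
  define mQ where "mQ p = mass (fst p) (snd p)" for p
  define G where "G k x = (\<Sum>p\<in>P. \<gamma> p k x)" for k x
  have B0: "B \<ge> 0" by (rule B_nonneg)
  have hp: "snd p > 0" if "p \<in> P" for p using Q[OF that] by simp
  have sub3: "ivals3 p \<subseteq> ival3 l h" if "p \<in> P" for p
    using Q[OF that] by auto
  have bfI: "bounded_cs fI" and bfQ: "bounded_cs (fQ p)" and bfD: "bounded_cs (fD p)" for p
    unfolding fI_def fQ_def fD_def by (intro bounded_cs_restrict bounded_f; simp)+
  have bgQ: "bounded_cs (gQ p k)" if "k \<in> {1..N}" for p k
    unfolding gQ_def by (intro bounded_cs_restrict bounded_g that; simp)
  have gQ0: "gQ p k x = 0" if "x \<notin> ivals p" for p k x using that by (simp add: gQ_def)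
  have b\<gamma>: "bounded_cs (\<gamma> p k)" if "p \<in> P" "k \<in> {1..N}" for p k
    unfolding \<gamma>_def by (rule bounded_cs_rep[OF bgQ[OF that(2)] gQ0 hp[OF that(1)]])
  have \<gamma>0: "\<gamma> p k x = 0" if "x \<notin> ivals p" for p k x
    unfolding \<gamma>_def by (rule rep_outside[OF gQ0 that])
  have b\<beta>: "bounded_cs (\<beta> p k)" if "p \<in> P" "k \<in> {1..N}" for p k
    unfolding \<beta>_def by (intro bounded_cs_diff bgQ b\<gamma> that)
  have bG: "bounded_cs (G k)" if "k \<in> {1..N}" for k
    unfolding G_def by (intro bounded_cs_sum P b\<gamma> that)
  have mQ: "(LINT x|lborel. vec_abs N (gQ p) x) = mQ p" for p
    unfolding mQ_def mass_def gQ_def vec_abs_restrict ..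
  have mQ0: "mQ p \<ge> 0" for p unfolding mQ_def by (rule mass_nonneg)
  have \<gamma>_le: "vec_abs N (\<gamma> p) x \<le> 5 / snd p * mQ p" if "p \<in> P" for p x
    using vec_abs_rep_le[of N "gQ p" "snd p" a b "fst p" x] bgQ hp[OF that] unfolding mQ \<gamma>_def by simp
  have v\<gamma>0: "vec_abs N (\<gamma> p) x = 0" if "x \<notin> ivals p" for p x
    using \<gamma>0[OF that] by (simp add: vec_abs_def)
  have \<gamma>_sq: "(LINT x|lborel. (vec_abs N (\<gamma> p) x)\<^sup>2) \<le> (5 / snd p * mQ p)\<^sup>2 * snd p"
    and \<gamma>_int: "(LINT x|lborel. vec_abs N (\<gamma> p) x) \<le> 5 * mQ p" if p: "p \<in> P" for p
    using integral_local_square_le[of "\<gamma> p", OF b\<gamma>[OF p] hp[OF p] \<gamma>_le[OF p] v\<gamma>0] hp[OF p] by auto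

  have decomp: "Loc l h = Form fI G + (\<Sum>p\<in>P. Form (fD p) (\<beta> p) + Loc (fst p) (snd p) - Form (fQ p) (\<gamma> p))"
  proof -
    \<comment> \<open>The double minus lets \<open>Form_diff\<close> serve as the addition
      rule.\<close>
    have split_g: "indicator (ival l h) x * g k x = (\<Sum>p\<in>P. \<gamma> p k x) - (\<Sum>p\<in>P. - \<beta> p k x)" for k x
    proof -
      have "indicator (ival l h) x * g k x = (\<Sum>p\<in>P. gQ p k x)"
        unfolding gQ_def sum_distrib_right[symmetric] P(3)[symmetric]
        using P by (subst indicator_UN_disjoint) auto
      then show ?thesis unfolding \<beta>_def by (simp add: sum_negf sum_subtractf)
    qed
    have b\<beta>m: "bounded_cs (\<lambda>x. - \<beta> p k x)" if "p \<in> P" "k \<in> {1..N}" for p k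
      using bounded_cs_diff[OF bounded_cs_0 b\<beta>[OF that]] by simp
    have "Loc l h = Form fI (\<lambda>k x. (\<Sum>p\<in>P. \<gamma> p k x) - (\<Sum>p\<in>P. - \<beta> p k x))"
      unfolding Loc_def fI_def split_g ..
    also have "\<dots> = Form fI G - Form fI (\<lambda>k x. \<Sum>p\<in>P. - \<beta> p k x)"
      unfolding G_def[abs_def] by (intro Form_diff(2)[OF bfI bfI] bounded_cs_sum P b\<gamma> b\<beta>m)
    also have "Form fI (\<lambda>k x. \<Sum>p\<in>P. - \<beta> p k x) = (\<Sum>p\<in>P. Form fI (\<lambda>k x. - \<beta> p k x))"
      by (rule Form_sum[OF P(1) bfI b\<beta>m])
    also have "\<dots> = (\<Sum>p\<in>P. - (Form (fD p) (\<beta> p) + Loc (fst p) (snd p) - Form (fQ p) (\<gamma> p)))"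
    proof (intro sum.cong refl)
      fix p assume p: "p \<in> P"
      have "Form fI (\<lambda>k x. - \<beta> p k x) = Form fI (\<lambda>k x. 0 - \<beta> p k x)" by simp
      also have "\<dots> = Form fI (\<lambda>k x. 0) - Form fI (\<beta> p)"
        by (intro Form_diff(2)[OF bfI bfI] bounded_cs_0 b\<beta> p)
      also have "Form fI (\<lambda>k x. 0) = 0" by (simp add: Form_def band_form_def)
      also have "Form fI (\<beta> p) = Form (\<lambda>x. fD p x - (0 - fQ p x)) (\<beta> p)"
        by (rule arg_cong2[where f = Form])
          (use sub3[OF p] in \<open>auto simp: fI_def fD_def fQ_def indicator_def fun_eq_iff\<close>)
      also have "Form (\<lambda>x. fD p x - (0 - fQ p x)) (\<beta> p) = Form (fD p) (\<beta> p) - Form (\<lambda>x. 0 - fQ p x) (\<beta> p)"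
        by (intro Form_diff(1)[where g' = "\<beta> p"] bounded_cs_diff bounded_cs_0 bfD bfQ b\<beta> p)
      also have "Form (\<lambda>x. 0 - fQ p x) (\<beta> p) = Form (\<lambda>x. 0) (\<beta> p) - Form (fQ p) (\<beta> p)"
        by (intro Form_diff(1)[where g' = "\<beta> p"] bounded_cs_0 bfQ b\<beta> p)
      also have "Form (\<lambda>x. 0) (\<beta> p) = 0" by (simp add: Form_def band_form_def)
      also have "Form (fQ p) (\<beta> p) = Form (fQ p) (gQ p) - Form (fQ p) (\<gamma> p)"
        unfolding \<beta>_def[abs_def] by (intro Form_diff(2)[OF bfQ bfQ] bgQ b\<gamma> p)
      also have "Form (fQ p) (gQ p) = Loc (fst p) (snd p)"
        unfolding Loc_def fQ_def gQ_def ..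
      finally show "Form fI (\<lambda>k x. - \<beta> p k x) = - (Form (fD p) (\<beta> p) + Loc (fst p) (snd p) - Form (fQ p) (\<gamma> p))"
        by simp
    qed
    finally show ?thesis by (simp only: sum_negf diff_minus_eq_add)
  qed

  \<comment> \<open>The pieces are disjoint, so at each point only one correction is nonzero; its
    size is at most (5 / length) times a mass of at most 128 v times the length, hence 640
    v.\<close>
  have T1: "cmod (Form fI G) \<le> 640 * (sqrt (B * m) * (v * h))"
  proof -
    have fI2: "(LINT x|lborel. (cmod (fI x))\<^sup>2) = sq3 l h"
      unfolding sq3_def fI_def by (intro Bochner_Integration.integral_cong) (auto simp: indicator_def)
    have G_in: "vec_abs N G x \<le> 640 * v" if x: "x \<in> ival l h" for x
    proof -
      obtain p where p: "p \<in> P" "x \<in> ivals p" using P(3) x by blast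
      have "G k x = \<gamma> p k x" for k
      proof -
        have "\<gamma> q k x = 0" if "q \<in> P - {p}" for q
        proof (rule \<gamma>0)
          have "ivals q \<inter> ivals p = {}"
            using that p(1) by (intro disjoint_family_onD[OF P(2)]) auto
          then show "x \<notin> ivals q" using p(2) by blast
        qed
        then have "(\<Sum>q\<in>P - {p}. \<gamma> q k x) = 0" by (rule sum.neutral[OF ballI])
        then show ?thesis unfolding G_def sum.remove[OF P(1) p(1)] by simp
      qed
      then have "vec_abs N G x = vec_abs N (\<gamma> p) x" by (simp add: vec_abs_def)
      also have "\<dots> \<le> 5 / snd p * mQ p" by (rule \<gamma>_le[OF p(1)])
      also have "\<dots> \<le> 5 / snd p * (128 * v * snd p)"
        unfolding mQ_def using mass[OF p(1)] hp[OF p(1)] by (intro mult_left_mono) auto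
      also have "\<dots> = 640 * v" using hp[OF p(1)] by simp
      finally show ?thesis .
    qed
    have G_out: "vec_abs N G x = 0" if "x \<notin> ival l h" for x
    proof -
      have "x \<notin> ivals p" if "p \<in> P" for p using P(3) that \<open>x \<notin> ival l h\<close> by blast
      then have "G k x = 0" for k unfolding G_def by (intro sum.neutral ballI \<gamma>0)
      then show ?thesis by (simp add: vec_abs_def)
    qed
    have "cmod (Form fI G) \<le> sqrt (B * sq3 l h * (LINT x|lborel. (vec_abs N G x)\<^sup>2))"
      unfolding fI2[symmetric] by (rule Form_bound[OF bfI bG])
    also have "\<dots> \<le> sqrt (B * (m * h) * ((640 * v)\<^sup>2 * h))"
    proof (intro real_sqrt_le_mono mult_mono[OF mult_left_mono[OF m(1) B0]])
      show "(LINT x|lborel. (vec_abs N G x)\<^sup>2) \<le> (640 * v)\<^sup>2 * h"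
        by (rule integral_local_square_le(1)[OF bG h G_in G_out])
    qed (use B0 m h in auto)
    also have "B * (m * h) * ((640 * v)\<^sup>2 * h) = (B * m) * (640 * v * h)\<^sup>2"
      by (simp add: power2_eq_square)
    also have "sqrt \<dots> = sqrt (B * m) * (640 * v * h)"
      using v h by (simp add: real_sqrt_mult)
    finally show ?thesis by simp
  qed

  \<comment> \<open>The length of \<open>p\<close> cancels against the tail bound, leaving 16 sqrt
    (B m). The remainder has at most 1 + 5 times the mass of \<open>g\<close>, and 4 * 16 * 6 =
    384.\<close>
  have T2: "cmod (Form (fD p) (\<beta> p)) \<le> 384 * (sqrt (B * m) * mQ p)" if p: "p \<in> P" for p
  proof -
    have "cmod (Form (fD p) (\<beta> p)) \<le> 4 * sqrt (B * snd p * (LINT y|lborel. (cmod (fD p y))\<^sup>2 / (y - fst p)\<^sup>2))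
           * (LINT x|lborel. vec_abs N (\<beta> p) x)"
    proof (rule Form_off_diagonal[OF bfD _ hp[OF p] b\<beta>[OF p]])
      show "fD p y = 0" if "y \<in> ivals3 p" for y using that by (simp add: fD_def)
      show "\<beta> p k x = 0" if "x \<notin> ivals p" for k x
        using gQ0[OF that] \<gamma>0[OF that] by (simp add: \<beta>_def)
      fix k assume k: "k \<in> {1..N}"
      have sub: "inv_fourier (\<beta> p k) \<xi> = inv_fourier (gQ p k) \<xi> - inv_fourier (\<gamma> p k) \<xi>" for \<xi>
      proof -
        have i: "integrable lborel (\<lambda>y. q y * cis (c * y))" if "bounded_cs q" for q c
          by (intro bounded_cs_integrable bounded_cs_mult(1)[OF that, where M = 1]) auto
        show ?thesis unfolding inv_fourier_cis \<beta>_def left_diff_distrib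
          by (rule Bochner_Integration.integral_diff[OF i[OF bgQ[OF k]] i[OF b\<gamma>[OF p k]]])
      qed
      show "inv_fourier (\<beta> p k) (a k) = 0" "inv_fourier (\<beta> p k) (b k) = 0"
        unfolding sub \<gamma>_def using inv_fourier_rep[OF bgQ[OF k] gQ0 hp[OF p]] by simp_all
    qed
    also have "(LINT y|lborel. (cmod (fD p y))\<^sup>2 / (y - fst p)\<^sup>2) = tail l h (fst p) (snd p) (fst p)"
      unfolding tail_def fD_def by (intro Bochner_Integration.integral_cong) (auto simp: indicator_def)
    also have "4 * sqrt (B * snd p * tail l h (fst p) (snd p) (fst p)) * (LINT x|lborel. vec_abs N (\<beta> p) x)
        \<le> 4 * sqrt (B * snd p * (256 * m / snd p)) * (6 * mQ p)"
    proof (intro mult_mono mult_left_mono real_sqrt_le_mono tail p)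
      have "(LINT x|lborel. vec_abs N (\<beta> p) x) \<le> (LINT x|lborel. vec_abs N (gQ p) x + vec_abs N (\<gamma> p) x)"
        unfolding \<beta>_def[abs_def]
        by (intro integral_mono Bochner_Integration.integrable_add vec_abs_integrable vec_abs_diff_le bounded_cs_diff bgQ b\<gamma> p)
      also have "\<dots> = mQ p + (LINT x|lborel. vec_abs N (\<gamma> p) x)"
        unfolding mQ[symmetric] by (intro Bochner_Integration.integral_add vec_abs_integrable bgQ b\<gamma> p)
      finally show "(LINT x|lborel. vec_abs N (\<beta> p) x) \<le> 6 * mQ p" using \<gamma>_int[OF p] by simp
    qed (use B0 hp[OF p] m tail_nonneg in \<open>auto intro!: Bochner_Integration.integral_nonneg mult_nonneg_nonneg\<close>)
    also have "B * snd p * (256 * m / snd p) = 16\<^sup>2 * (B * m)" using hp[OF p] by simp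
    also have "4 * sqrt (16\<^sup>2 * (B * m)) * (6 * mQ p) = 384 * (sqrt (B * m) * mQ p)"
      unfolding real_sqrt_mult[of "16\<^sup>2"] by simp
    finally show ?thesis .
  qed

  have T3: "cmod (Form (fQ p) (\<gamma> p)) \<le> 60 * (sqrt (B * m) * mQ p)" if p: "p \<in> P" for p
  proof -
    have fQ2: "(LINT x|lborel. (cmod (fQ p x))\<^sup>2) = sq3 (fst p) (snd p)"
      unfolding sq3_def fQ_def by (intro Bochner_Integration.integral_cong) (auto simp: indicator_def)
    have "cmod (Form (fQ p) (\<gamma> p)) \<le> sqrt (B * sq3 (fst p) (snd p) * (LINT x|lborel. (vec_abs N (\<gamma> p) x)\<^sup>2))"
      unfolding fQ2[symmetric] by (rule Form_bound[OF bfQ b\<gamma>[OF p]])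
    also have "\<dots> \<le> sqrt (B * (144 * m * snd p) * ((5 / snd p * mQ p)\<^sup>2 * snd p))"
    proof -
      \<comment> \<open>128 is rounded up to the square of 12, so that the constant becomes 12 * 5 =
        60.\<close>
      have "128 * m * snd p \<le> 144 * m * snd p" using m(2) hp[OF p] by (intro mult_right_mono) auto
      then show ?thesis
        using \<gamma>_sq[OF p] B0 m(2) hp[OF p] sq3_nonneg order_trans[OF sq[OF p]]
        by (intro real_sqrt_le_mono mult_mono mult_left_mono) auto
    qed
    also have "B * (144 * m * snd p) * ((5 / snd p * mQ p)\<^sup>2 * snd p) = (B * m) * (60 * mQ p)\<^sup>2"
      using hp[OF p] by (simp add: power2_eq_square)
    also have "sqrt \<dots> = sqrt (B * m) * (60 * mQ p)"
      using mQ0[of p] by (simp add: real_sqrt_mult)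
    finally show ?thesis by simp
  qed

  have mass_sum: "(\<Sum>p\<in>P. mQ p) \<le> v * h"
  proof -
    have "(\<Sum>p\<in>P. mQ p) \<le> mass l h"
      unfolding mQ_def mass_def
      by (rule sum_integral_disjoint_le[OF P(1,2)]) (use Q integrable_vec_g in force)+
    then show ?thesis using v by simp
  qed
  have "cmod (Loc l h) \<le> cmod (Form fI G) + (\<Sum>p\<in>P. cmod (Form (fD p) (\<beta> p) + Loc (fst p) (snd p) - Form (fQ p) (\<gamma> p)))"
    unfolding decomp by (rule order_trans[OF norm_triangle_ineq]) (intro add_left_mono norm_sum)
  also have "\<dots> \<le> 640 * (sqrt (B * m) * (v * h)) + (\<Sum>p\<in>P. cmod (Loc (fst p) (snd p)) + 444 * (sqrt (B * m) * mQ p))"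
  proof (intro add_mono T1 sum_mono)
    fix p assume p: "p \<in> P"
    have "cmod (Form (fD p) (\<beta> p) + Loc (fst p) (snd p) - Form (fQ p) (\<gamma> p))
       \<le> cmod (Form (fD p) (\<beta> p)) + cmod (Loc (fst p) (snd p)) + cmod (Form (fQ p) (\<gamma> p))"
      by norm
    then show "cmod (Form (fD p) (\<beta> p) + Loc (fst p) (snd p) - Form (fQ p) (\<gamma> p))
       \<le> cmod (Loc (fst p) (snd p)) + 444 * (sqrt (B * m) * mQ p)"
      using T2[OF p] T3[OF p] by linarith
  qed
  also have "\<dots> = (\<Sum>p\<in>P. cmod (Loc (fst p) (snd p))) + 640 * (sqrt (B * m) * (v * h)) + 444 * (sqrt (B * m) * (\<Sum>p\<in>P. mQ p))"
    by (simp add: sum.distrib sum_distrib_left)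
  also have "\<dots> \<le> (\<Sum>p\<in>P. cmod (Loc (fst p) (snd p))) + 640 * (sqrt (B * m) * (v * h)) + 444 * (sqrt (B * m) * (v * h))"
    using mass_sum B0 m by (intro add_left_mono mult_left_mono) auto
  \<comment> \<open>640 + 384 + 60 = 1084, rounded up.\<close>
  also have "\<dots> \<le> (\<Sum>p\<in>P. cmod (Loc (fst p) (snd p))) + 1100 * (sqrt (B * m) * (v * h))"
    using B0 m v h by (simp add: algebra_simps)
  finally show ?thesis .
qed

end

section \<open>The stopping rule: its invariant, and the total length of the stopped
  intervals\<close>

lemma Diff_Int_self: "(A - B) \<inter> B = {}"
  by blast

lemma indicator_Diff_split:
  "C \<subseteq> B \<Longrightarrow> B \<subseteq> A \<Longrightarrow> indicator (A - C) x = (indicator (A - B) x + indicator (B - C) x :: real)"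
  by (auto simp: indicator_def)

context form_data
begin

text \<open>Any point of an interval of length \<open>h\<close> is at distance at least
  \<open>h\<close> from the complement of its triple.\<close>

lemma tail_piece:
  assumes A: "A \<in> sets borel" "A \<inter> ival3 l h = {}" and h: "h > 0" and c: "c \<in> ival l h"
  shows "integrable lborel (\<lambda>x. indicator A x * ((cmod (f x))\<^sup>2 / (x - c)\<^sup>2))"
    and "(LINT x|lborel. indicator A x * ((cmod (f x))\<^sup>2 / (x - c)\<^sup>2))
      \<le> (LINT x|lborel. indicator A x * (cmod (f x))\<^sup>2) / h\<^sup>2"
proof -
  have le: "indicator A x * ((cmod (f x))\<^sup>2 / (x - c)\<^sup>2) \<le> indicator A x * (cmod (f x))\<^sup>2 / h\<^sup>2" for x
  proof (cases "x \<in> A")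
    case True
    then have "x \<notin> ival3 l h" using A by blast
    then have "h \<le> \<bar>x - c\<bar>" using c by auto
    then have "h\<^sup>2 \<le> (x - c)\<^sup>2" using h by (metis abs_le_square_iff abs_of_pos)
    then show ?thesis using True h by (auto intro!: frac_le)
  qed simp
  note m = bounded_cs_measurable[OF bounded_f]
  show int: "integrable lborel (\<lambda>x. indicator A x * ((cmod (f x))\<^sup>2 / (x - c)\<^sup>2))"
  proof (rule Bochner_Integration.integrable_bound)
    show "integrable lborel (\<lambda>x. indicator A x * (cmod (f x))\<^sup>2 / h\<^sup>2)"
      by (intro integrable_divide integrable_restrict_f A)
    show "AE x in lborel. norm (indicator A x * ((cmod (f x))\<^sup>2 / (x - c)\<^sup>2)) \<le> norm (indicator A x * (cmod (f x))\<^sup>2 / h\<^sup>2)"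
    proof (intro AE_I2)
      fix x
      have "0 \<le> indicator A x * ((cmod (f x))\<^sup>2 / (x - c)\<^sup>2)" by simp
      then show "norm (indicator A x * ((cmod (f x))\<^sup>2 / (x - c)\<^sup>2)) \<le> norm (indicator A x * (cmod (f x))\<^sup>2 / h\<^sup>2)"
        unfolding real_norm_def using le[of x] by linarith
    qed
    show "(\<lambda>x. indicator A x * ((cmod (f x))\<^sup>2 / (x - c)\<^sup>2)) \<in> borel_measurable lborel"
      using A(1) m by simp
  qed
  have "(LINT x|lborel. indicator A x * ((cmod (f x))\<^sup>2 / (x - c)\<^sup>2))
      \<le> (LINT x|lborel. indicator A x * (cmod (f x))\<^sup>2 / h\<^sup>2)"
    by (intro integral_mono int le integrable_divide integrable_restrict_f A)
  then show "(LINT x|lborel. indicator A x * ((cmod (f x))\<^sup>2 / (x - c)\<^sup>2))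
      \<le> (LINT x|lborel. indicator A x * (cmod (f x))\<^sup>2) / h\<^sup>2" by simp
qed

text \<open>Shrinking the interval enlarges the tail only by the shell between the two triples,
  where |x - c| is at least \<open>h2\<close>.\<close>

lemma tail_child:
  assumes Q: "l \<le> l1" "l1 + h1 \<le> l + h" and S: "l1 \<le> l2" "l2 + h2 \<le> l1 + h1" and h2: "h2 > 0"
    and c: "c \<in> ival l2 h2"
  shows "tail l h l2 h2 c \<le> tail l h l1 h1 c + sq3 l1 h1 / h2\<^sup>2"
proof -
  have h1: "h1 > 0" using S h2 by linarith
  have c1: "c \<in> ival l1 h1" using c S unfolding atLeastLessThan_iff by linarith
  have "l1 - h1 \<le> l2 - h2" "l2 + 2 * h2 \<le> l1 + 2 * h1" "l - h \<le> l1 - h1" "l1 + 2 * h1 \<le> l + 2 * h"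
    using Q S by linarith+
  then have sub: "ival3 l2 h2 \<subseteq> ival3 l1 h1" "ival3 l1 h1 \<subseteq> ival3 l h"
    by (simp_all add: ivl_subset)
  let ?p = "\<lambda>x. (cmod (f x))\<^sup>2 / (x - c)\<^sup>2"
  have 1: "integrable lborel (\<lambda>x. indicator (ival3 l h - ival3 l1 h1) x * ?p x)"
    by (rule tail_piece(1)[OF _ Diff_Int_self h1 c1]) simp
  have 2: "integrable lborel (\<lambda>x. indicator (ival3 l1 h1 - ival3 l2 h2) x * ?p x)"
    by (rule tail_piece(1)[OF _ Diff_Int_self h2 c]) simp
  note ind = indicator_Diff_split[OF sub]
  have split: "tail l h l2 h2 c = tail l h l1 h1 c + (LINT x|lborel. indicator (ival3 l1 h1 - ival3 l2 h2) x * ?p x)"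
    unfolding tail_def ind distrib_right by (rule Bochner_Integration.integral_add[OF 1 2])
  have "(LINT x|lborel. indicator (ival3 l1 h1 - ival3 l2 h2) x * ?p x)
     \<le> (LINT x|lborel. indicator (ival3 l1 h1 - ival3 l2 h2) x * (cmod (f x))\<^sup>2) / h2\<^sup>2"
    by (rule tail_piece(2)[OF _ Diff_Int_self h2 c]) simp
  moreover have "(LINT x|lborel. indicator (ival3 l1 h1 - ival3 l2 h2) x * (cmod (f x))\<^sup>2) / h2\<^sup>2 \<le> sq3 l1 h1 / h2\<^sup>2"
    unfolding sq3_def
    by (intro divide_right_mono integral_mono integrable_restrict_f mult_right_mono)
      (auto simp: indicator_def simp del: atLeastLessThan_iff)
  ultimately show ?thesis unfolding split by linarith
qed

definition stops :: "real \<Rightarrow> real \<Rightarrow> real \<Rightarrow> real \<Rightarrow> bool" where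
  "stops m v l h \<longleftrightarrow> mass l h > 64 * v * h \<or> sq3 l h > 64 * m * h"

text \<open>The invariant of the bisection. It has to hold at stopped intervals too, so it allows
  twice the threshold 64 of \<open>stops\<close>: halving an interval that did not stop can at most
  double its ratios.\<close>

definition adm :: "real \<Rightarrow> real \<Rightarrow> real \<Rightarrow> real \<Rightarrow> real \<Rightarrow> real \<Rightarrow> bool" where
  "adm l h m v l' h' \<longleftrightarrow> l \<le> l' \<and> l' + h' \<le> l + h \<and> mass l' h' \<le> 128 * v * h' \<and> sq3 l' h' \<le> 128 * m * h' \<and>
     (\<forall>c\<in>ival l' h'. tail l h l' h' c \<le> 256 * m / h')"

lemma adm_child:
  assumes adm: "adm l h m v l1 h1" and h1: "h1 > 0" and ns: "\<not> stops m v l1 h1" and m: "m \<ge> 0"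
    and l2: "l2 = l1 \<or> l2 = l1 + h1 / 2"
  shows "adm l h m v l2 (h1 / 2)"
proof -
  have sub: "l1 \<le> l2" "l2 + h1 / 2 \<le> l1 + h1" using l2 h1 by auto
  have Q: "l \<le> l1" "l1 + h1 \<le> l + h" using adm by (auto simp: adm_def)
  have ns': "mass l1 h1 \<le> 64 * v * h1" "sq3 l1 h1 \<le> 64 * m * h1" using ns by (auto simp: stops_def)
  have "mass l2 (h1 / 2) \<le> mass l1 h1" using sub by (intro mass_mono) auto
  moreover have "sq3 l2 (h1 / 2) \<le> sq3 l1 h1" using sub h1 by (intro sq3_mono) auto
  moreover have "tail l h l2 (h1 / 2) c \<le> 256 * m / (h1 / 2)" if c: "c \<in> ival l2 (h1 / 2)" for c
  proof -
    have "tail l h l2 (h1 / 2) c \<le> tail l h l1 h1 c + sq3 l1 h1 / (h1 / 2)\<^sup>2"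
      by (rule tail_child[OF Q sub _ c]) (use h1 in simp)
    also have "\<dots> \<le> 256 * m / h1 + (64 * m * h1) / (h1 / 2)\<^sup>2"
    proof (intro add_mono divide_right_mono ns')
      show "tail l h l1 h1 c \<le> 256 * m / h1" using adm c sub by (auto simp: adm_def)
    qed simp
    \<comment> \<open>256 is the value that reproduces itself: the shell adds 64 m h1 / (h1 / 2)^2 =
      256 m / h1, which together with the old tail gives 512 m / h1.\<close>
    also have "\<dots> = 256 * m / (h1 / 2)" using h1 by (simp add: power2_eq_square field_simps)
    finally show ?thesis .
  qed
  moreover have "128 * v * (h1 / 2) = 64 * v * h1" "128 * m * (h1 / 2) = 64 * m * h1" by simp_all
  ultimately show ?thesis using ns' Q sub unfolding adm_def
    by (intro conjI ballI) (linarith | blast)+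
qed

text \<open>Intervals stopped by the mass of \<open>g\<close> are disjoint and fill at most h / 64.
  For those stopped by \<open>f\<close> the triples matter, and the Vitali selection gives 15 h /
  64. The total is h / 4.\<close>

lemma stopped_length:
  assumes h: "h > 0" and m: "sq3 l h = m * h" and v: "mass l h = v * h"
    and P: "finite P" "disjoint_family_on ivals P"
    and Q: "\<And>p. p \<in> P \<Longrightarrow> snd p > 0 \<and> l \<le> fst p \<and> fst p + snd p \<le> l + h \<and> stops m v (fst p) (snd p)"
  shows "(\<Sum>p\<in>P. snd p) \<le> h / 2"
proof -
  have m0: "m \<ge> 0" using sq3_nonneg[of l h] m h by (simp add: zero_le_mult_iff)
  have v0: "v \<ge> 0" using mass_nonneg[of l h] v h by (simp add: zero_le_mult_iff)
  have sub: "ivals p \<subseteq> ival l h" "ivals3 p \<subseteq> ival3 l h" if "p \<in> P" for p using Q[OF that] by auto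
  define P1 where "P1 = {p \<in> P. mass (fst p) (snd p) > 64 * v * snd p}"
  define P2 where "P2 = {p \<in> P. sq3 (fst p) (snd p) > 64 * m * snd p}"
  have P12: "P = P1 \<union> P2" "finite P1" "finite P2" "P1 \<subseteq> P" "P2 \<subseteq> P"
    using Q P by (auto simp: P1_def P2_def stops_def)
  have dis: "disjoint_family_on ivals P1" "disjoint_family_on ivals P2"
    using P(2) P12 disjoint_family_on_mono by blast+
  have A: "64 * (\<Sum>p\<in>P1. snd p) \<le> h"
  proof (cases "P1 = {}")
    case False
    then obtain q where q: "q \<in> P1" by blast
    \<comment> \<open>The strict inequality in \<open>stops\<close> forces \<open>v\<close> to be
      positive as soon as one interval stops, so \<open>v\<close> can be cancelled below.\<close>
    have "0 \<le> 64 * v * snd q" using v0 Q[of q] q P12 by (intro mult_nonneg_nonneg) (auto intro: less_imp_le)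
    moreover have "64 * v * snd q < mass (fst q) (snd q)" using q by (simp add: P1_def)
    moreover have "mass (fst q) (snd q) \<le> mass l h"
      using sub(1)[of q] q P12 by (intro mass_mono) auto
    ultimately have vp: "v > 0" using v h by (metis less_le_trans le_less_trans zero_less_mult_pos2)
    have "v * (64 * (\<Sum>p\<in>P1. snd p)) = (\<Sum>p\<in>P1. 64 * v * snd p)" unfolding sum_distrib_left by (intro sum.cong refl) simp
    also have "\<dots> \<le> (\<Sum>p\<in>P1. mass (fst p) (snd p))" by (intro sum_mono) (simp add: P1_def)
    also have "\<dots> \<le> mass l h"
      unfolding mass_def
      by (rule sum_integral_disjoint_le[OF P12(2) dis(1)]) (use sub(1) P12 integrable_vec_g in auto)
    finally show ?thesis using v vp by simp
  qed (use h in simp)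
  have Bd: "64 * (\<Sum>p\<in>P2. snd p) \<le> 15 * h"
  proof (cases "P2 = {}")
    case False
    then obtain q where q: "q \<in> P2" by blast
    have "0 \<le> 64 * m * snd q" using m0 Q[of q] q P12 by (intro mult_nonneg_nonneg) (auto intro: less_imp_le)
    moreover have "64 * m * snd q < sq3 (fst q) (snd q)" using q by (simp add: P2_def)
    moreover have "sq3 (fst q) (snd q) \<le> sq3 l h"
      using sub(2)[of q] q P12 by (intro sq3_mono) auto
    ultimately have mp: "m > 0" using m h by (metis less_le_trans le_less_trans zero_less_mult_pos2)
    obtain C where C: "C \<subseteq> P2" "disjoint_family_on ivals3 C" "(\<Sum>p\<in>P2. snd p) \<le> 15 * (\<Sum>p\<in>C. snd p)"
      using sum_length_Vitali[OF P12(3) dis(2)] Q P12 by blast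
    have finC: "finite C" using C(1) P12(3) finite_subset by blast
    have "m * (64 * (\<Sum>p\<in>C. snd p)) = (\<Sum>p\<in>C. 64 * m * snd p)" unfolding sum_distrib_left by (intro sum.cong refl) simp
    also have "\<dots> \<le> (\<Sum>p\<in>C. sq3 (fst p) (snd p))" using C(1) by (intro sum_mono) (auto simp: P2_def)
    also have "\<dots> \<le> sq3 l h"
      unfolding sq3_def
      by (rule sum_integral_disjoint_le[OF finC C(2)])
        (use sub(2) P12 C(1) bounded_cs_norm_integrable(2)[OF bounded_f] in auto)
    finally have "64 * (\<Sum>p\<in>C. snd p) \<le> h" using m mp by simp
    then show ?thesis using C(3) by linarith
  qed (use h in simp)
  have "(\<Sum>p\<in>P. snd p) \<le> (\<Sum>p\<in>P1. snd p) + (\<Sum>p\<in>P2. snd p)"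
  proof -
    have "0 \<le> (\<Sum>p\<in>P1 \<inter> P2. snd p)" using Q P12 by (intro sum_nonneg) (auto intro: less_imp_le)
    then show ?thesis unfolding P12(1) using sum.union_inter[OF P12(2,3), of snd] by linarith
  qed
  then show ?thesis using A Bd h by linarith
qed

text \<open>The kernels are bounded by the band lengths and both cutoffs have length proportional to
  \<open>h\<close>. \<open>C\<close> may depend on \<open>f\<close>, \<open>g\<close> and the bands,
  since it only decides how deep the recursion runs.\<close>

lemma Loc_le_square:
  obtains C where "C \<ge> 0" "\<And>l h. h > 0 \<Longrightarrow> cmod (Loc l h) \<le> C * h\<^sup>2"
proof -
  obtain Mf where Mf: "Mf > 0" "\<And>x. cmod (f x) \<le> Mf" using bounded_f by (rule bounded_csE) blast
  have "\<forall>k\<in>{1..N}. \<exists>M>0. \<forall>x. cmod (g k x) \<le> M"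
    using bounded_g by (metis bounded_csE)
  then obtain Mg where Mg: "\<And>k. k \<in> {1..N} \<Longrightarrow> Mg k > 0" "\<And>k x. k \<in> {1..N} \<Longrightarrow> cmod (g k x) \<le> Mg k"
    by metis
  define C where "C = (\<Sum>k=1..N. 3 * Mf * Mg k * (b k - a k))"
  have I: "r \<le> s \<Longrightarrow> integrable lborel (\<lambda>x. c * indicator {r..<s} x)" "r \<le> s \<Longrightarrow> (LINT x|lborel. c * indicator {r..<s} x) = c * (s - r)" for c r s :: real
    by auto
  show thesis
  proof (rule that)
    show "C \<ge> 0" unfolding C_def using Mf Mg a_le_b
      by (intro sum_nonneg mult_nonneg_nonneg) (auto intro: less_imp_le)
    fix l h :: real assume h: "h > 0"
    have "cmod (band_form (a k) (b k) (\<lambda>x. indicator (ival3 l h) x * f x) (\<lambda>x. indicator (ival l h) x * g k x))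
       \<le> (3 * Mf * Mg k * (b k - a k)) * h\<^sup>2" if k: "k \<in> {1..N}" for k
    proof -
      have ba: "0 \<le> b k - a k" using a_le_b[OF k] by simp
      have inner: "cmod (LINT y|lborel. (indicator (ival3 l h) y * f y) * kern (a k) (b k) (x - y)) \<le> Mf * (b k - a k) * (3 * h)" for x
      proof -
        have "cmod (LINT y|lborel. (indicator (ival3 l h) y * f y) * kern (a k) (b k) (x - y))
           \<le> (LINT y|lborel. (Mf * (b k - a k)) * indicator (ival3 l h) y)"
        proof (rule norm_integral_le[OF I(1)])
          fix y
          have "cmod (f y) * cmod (kern (a k) (b k) (x - y)) \<le> Mf * (b k - a k)"
            using Mf kern_bound[OF a_le_b[OF k]] by (intro mult_mono) auto
          then show "cmod ((indicator (ival3 l h) y * f y) * kern (a k) (b k) (x - y)) \<le> (Mf * (b k - a k)) * indicator (ival3 l h) y"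
            by (auto simp: indicator_def norm_mult)
        qed (use h in simp)
        also have "\<dots> = Mf * (b k - a k) * (3 * h)" using h by (subst I(2)) auto
        finally show ?thesis .
      qed
      have "cmod (band_form (a k) (b k) (\<lambda>x. indicator (ival3 l h) x * f x) (\<lambda>x. indicator (ival l h) x * g k x))
        \<le> (LINT x|lborel. (Mg k * (Mf * (b k - a k) * (3 * h))) * indicator (ival l h) x)"
        unfolding band_form_def
      proof (rule norm_integral_le[OF I(1)])
        fix x
        have "cmod (g k x) * cmod (LINT y|lborel. (indicator (ival3 l h) y * f y) * kern (a k) (b k) (x - y)) \<le> Mg k * (Mf * (b k - a k) * (3 * h))"
          using Mg[OF k] by (intro mult_mono inner) (auto intro: less_imp_le)
        then show "cmod ((indicator (ival l h) x * g k x) * (LINT y|lborel. (indicator (ival3 l h) y * f y) * kern (a k) (b k) (x - y)))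
           \<le> (Mg k * (Mf * (b k - a k) * (3 * h))) * indicator (ival l h) x"
          by (cases "x \<in> ival l h") (auto simp: norm_mult)
      qed (use h in simp)
      also have "\<dots> = (3 * Mf * Mg k * (b k - a k)) * h\<^sup>2" using h by (subst I(2)) (auto simp: power2_eq_square)
      finally show ?thesis .
    qed
    then show "cmod (Loc l h) \<le> C * h\<^sup>2"
      unfolding Loc_def Form_def C_def sum_distrib_right by (intro sum_norm_le)
  qed
qed


end

section \<open>Sparse domination\<close>

context form_data
begin

text \<open>Strong induction on the remaining depth. A stopped interval of length h / 2^n is treated
  with depth d - n, so its error is C h / 2^d per unit length, the same rate as for the leaves at
  the depth limit; the leaves partition the interval and the errors sum to C h^2 / 2^d. For d > 0
  the top pair is recorded in \<open>S\<close> because its term must later absorb this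
  error.\<close>

lemma finite_sparse_domination:
  assumes C: "C \<ge> 0" "\<forall>l h. h > 0 \<longrightarrow> cmod (Loc l h) \<le> C * h\<^sup>2"
  shows "h > 0 \<Longrightarrow> \<exists>S E. finite S \<and> (d > 0 \<longrightarrow> (l, h) \<in> S) \<and>
    (\<forall>p\<in>S. snd p > 0 \<and> snd p \<le> h \<and> E p \<in> sets borel \<and> E p \<subseteq> ivals p \<and> ivals p \<subseteq> ival l h \<and> snd p / 2 \<le> measure lborel (E p)) \<and>
    disjoint_family_on E S \<and>
    cmod (Loc l h) \<le> 1100 * sqrt B * (\<Sum>p\<in>S. sqrt (sq3 (fst p) (snd p) / snd p) * mass (fst p) (snd p)) + C * h\<^sup>2 / 2 ^ d"
proof (induction d arbitrary: l h rule: less_induct)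
  case (less d)
  show ?case
  proof (cases "d = 0")
    case True
    then show ?thesis using C(2)[rule_format, OF less.prems]
      by (intro exI[of _ "{}"] exI[of _ "\<lambda>_. {}"]) (auto simp: disjoint_family_on_def)
  next
    case False
    note h = less.prems
    define m where "m = sq3 l h / h"
    define v where "v = mass l h / h"
    have m: "sq3 l h = m * h" "m \<ge> 0" and v: "mass l h = v * h" "v \<ge> 0"
      using h sq3_nonneg[of l h] mass_nonneg[of l h] by (auto simp: m_def v_def)
    have start: "adm l h m v l h"
      unfolding adm_def using m v h by (auto simp: tail_def)
    \<comment> \<open>At the top the ratios are exactly \<open>m\<close> and \<open>v\<close>, so it
      does not stop. Stopped intervals are therefore strictly shorter and the depth drops in the
      induction.\<close>
    have ns: "\<not> stops m v l h" unfolding stops_def m(1) v(1) using m(2) v(2) h by (auto simp: not_less)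
    obtain P where P: "finite P" "disjoint_family_on ivals P" "(\<Union>p\<in>P. ivals p) = ival l h"
      "\<forall>(l', h')\<in>P. adm l h m v l' h' \<and> h' > 0 \<and> l \<le> l' \<and> l' + h' \<le> l + h \<and>
         (\<exists>n\<le>d. h' = h / 2 ^ n \<and> (n = d \<or> stops m v l' h'))"
    proof -
      have "\<exists>P. finite P \<and> disjoint_family_on ivals P \<and> (\<Union>p\<in>P. ivals p) = ival l h \<and>
        (\<forall>(l', h')\<in>P. adm l h m v l' h' \<and> h' > 0 \<and> l \<le> l' \<and> l' + h' \<le> l + h \<and>
         (\<exists>n\<le>d. h' = h / 2 ^ n \<and> (n = d \<or> stops m v l' h')))"
      proof (rule dyadic_stopping[where Inv = "adm l h m v" and stop = "stops m v", OF _ h start])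
        fix l1 h1 assume a: "adm l h m v l1 h1" "0 < h1" "\<not> stops m v l1 h1"
        show "adm l h m v l1 (h1 / 2) \<and> adm l h m v (l1 + h1 / 2) (h1 / 2)"
          using adm_child[OF a m(2)] by blast
      qed
      then show thesis by (elim exE conjE) (rule that)
    qed
    have PQ: "snd p > 0 \<and> l \<le> fst p \<and> fst p + snd p \<le> l + h" and Padm: "adm l h m v (fst p) (snd p)"
      and Pn: "\<exists>n\<le>d. snd p = h / 2 ^ n \<and> (n = d \<or> stops m v (fst p) (snd p))" if "p \<in> P" for p
      using bspec[OF P(4) that] unfolding case_prod_beta by simp_all
    have sub: "ivals p \<subseteq> ival l h" if "p \<in> P" for p using P(3) that by blast
    define T where "T = {p \<in> P. stops m v (fst p) (snd p)}"
    have T: "finite T" "T \<subseteq> P" using P by (auto simp: T_def)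
    have disT: "disjoint_family_on ivals T" using P(2) T(2) by (rule disjoint_family_on_mono[rotated])
    have Tlt: "snd p < h" if p: "p \<in> T" for p
    proof (rule ccontr)
      assume "\<not> snd p < h"
      then have "fst p = l" "snd p = h" using PQ[of p] p T(2) by auto
      then show False using ns p by (auto simp: T_def)
    qed
    have sumP: "(\<Sum>p\<in>P. snd p) = h"
      using sum_length_le[OF P(1,2)] PQ P(3) h by simp
    have sumT: "(\<Sum>p\<in>T. snd p) \<le> h / 2"
      by (rule stopped_length[OF h m(1) v(1) T(1) disT]) (use PQ T in \<open>auto simp: T_def\<close>)
    define good where "good p S E \<longleftrightarrow> finite S \<and>
      (\<forall>q\<in>S. snd q > 0 \<and> snd q \<le> snd p \<and> E q \<in> sets borel \<and> E q \<subseteq> ivals q \<and> ivals q \<subseteq> ivals p \<and> snd q / 2 \<le> measure lborel (E q)) \<and>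
      disjoint_family_on E S \<and>
      cmod (Loc (fst p) (snd p)) \<le> 1100 * sqrt B * (\<Sum>q\<in>S. sqrt (sq3 (fst q) (snd q) / snd q) * mass (fst q) (snd q))
        + C * h / 2 ^ d * snd p" for p S E
    have "\<exists>S E. good p S E" if p: "p \<in> T" for p
    proof -
      obtain n where n: "n \<le> d" "snd p = h / 2 ^ n" using Pn p T by blast
      have "n \<noteq> 0" using Tlt[OF p] n(2) by (cases "n = 0") auto
      then have lt: "d - n < d" using False by simp
      have eq: "C * (snd p)\<^sup>2 / 2 ^ (d - n) = C * h / 2 ^ d * snd p"
      proof -
        have "(2::real) ^ d = 2 ^ n * 2 ^ (d - n)" using n(1) by (simp flip: power_add)
        then show ?thesis unfolding n(2) by (simp add: power2_eq_square mult_ac)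
      qed
      have hp: "snd p > 0" using PQ[of p] p T(2) by blast
      obtain S E where IH: "finite S"
        "\<forall>q\<in>S. snd q > 0 \<and> snd q \<le> snd p \<and> E q \<in> sets borel \<and> E q \<subseteq> ivals q \<and> ivals q \<subseteq> ivals p \<and> snd q / 2 \<le> measure lborel (E q)"
        "disjoint_family_on E S"
        "cmod (Loc (fst p) (snd p)) \<le> 1100 * sqrt B * (\<Sum>q\<in>S. sqrt (sq3 (fst q) (snd q) / snd q) * mass (fst q) (snd q))
          + C * (snd p)\<^sup>2 / 2 ^ (d - n)"
      proof -
        from less.IH[OF lt hp, of "fst p"] show thesis by (elim exE conjE) (rule that)
      qed
      show ?thesis
        using IH unfolding eq good_def by (intro exI[of _ S] exI[of _ E] conjI)
    qed
    then obtain S E where good: "\<And>p. p \<in> T \<Longrightarrow> good p (S p) (E p)"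
      by metis
    have SE: "finite (S p)"
       "q \<in> S p \<Longrightarrow> snd q > 0 \<and> snd q \<le> snd p \<and> E p q \<in> sets borel \<and> E p q \<subseteq> ivals q \<and> ivals q \<subseteq> ivals p \<and> snd q / 2 \<le> measure lborel (E p q)"
       "disjoint_family_on (E p) (S p)"
       "cmod (Loc (fst p) (snd p)) \<le> 1100 * sqrt B * (\<Sum>q\<in>S p. sqrt (sq3 (fst q) (snd q) / snd q) * mass (fst q) (snd q))
        + C * h / 2 ^ d * snd p" if p: "p \<in> T" for p q
    proof -
      note G1 = good[OF p, unfolded good_def]
      note G2 = G1[THEN conjunct2]
      note G3 = G2[THEN conjunct2]
      show "finite (S p)" by (rule G1[THEN conjunct1])
      show "snd q > 0 \<and> snd q \<le> snd p \<and> E p q \<in> sets borel \<and> E p q \<subseteq> ivals q \<and> ivals q \<subseteq> ivals p \<and> snd q / 2 \<le> measure lborel (E p q)"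
        if "q \<in> S p" by (rule bspec[OF G2[THEN conjunct1] that])
      show "disjoint_family_on (E p) (S p)" by (rule G3[THEN conjunct1])
      show "cmod (Loc (fst p) (snd p)) \<le> 1100 * sqrt B * (\<Sum>q\<in>S p. sqrt (sq3 (fst q) (snd q) / snd q) * mass (fst q) (snd q))
        + C * h / 2 ^ d * snd p" by (rule G3[THEN conjunct2])
    qed
    define S' where "S' = insert (l, h) (\<Union>p\<in>T. S p)"
    \<comment> \<open>The top interval keeps what the stopped intervals leave free, at least half of
      it. For any other pair in \<open>S'\<close> the union has a single member: by
      \<open>uniq\<close> it comes from only one stopped interval.\<close>
    define E' where "E' q = (if q = (l, h) then ival l h - (\<Union>p\<in>T. ivals p) else (\<Union>p\<in>{p\<in>T. q \<in> S p}. E p q))" for q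
    have new: "(l, h) \<notin> S p" if "p \<in> T" for p
      using SE(2)[OF that, of "(l, h)"] Tlt[OF that] by auto
    have uniq: "p = p'" if "p \<in> T" "p' \<in> T" "q \<in> S p" "q \<in> S p'" for p p' q
    proof -
      have "fst q \<in> ivals q" using SE(2)[OF that(1,3)] by simp
      then have "fst q \<in> ivals p \<inter> ivals p'" using SE(2)[OF that(1,3)] SE(2)[OF that(2,4)] by blast
      then show ?thesis using disT that unfolding disjoint_family_on_def by blast
    qed
    have E'_eq: "E' q = E p q" if "p \<in> T" "q \<in> S p" for p q
    proof -
      have "{p\<in>T. q \<in> S p} = {p}" using uniq that by blast
      moreover have "q \<noteq> (l, h)" using new that by blast
      ultimately show ?thesis by (simp add: E'_def)
    qed
    have E'_top: "E' (l, h) = ival l h - (\<Union>p\<in>T. ivals p)" by (simp add: E'_def)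
    have err: "cmod (Loc (fst p) (snd p)) \<le> C * h / 2 ^ d * snd p" if p: "p \<in> P - T" for p
    proof -
      obtain n where "n \<le> d" "snd p = h / 2 ^ n" "n = d \<or> stops m v (fst p) (snd p)" using Pn p by blast
      then have hp: "snd p = h / 2 ^ d" using p by (auto simp: T_def)
      have "cmod (Loc (fst p) (snd p)) \<le> C * (snd p)\<^sup>2" using C(2) PQ[of p] p by blast
      also have "\<dots> = C * h / 2 ^ d * snd p" unfolding hp by (simp add: power2_eq_square)
      finally show ?thesis .
    qed
    let ?t = "\<lambda>q. sqrt (sq3 (fst q) (snd q) / snd q) * mass (fst q) (snd q)"
    have main: "cmod (Loc l h) \<le> 1100 * sqrt B * (\<Sum>q\<in>S'. ?t q) + C * h\<^sup>2 / 2 ^ d"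
    proof -
      have "(\<Sum>p\<in>P. cmod (Loc (fst p) (snd p))) = (\<Sum>p\<in>T. cmod (Loc (fst p) (snd p))) + (\<Sum>p\<in>P - T. cmod (Loc (fst p) (snd p)))"
        using sum.subset_diff[OF T(2) P(1), of "\<lambda>p. cmod (Loc (fst p) (snd p))"] by linarith
      also have "\<dots> \<le> (\<Sum>p\<in>T. 1100 * sqrt B * (\<Sum>q\<in>S p. ?t q) + C * h / 2 ^ d * snd p) + (\<Sum>p\<in>P - T. C * h / 2 ^ d * snd p)"
        by (intro add_mono sum_mono SE(4) err)
      also have "\<dots> = 1100 * sqrt B * (\<Sum>p\<in>T. \<Sum>q\<in>S p. ?t q) + ((\<Sum>p\<in>T. C * h / 2 ^ d * snd p) + (\<Sum>p\<in>P - T. C * h / 2 ^ d * snd p))"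
        by (simp only: sum.distrib sum_distrib_left add.assoc)
      finally have bound: "(\<Sum>p\<in>P. cmod (Loc (fst p) (snd p)))
         \<le> 1100 * sqrt B * (\<Sum>p\<in>T. \<Sum>q\<in>S p. ?t q) + ((\<Sum>p\<in>T. C * h / 2 ^ d * snd p) + (\<Sum>p\<in>P - T. C * h / 2 ^ d * snd p))" .
      have "(\<Sum>p\<in>T. C * h / 2 ^ d * snd p) + (\<Sum>p\<in>P - T. C * h / 2 ^ d * snd p) = (\<Sum>p\<in>P. C * h / 2 ^ d * snd p)"
        using sum.subset_diff[OF T(2) P(1), of "\<lambda>p. C * h / 2 ^ d * snd p"] by linarith
      also have "\<dots> = C * h\<^sup>2 / 2 ^ d"
        unfolding sum_distrib_left[symmetric] sumP by (simp add: power2_eq_square)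
      finally have errors: "(\<Sum>p\<in>T. C * h / 2 ^ d * snd p) + (\<Sum>p\<in>P - T. C * h / 2 ^ d * snd p) = C * h\<^sup>2 / 2 ^ d" .
      have "S p \<inter> S p' = {}" if "p \<in> T" "p' \<in> T" "p \<noteq> p'" for p p'
        using uniq[OF that(1,2)] that(3) by blast
      then have union: "(\<Sum>p\<in>T. \<Sum>q\<in>S p. ?t q) = (\<Sum>q\<in>(\<Union>p\<in>T. S p). ?t q)"
        by (intro sum.UNION_disjoint[symmetric] T(1) ballI SE(1) impI)
      have ins: "(\<Sum>q\<in>S'. ?t q) = ?t (l, h) + (\<Sum>q\<in>(\<Union>p\<in>T. S p). ?t q)"
        unfolding S'_def by (rule sum.insert) (use T(1) SE(1) new in blast)+
      have step: "cmod (Loc l h) \<le> (\<Sum>p\<in>P. cmod (Loc (fst p) (snd p))) + 1100 * (sqrt (B * m) * (v * h))"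
      proof (rule Loc_step[OF h P(1-3) PQ])
        fix p assume p: "p \<in> P"
        note q = Padm[OF p, unfolded adm_def]
        show "mass (fst p) (snd p) \<le> 128 * v * snd p" "sq3 (fst p) (snd p) \<le> 128 * m * snd p"
          using q by blast+
        have "fst p \<in> ivals p" using PQ[OF p] by simp
        then show "tail l h (fst p) (snd p) (fst p) \<le> 256 * m / snd p" using q by blast
      qed (use m v in auto)
      have head: "1100 * (sqrt (B * m) * (v * h)) = 1100 * sqrt B * ?t (l, h)"
        unfolding real_sqrt_mult by (simp add: m_def v(1))
      show ?thesis
        using step bound unfolding head ins distrib_left errors union by linarith
    qed
    have top: "E' (l, h) \<in> sets borel" "h / 2 \<le> measure lborel (E' (l, h))"
    proof -
      have bT: "(\<Union>p\<in>T. ivals p) \<in> sets borel" using T(1) by (intro sets.finite_UN) auto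
      then show "E' (l, h) \<in> sets borel" unfolding E'_top by auto
      have "measure lborel (ival l h - (\<Union>p\<in>T. ivals p)) = measure lborel (ival l h) - measure lborel (\<Union>p\<in>T. ivals p)"
      proof (rule measure_Diff)
        show "(\<Union>p\<in>T. ivals p) \<subseteq> ival l h" using sub T(2) by blast
      qed (use bT h in simp_all)
      also have "\<dots> = h - (\<Sum>p\<in>T. snd p)"
      proof -
        have "snd p > 0" if "p \<in> T" for p using PQ that T(2) by blast
        from sum_length_le[OF T(1) disT this] show ?thesis using h by simp
      qed
      finally show "h / 2 \<le> measure lborel (E' (l, h))" unfolding E'_top using sumT by simp
    qed
    have props: "snd p > 0 \<and> snd p \<le> h \<and> E' p \<in> sets borel \<and> E' p \<subseteq> ivals p \<and> ivals p \<subseteq> ival l h \<and> snd p / 2 \<le> measure lborel (E' p)"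
      if pS: "p \<in> S'" for p
    proof (cases "p = (l, h)")
      case True
      then show ?thesis using top h E'_top by auto
    next
      case False
      then obtain q where q: "q \<in> T" "p \<in> S q" using pS by (auto simp: S'_def)
      have "ivals q \<subseteq> ival l h" using sub T(2) q(1) by blast
      then show ?thesis using SE(2)[OF q] Tlt[OF q(1)] unfolding E'_eq[OF q] by auto
    qed
    have "disjoint_family_on E' S'"
      unfolding disjoint_family_on_def
    proof (intro ballI impI)
      have top_dis: "E' (l, h) \<inter> E' q = {}" if q: "q \<in> S'" "q \<noteq> (l, h)" for q
      proof -
        obtain p where p: "p \<in> T" "q \<in> S p" using q by (auto simp: S'_def)
        have "E' q \<subseteq> ivals p" using SE(2)[OF p] unfolding E'_eq[OF p] by blast
        then show ?thesis unfolding E'_top using p by blast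
      qed
      fix q q' assume q: "q \<in> S'" "q' \<in> S'" "q \<noteq> q'"
      show "E' q \<inter> E' q' = {}"
      proof (cases "q = (l, h) \<or> q' = (l, h)")
        case True
        then show ?thesis using top_dis[of q] top_dis[of q'] q by auto
      next
        case False
        obtain p where p: "p \<in> T" "q \<in> S p" using q False by (auto simp: S'_def)
        obtain p' where p': "p' \<in> T" "q' \<in> S p'" using q False by (auto simp: S'_def)
        show ?thesis
        proof (cases "p = p'")
          case True
          then show ?thesis
            using SE(3)[OF p(1)] p p' q(3) unfolding E'_eq[OF p] E'_eq[OF p'] disjoint_family_on_def by blast
        next
          case False
          then have "ivals p \<inter> ivals p' = {}" using disT p p' unfolding disjoint_family_on_def by blast
          then show ?thesis using SE(2)[OF p] SE(2)[OF p'] unfolding E'_eq[OF p] E'_eq[OF p'] by blast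
        qed
      qed
    qed
    moreover have "finite S'" unfolding S'_def using T SE(1) by auto
    moreover have "(l, h) \<in> S'" by (simp add: S'_def)
    ultimately show ?thesis using main props by (intro exI[of _ S'] exI[of _ E']) blast
  qed
qed


text \<open>The degenerate case in which the top term of the sparse sum vanishes and could not
  absorb the truncation error.\<close>

lemma Loc_eq_0:
  assumes "sq3 l h = 0 \<or> mass l h = 0"
  shows "Loc l h = 0"
proof -
  let ?f = "\<lambda>x. indicator (ival3 l h) x * f x" and ?g = "\<lambda>k x. indicator (ival l h) x * g k x"
  have bf: "bounded_cs ?f" by (intro bounded_cs_restrict bounded_f) simp
  have bg: "bounded_cs (?g k)" if "k \<in> {1..N}" for k by (intro bounded_cs_restrict bounded_g that) simp
  have "(LINT x|lborel. (cmod (?f x))\<^sup>2) = 0 \<or> (LINT x|lborel. (vec_abs N ?g x)\<^sup>2) = 0"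
  proof (cases "sq3 l h = 0")
    case True
    have "(LINT x|lborel. (cmod (?f x))\<^sup>2) = sq3 l h"
      unfolding sq3_def by (intro Bochner_Integration.integral_cong) (auto simp: indicator_def)
    then show ?thesis using True by simp
  next
    case False
    then have "mass l h = 0" using assms by simp
    then have "AE x in lborel. indicator (ival l h) x * vec_abs N g x = 0"
      unfolding mass_def
      by (subst (asm) integral_nonneg_eq_0_iff_AE) (auto intro: integrable_restrict_g)
    then have "AE x in lborel. (vec_abs N ?g x)\<^sup>2 = 0"
      unfolding vec_abs_restrict by simp
    then have "(LINT x|lborel. (vec_abs N ?g x)\<^sup>2) = 0" by (rule integral_eq_zero_AE)
    then show ?thesis by simp
  qed
  then have "B * (LINT x|lborel. (cmod (?f x))\<^sup>2) * (LINT x|lborel. (vec_abs N ?g x)\<^sup>2) = 0" by auto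
  moreover have "cmod (Loc l h) \<le> sqrt (B * (LINT x|lborel. (cmod (?f x))\<^sup>2) * (LINT x|lborel. (vec_abs N ?g x)\<^sup>2))"
    unfolding Loc_def by (rule Form_bound[OF bf bg])
  ultimately have "cmod (Loc l h) \<le> sqrt 0" by (simp only:)
  then show ?thesis by simp
qed

text \<open>The recursion starts on one interval containing all supports, where \<open>Loc\<close>
  is the whole form. The depth is chosen so large that the truncation error is at most the top term
  of the sparse sum; this is the summand 1 in the constant, and no limit is taken.\<close>

lemma sparse_domination_pairs:
  obtains S E where "finite S" "\<And>p. p \<in> S \<Longrightarrow> snd p > 0"
    "\<And>p. p \<in> S \<Longrightarrow> E p \<in> sets borel" "\<And>p. p \<in> S \<Longrightarrow> E p \<subseteq> ivals p"
    "\<And>p. p \<in> S \<Longrightarrow> snd p / 2 \<le> measure lborel (E p)" "disjoint_family_on E S"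
    "cmod (Form f g) \<le> (1100 * sqrt B + 1) * (\<Sum>p\<in>S. sqrt (sq3 (fst p) (snd p) / snd p) * mass (fst p) (snd p))"
proof -
  let ?t = "\<lambda>p. sqrt (sq3 (fst p) (snd p) / snd p) * mass (fst p) (snd p)"
  obtain R0 where R0: "\<And>x. \<bar>x\<bar> > R0 \<Longrightarrow> f x = 0" "R0 > 0" using bounded_f by (rule bounded_csE) blast
  have "\<forall>k\<in>{1..N}. \<exists>R>0. \<forall>x. \<bar>x\<bar> > R \<longrightarrow> g k x = 0"
    using bounded_g by (metis bounded_csE)
  then obtain Rg where Rg: "\<And>k. k \<in> {1..N} \<Longrightarrow> Rg k > 0" "\<And>k x. k \<in> {1..N} \<Longrightarrow> \<bar>x\<bar> > Rg k \<Longrightarrow> g k x = 0"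
    by metis
  define R where "R = R0 + (\<Sum>k=1..N. Rg k)"
  have R: "R \<ge> Rg k" if "k \<in> {1..N}" for k
  proof -
    have "Rg k \<le> (\<Sum>k=1..N. Rg k)" using Rg(1) that by (intro member_le_sum) (auto intro: less_imp_le)
    then show "R \<ge> Rg k" unfolding R_def using R0(2) by simp
  qed
  have RR: "R \<ge> R0" 
  proof -
    have "0 \<le> (\<Sum>k=1..N. Rg k)" using Rg(1) by (intro sum_nonneg) (auto intro: less_imp_le)
    then show ?thesis unfolding R_def by simp
  qed
  define l where "l = - R"
  \<comment> \<open>One unit longer than needed for radius \<open>R\<close>, so that the half-open
    interval contains the right endpoint \<open>R\<close>.\<close>
  define h where "h = 2 * R + 1"
  have h: "h > 0" unfolding h_def using RR R0(2) by simp
  have f_out: "f x = 0" if "x \<notin> ival3 l h" for x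
    using that R0(1)[of x] RR R0(2) unfolding l_def h_def atLeastLessThan_iff by (cases "\<bar>x\<bar> > R0") auto
  have g_out: "g k x = 0" if "k \<in> {1..N}" "x \<notin> ival l h" for k x
    using that(2) Rg(2)[OF that(1), of x] R[OF that(1)] unfolding l_def h_def atLeastLessThan_iff
    by (cases "\<bar>x\<bar> > Rg k") auto
  have Loc: "Loc l h = Form f g"
  proof -
    have "(\<lambda>x. indicator (ival3 l h) x * f x) = f"
      using f_out by (auto simp: indicator_def fun_eq_iff simp del: atLeastLessThan_iff)
    moreover have "Form f (\<lambda>k x. indicator (ival l h) x * g k x) = Form f g"
      by (rule Form_cong) (use g_out in \<open>auto simp: indicator_def simp del: atLeastLessThan_iff atLeastAtMost_iff\<close>)
    ultimately show ?thesis unfolding Loc_def by simp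
  qed
  have t0: "?t p \<ge> 0" if "snd p > 0" for p
    using that sq3_nonneg mass_nonneg by (intro mult_nonneg_nonneg) auto
  show thesis
  proof (cases "sq3 l h = 0 \<or> mass l h = 0")
    case True
    then show thesis
      using that[of "{}" "\<lambda>_. {}"] Loc_eq_0 Loc by (auto simp: disjoint_family_on_def)
  next
    case False
    then have tp: "?t (l, h) > 0"
      using h sq3_nonneg[of l h] mass_nonneg[of l h] by (auto simp: less_le)
    obtain C where C: "C \<ge> 0" "\<forall>l h. h > 0 \<longrightarrow> cmod (Loc l h) \<le> C * h\<^sup>2"
      using Loc_le_square by blast
    obtain n where "C * h\<^sup>2 / ?t (l, h) < 2 ^ n"
      using real_arch_pow[of 2] by auto
    \<comment> \<open>The successor makes the depth positive, which guarantees that the top pair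
      belongs to \<open>S\<close>.\<close>
    moreover have "(2::real) ^ n \<le> 2 ^ Suc n" by simp
    ultimately have "C * h\<^sup>2 / ?t (l, h) < 2 ^ Suc n" by linarith
    then have err: "C * h\<^sup>2 / 2 ^ Suc n \<le> ?t (l, h)" using tp by (simp add: field_simps)
    obtain S E where S: "finite S" "(l, h) \<in> S"
      "\<forall>p\<in>S. snd p > 0 \<and> snd p \<le> h \<and> E p \<in> sets borel \<and> E p \<subseteq> ivals p \<and> ivals p \<subseteq> ival l h \<and> snd p / 2 \<le> measure lborel (E p)"
      "disjoint_family_on E S"
      "cmod (Loc l h) \<le> 1100 * sqrt B * (\<Sum>p\<in>S. ?t p) + C * h\<^sup>2 / 2 ^ Suc n"
    proof -
      from finite_sparse_domination[OF C h, of "Suc n" l] show thesis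
        by (elim exE conjE) (rule that, simp_all)
    qed
    have "?t (l, h) \<le> (\<Sum>p\<in>S. ?t p)"
      by (rule member_le_sum[OF S(2) _ S(1)]) (use S(3) t0 in auto)
    then have "cmod (Form f g) \<le> (1100 * sqrt B + 1) * (\<Sum>p\<in>S. ?t p)"
      using S(5) err unfolding Loc by (simp add: distrib_right)
    with S(1,3,4) show thesis by (intro that[of S E]; blast)
  qed
qed

text \<open>Averaging |f|^2 over the triple divides by 3h instead of \<open>h\<close>, a loss of
  sqrt 3, bounded by 2. Length times average of |g| on the triple is the integral of |g| there,
  which dominates the mass on the interval.\<close>

lemma sparse_term_le:
  assumes h: "h > 0"
  shows "sqrt (sq3 l h / h) * mass l h
    \<le> 2 * (measure lborel (ival3 l h) * avg 2 (ival3 l h) f * avg 1 (ival3 l h) (vec_abs N g))"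
proof -
  define W where "W = (LINT x|lborel. indicator (ival3 l h) x * vec_abs N g x)"
  have mW: "mass l h \<le> W"
    unfolding mass_def W_def using h
    by (intro integral_mono integrable_restrict_g) (auto simp: indicator_def)
  have meas: "measure lborel (ival3 l h) = 3 * h" using h by simp
  have a2: "avg 2 (ival3 l h) f = sqrt (sq3 l h / (3 * h))"
  proof -
    have "(LINT x:ival3 l h|lborel. cmod (f x) powr 2) = sq3 l h"
      unfolding sq3_def set_lebesgue_integral_def by simp
    then show ?thesis
      unfolding avg_def meas using sq3_nonneg[of l h] h by (subst powr_half_sqrt) auto
  qed
  have a1: "avg 1 (ival3 l h) (vec_abs N g) = W / (3 * h)"
  proof -
    have "(LINT x:ival3 l h|lborel. norm (vec_abs N g x) powr 1) = W"
      unfolding W_def set_lebesgue_integral_def by simp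
    moreover have "W \<ge> 0" using mW mass_nonneg[of l h] by linarith
    ultimately show ?thesis unfolding avg_def meas using h by simp
  qed
  have "sqrt (sq3 l h / h) \<le> 2 * sqrt (sq3 l h / (3 * h))"
  proof -
    have "sq3 l h / h \<le> 2\<^sup>2 * (sq3 l h / (3 * h))" using sq3_nonneg[of l h] h by (simp add: field_simps)
    then have "sqrt (sq3 l h / h) \<le> sqrt (2\<^sup>2 * (sq3 l h / (3 * h)))" by (rule real_sqrt_le_mono)
    then show ?thesis unfolding real_sqrt_mult by simp
  qed
  then have "sqrt (sq3 l h / h) * mass l h \<le> 2 * sqrt (sq3 l h / (3 * h)) * W"
    using mW mass_nonneg[of l h] h sq3_nonneg[of l h] by (intro mult_mono) auto
  also have "\<dots> = 2 * (measure lborel (ival3 l h) * avg 2 (ival3 l h) f * avg 1 (ival3 l h) (vec_abs N g))"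
    unfolding a1 a2 meas using h by simp
  finally show ?thesis .
qed

lemma sparse_domination:
  "\<exists>S. sparse_family (1/6) S \<and>
     ennreal (cmod (Form f g)) \<le> ennreal (2 * (1100 * sqrt B + 1)) * sparse_form S N f g"
proof -
  obtain S E where S: "finite S" "\<And>p. p \<in> S \<Longrightarrow> snd p > 0"
    "\<And>p. p \<in> S \<Longrightarrow> E p \<in> sets borel" "\<And>p. p \<in> S \<Longrightarrow> E p \<subseteq> ivals p"
    "\<And>p. p \<in> S \<Longrightarrow> snd p / 2 \<le> measure lborel (E p)" "disjoint_family_on E S"
    "cmod (Form f g) \<le> (1100 * sqrt B + 1) * (\<Sum>p\<in>S. sqrt (sq3 (fst p) (snd p) / snd p) * mass (fst p) (snd p))"
  proof -
    show thesis by (rule sparse_domination_pairs) (rule that)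
  qed
  let ?I = "\<lambda>p. ivals3 p"
  \<comment> \<open>The sparse family is a set of intervals, not of pairs. Injectivity ensures that
    no term of the sum is lost and that each triple inherits one well-defined set
    \<open>E\<close>.\<close>
  have inj: "inj_on ?I S"
  proof (rule inj_onI)
    fix p q assume pq: "p \<in> S" "q \<in> S" "?I p = ?I q"
    then have "fst p - snd p = fst q - snd q \<and> fst p + 2 * snd p = fst q + 2 * snd q"
      using S(2)[OF pq(1)] S(2)[OF pq(2)] iffD1[OF Ico_eq_Ico pq(3)] by linarith
    then have "fst p = fst q \<and> snd p = snd q" by linarith
    then show "p = q" by (simp add: prod_eq_iff)
  qed
  define r where "r = inv_into S ?I"
  have r: "r (?I p) = p" if "p \<in> S" for p unfolding r_def using inj that by (rule inv_into_f_f)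
  have "sparse_family (1/6) (?I ` S)"
    unfolding sparse_family_def
  proof (intro conjI exI[of _ "\<lambda>I. E (r I)"] ballI)
    fix I assume "I \<in> ?I ` S"
    then obtain p where p: "p \<in> S" "I = ?I p" by (rule imageE)
    show "is_interval I" "bounded I" "0 < measure lborel I"
      using S(2)[OF p(1)] p(2) by (auto simp: is_interval_co)
    show "E (r I) \<in> sets lebesgue" using S(3)[OF p(1)] r[OF p(1)] p(2) by simp
    show "E (r I) \<subseteq> I"
      using S(4)[OF p(1)] S(2)[OF p(1)] unfolding p(2) r[OF p(1)] by auto
    show "1 / 6 * measure lborel I \<le> measure lebesgue (E (r I))"
      using S(5)[OF p(1)] S(3)[OF p(1)] S(2)[OF p(1)] unfolding p(2) r[OF p(1)] by simp
  next
    show "disjoint_family_on (\<lambda>I. E (r I)) (?I ` S)"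
      unfolding disjoint_family_on_def
    proof (intro ballI impI)
      fix I J assume IJ: "I \<in> ?I ` S" "J \<in> ?I ` S" "I \<noteq> J"
      obtain p where p: "p \<in> S" "I = ?I p" using IJ(1) by (rule imageE)
      obtain q where q: "q \<in> S" "J = ?I q" using IJ(2) by (rule imageE)
      have "p \<noteq> q" using IJ(3) p q by blast
      then show "E (r I) \<inter> E (r J) = {}"
        unfolding p(2) q(2) r[OF p(1)] r[OF q(1)] by (rule disjoint_family_onD[OF S(6) p(1) q(1)])
    qed
  qed
  moreover have "ennreal (cmod (Form f g)) \<le> ennreal (2 * (1100 * sqrt B + 1)) * sparse_form (?I ` S) N f g"
  proof -
    let ?a = "\<lambda>I. measure lborel I * avg 2 I f * avg 1 I (vec_abs N g)"
    have a0: "?a I \<ge> 0" for I unfolding avg_def by simp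
    have "cmod (Form f g) \<le> (1100 * sqrt B + 1) * (\<Sum>p\<in>S. 2 * ?a (?I p))"
      using B_nonneg S(2) by (intro order_trans[OF S(7)] mult_left_mono sum_mono sparse_term_le) auto
    also have "\<dots> = 2 * (1100 * sqrt B + 1) * (\<Sum>p\<in>S. ?a (?I p))"
      unfolding sum_distrib_left[symmetric] by simp
    also have "(\<Sum>p\<in>S. ?a (?I p)) = (\<Sum>I\<in>?I ` S. ?a I)"
      by (subst sum.reindex[OF inj]) simp
    finally have "ennreal (cmod (Form f g)) \<le> ennreal (2 * (1100 * sqrt B + 1) * (\<Sum>I\<in>?I ` S. ?a I))"
      by (rule ennreal_leI)
    also have "\<dots> = ennreal (2 * (1100 * sqrt B + 1)) * (\<Sum>I\<in>?I ` S. ennreal (?a I))"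
    proof -
      have "0 \<le> 2 * (1100 * sqrt B + 1)" using B_nonneg by simp
      moreover have "0 \<le> (\<Sum>I\<in>?I ` S. ?a I)" by (intro sum_nonneg a0)
      ultimately show ?thesis by (simp only: ennreal_mult sum_ennreal a0)
    qed
    also have "(\<Sum>I\<in>?I ` S. ennreal (?a I)) = sparse_form (?I ` S) N f g"
      unfolding sparse_form_def using S(1) by simp
    finally show ?thesis .
  qed
  ultimately show ?thesis by blast
qed

end

section \<open>From test functions and \<open>sq_form\<close> to the recursive estimate\<close>

lemma bounded_cs_test_function:
  assumes "test_function f"
  shows "bounded_cs f"
proof -
  have "nth_vderiv 0 f = f" by (simp add: nth_vderiv_def)
  moreover have "nth_vderiv 0 f differentiable (at x)" for x
    using assms by (simp add: test_function_def)
  ultimately have "f differentiable (at x)" for x by simp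
  then have cont: "continuous_on UNIV f"
    by (simp add: continuous_at_imp_continuous_on differentiable_imp_continuous_within)
  let ?K = "closure {x. f x \<noteq> 0}"
  have K: "compact ?K" using assms by (simp add: test_function_def)
  have "bounded (f ` ?K)"
    using K cont by (intro compact_imp_bounded compact_continuous_image) (auto intro: continuous_on_subset)
  then obtain M where M: "M > 0" "\<forall>y\<in>f ` ?K. cmod y \<le> M"
    unfolding bounded_pos by (elim exE conjE)
  obtain R where R: "\<forall>x\<in>?K. \<bar>x\<bar> \<le> R"
    using compact_imp_bounded[OF K] unfolding bounded_iff real_norm_def by (rule exE)
  have in_K: "x \<in> ?K" if "f x \<noteq> 0" for x
    by (rule subsetD[OF closure_subset]) (use that in simp)
  show ?thesis
  proof (rule bounded_csI)
    show "f \<in> borel_measurable borel" using cont by (rule borel_measurable_continuous_onI)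
    show "cmod (f x) \<le> M" for x
    proof (cases "f x = 0")
      case False
      then show ?thesis by (intro bspec[OF M(2)] imageI in_K)
    qed (use M in simp)
    show "\<bar>x\<bar> \<le> R" if "f x \<noteq> 0" for x by (rule bspec[OF R in_K[OF that]])
  qed
qed

lemma (in interval_family) sq_form_eq_Form: "sq_form N a b f g = Form f g"
  unfolding sq_form_def Form_def band_form_def
proof (intro sum.cong refl Bochner_Integration.integral_cong)
  fix k x
  have "convolve f (inv_fourier (indicator {a k..b k})) x = (LINT y|lborel. f y * kern (a k) (b k) (x - y))"
    using lborel_integral_real_affine[of "-1" "\<lambda>y. f y * kern (a k) (b k) (x - y)" x]
    unfolding convolve_def kern_def by simp
  then show "convolve f (inv_fourier (indicator {a k..b k})) x * g k x
      = g k x * (LINT y|lborel. f y * kern (a k) (b k) (x - y))"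
    by simp
qed

theorem theorem1p3:
  fixes B :: real
  shows "\<exists>K::real. K > 0 \<and>
    (\<forall>(N::nat) (a::nat \<Rightarrow> real) (b::nat \<Rightarrow> real).
       (\<forall>k\<in>{1..N}. a k \<le> b k) \<and>
       (\<forall>x::real. (\<Sum>k=1..N. indicator {a k..b k} x) \<le> B) \<longrightarrow>
       (\<forall>(f::real \<Rightarrow> complex) (g::nat \<Rightarrow> real \<Rightarrow> complex).
          test_function f \<and> (\<forall>k\<in>{1..N}. test_function (g k)) \<longrightarrow>
          (\<exists>S. sparse_family (1/6) S \<and>
               ennreal (cmod (sq_form N a b f g)) \<le> ennreal K * sparse_form S N f g)))"
\<comment> \<open>The witness depends on \<open>B\<close> alone. In HOL the square root of a
  negative number is negative, so the maximum with 1 keeps it positive for every real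
  \<open>B\<close>.\<close>
proof (intro exI[of _ "max 1 (2 * (1100 * sqrt B + 1))"] conjI allI impI; (elim conjE)?)
  fix N :: nat and a b :: "nat \<Rightarrow> real" and f :: "real \<Rightarrow> complex" and g :: "nat \<Rightarrow> real \<Rightarrow> complex"
  assume ab: "\<forall>k\<in>{1..N}. a k \<le> b k" and ov: "\<forall>x::real. (\<Sum>k=1..N. indicator {a k..b k} x) \<le> B"
    and tf: "test_function f" and tg: "\<forall>k\<in>{1..N}. test_function (g k)"
  interpret form_data N a b B f g
    using ab ov tf tg by unfold_locales (auto intro: bounded_cs_test_function)
  obtain S where S: "sparse_family (1/6) S"
    "ennreal (cmod (Form f g)) \<le> ennreal (2 * (1100 * sqrt B + 1)) * sparse_form S N f g"
    using sparse_domination by blast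
  have "ennreal (2 * (1100 * sqrt B + 1)) * sparse_form S N f g
      \<le> ennreal (max 1 (2 * (1100 * sqrt B + 1))) * sparse_form S N f g"
    by (intro mult_right_mono ennreal_leI) auto
  then show "\<exists>S. sparse_family (1/6) S \<and>
      ennreal (cmod (sq_form N a b f g)) \<le> ennreal (max 1 (2 * (1100 * sqrt B + 1))) * sparse_form S N f g"
    unfolding sq_form_eq_Form using S order_trans by blast
qed simp

end
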